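(* The universal Hecke ring $\mathcal{H}$ is a free polynomial algebra over $\mathcal{B}$, generated by the algebraically independent set of generators $T_i$, $i\in\mathbb N=\{1,2,3,\dots\}$, defined by $$T_i:=\sum_{|\mu|=i}K_\mu,$$ the sum being over all partitions $\mu$ with $|\mu|=i$.
   Context: Partitions: finite non-increasing sequences of positive integers; $\mathcal P$ is the set of all partitions (including $\emptyset$); $|\lambda|$ is the sum of the parts, $\ell(\lambda)$ the number of parts, $\mathrm{wt}(\lambda)=|\lambda|+\ell(\lambda)$. $\mathcal B$ is the ring of integer-valued polynomials in one variable with rational coefficients. $B_n\subset S_{2n}$ is the centralizer of $t=(1\,2)(3\,4)\cdots(2n-1\,2n)$. For $w\in S_{2n}$ let $\varGamma(w)$ be the multigraph on $\{1,\dots,2n\}$ with, for each $k=1,\dots,n$, an edge joining $2k-1,2k$ and an edge joining $w^{-1}(2k-1),w^{-1}(2k)$; it is a disjoint union of cycles of lengths $2\rho_1\ge2\rho_2\ge\cdots$. The partition $(\rho_1,\rho_2,\dots)$ of $n$ is the coset type of $w$, and subtracting 1 from each part (discarding zeros) gives its stable coset type. $\mathcal H_n$ is the ring of $B_n$-biinvariant functions $S_{2n}\to\mathbb Z$ with product $(f*g)(x)=\frac1{|B_n|}\sum_{y\in S_{2n}}f(xy^{-1})g(y)$; $K_\mu(n)\in\mathcal H_n$ is the indicator function of the set of $w\in S_{2n}$ of stable coset type $\mu$; those with $\mathrm{wt}(\mu)\le n$ form a $\mathbb Z$-basis. Write $K_\lambda(n)K_\mu(n)=\sum_\nu b^\nu_{\lambda\mu}(n)K_\nu(n)$.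 Then $b^\nu_{\lambda\mu}(n)=0$ if $|\nu|>|\lambda|+|\mu|$, and for $|\nu|\le|\lambda|+|\mu|$ there is a unique $f^\nu_{\lambda\mu}\in\mathcal B$ with $b^\nu_{\lambda\mu}(n)=f^\nu_{\lambda\mu}(n)$ for all $n\ge\mathrm{wt}(\nu)$. The universal Hecke ring $\mathcal H$ is the free $\mathcal B$-module on symbols $K_\mu$, $\mu\in\mathcal P$, with product $K_\lambda K_\mu=\sum_{|\nu|\le|\lambda|+|\mu|}f^\nu_{\lambda\mu}K_\nu$; it is an associative, commutative, unital $\mathcal B$-algebra with unit $K_\emptyset$. *)

theory Defs
  imports
    "HOL-Algebra.Sym_Groups"
    "HOL-Algebra.Module"
    "HOL-Algebra.QuotRing"
    "HOL-Computational_Algebra.Polynomial"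
    "HOL-Library.Poly_Mapping"
begin

section \<open>Partitions\<close>

definition is_partition :: "nat list \<Rightarrow> bool" where
  "is_partition xs \<longleftrightarrow> sorted_wrt (\<ge>) xs \<and> (\<forall>x\<in>set xs. 0 < x)"

text \<open>The size of a partition \<open>xs\<close> is \<^term>\<open>sum_list xs\<close> and its number of parts is
  \<^term>\<open>length xs\<close>.\<close>

definition wt :: "nat list \<Rightarrow> nat" where
  "wt xs = sum_list xs + length xs"


section \<open>The Hecke ring of the pair (S(2n), B(n))\<close>

definition pair_swap :: "nat \<Rightarrow> nat \<Rightarrow> nat" where
  "pair_swap n i = (if i \<in> {1..2 * n} then (if odd i then i + 1 else i - 1) else i)"

definition hyperoctahedral :: "nat \<Rightarrow> (nat \<Rightarrow> nat) set" where
  "hyperoctahedral n =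
     {b \<in> carrier (sym_group (2 * n)). b \<circ> pair_swap n = pair_swap n \<circ> b}"

text \<open>An edge of the graph is the set of its two end points. The multigraph may have parallel
  edges, which are identified here; the connected components, as sets of vertices, are not
  affected. A pair of parallel edges is a cycle of length 2, so the length of a cycle is
  always its number of vertices.\<close>

definition gamma_edges :: "nat \<Rightarrow> (nat \<Rightarrow> nat) \<Rightarrow> nat set set" where
  "gamma_edges n w =
     (\<Union>k\<in>{1..n}. {{2 * k - 1, 2 * k}, {inv' w (2 * k - 1), inv' w (2 * k)}})"

definition gamma_cycles :: "nat \<Rightarrow> (nat \<Rightarrow> nat) \<Rightarrow> nat set set" where
  "gamma_cycles n w = {1..2 * n} // {(i, j). {i, j} \<in> gamma_edges n w}\<^sup>*"

definition coset_type :: "nat \<Rightarrow> (nat \<Rightarrow> nat) \<Rightarrow> nat list" where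
  "coset_type n w =
     rev (sorted_list_of_multiset
       (image_mset (\<lambda>C. card C div 2) (mset_set (gamma_cycles n w))))"

definition stable_coset_type :: "nat \<Rightarrow> (nat \<Rightarrow> nat) \<Rightarrow> nat list" where
  "stable_coset_type n w = filter (\<lambda>r. 0 < r) (map (\<lambda>r. r - 1) (coset_type n w))"

text \<open>Functions on the symmetric group are extended by 0 to all functions on \<open>nat\<close>. They are
  rational-valued, so that the division in the convolution product is the true one, and the
  carrier requires the values to be integers.\<close>

definition hecke_ring :: "nat \<Rightarrow> ((nat \<Rightarrow> nat) \<Rightarrow> rat) ring" where
  "hecke_ring n =
    \<lparr>carrier = {f. (\<forall>w. f w \<in> \<int>) \<and> (\<forall>w. w \<notin> carrier (sym_group (2 * n)) \<longrightarrow> f w = 0) \<and>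
        (\<forall>w\<in>carrier (sym_group (2 * n)). \<forall>b\<in>hyperoctahedral n. \<forall>c\<in>hyperoctahedral n.
           f (b \<circ> w \<circ> c) = f w)},
     mult = (\<lambda>f g x. if x \<in> carrier (sym_group (2 * n))
        then (\<Sum>y\<in>carrier (sym_group (2 * n)). f (x \<circ> inv' y) * g y)
             / of_nat (card (hyperoctahedral n))
        else 0),
     one = (\<lambda>w. if w \<in> hyperoctahedral n then 1 else 0),
     zero = (\<lambda>w. 0),
     add = (\<lambda>f g w. f w + g w)\<rparr>"

definition hecke_K :: "nat \<Rightarrow> nat list \<Rightarrow> (nat \<Rightarrow> nat) \<Rightarrow> rat" where
  "hecke_K n \<mu> w =
     (if w \<in> carrier (sym_group (2 * n)) \<and> stable_coset_type n w = \<mu> then 1 else 0)"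

text \<open>The coefficients of \<open>K\<^sub>\<kappa>(n) K\<^sub>\<mu>(n)\<close> in the basis of the \<open>K\<^sub>\<nu>(n)\<close> with \<open>wt \<nu> \<le> n\<close>,
  extended by 0 to the other \<open>\<nu>\<close>.\<close>

definition hecke_coeff :: "nat \<Rightarrow> nat list \<Rightarrow> nat list \<Rightarrow> nat list \<Rightarrow> int" where
  "hecke_coeff n \<kappa> \<mu> =
    (THE b. (\<forall>\<nu>. \<not> (is_partition \<nu> \<and> wt \<nu> \<le> n) \<longrightarrow> b \<nu> = 0) \<and>
       hecke_K n \<kappa> \<otimes>\<^bsub>hecke_ring n\<^esub> hecke_K n \<mu> =
         (\<lambda>w. \<Sum>\<nu> | is_partition \<nu> \<and> wt \<nu> \<le> n. of_int (b \<nu>) * hecke_K n \<nu> w))"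


section \<open>The universal Hecke ring\<close>

definition int_valued_polys :: "rat poly ring" where
  "int_valued_polys =
    \<lparr>carrier = {p. \<forall>z::int. poly p (of_int z) \<in> \<int>},
     mult = (*), one = 1, zero = 0, add = (+)\<rparr>"

definition universal_coeff :: "nat list \<Rightarrow> nat list \<Rightarrow> nat list \<Rightarrow> rat poly" where
  "universal_coeff \<kappa> \<mu> \<nu> =
    (THE f. f \<in> carrier int_valued_polys \<and>
       (\<forall>n\<ge>wt \<nu>. poly f (of_nat n) = of_int (hecke_coeff n \<kappa> \<mu> \<nu>)))"

text \<open>The basis element \<open>K\<^sub>\<mu>\<close> is \<^term>\<open>Poly_Mapping.single \<mu> (1::rat poly)\<close>.\<close>

definition universal_hecke :: "(rat poly, nat list \<Rightarrow>\<^sub>0 rat poly) module" where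
  "universal_hecke =
    \<lparr>carrier = {x. \<forall>\<mu>\<in>Poly_Mapping.keys x.
        is_partition \<mu> \<and> Poly_Mapping.lookup x \<mu> \<in> carrier int_valued_polys},
     mult = (\<lambda>x y. \<Sum>\<kappa>\<in>Poly_Mapping.keys x. \<Sum>\<mu>\<in>Poly_Mapping.keys y.
        \<Sum>\<nu> | is_partition \<nu> \<and> sum_list \<nu> \<le> sum_list \<kappa> + sum_list \<mu>.
          Poly_Mapping.single \<nu>
            (Poly_Mapping.lookup x \<kappa> * Poly_Mapping.lookup y \<mu> * universal_coeff \<kappa> \<mu> \<nu>)),
     one = Poly_Mapping.single [] 1,
     zero = 0,
     add = (+),
     module.smult = (\<lambda>c x. Poly_Mapping.map ((*) c) x)\<rparr>"

definition hecke_T :: "nat \<Rightarrow> (nat list \<Rightarrow>\<^sub>0 rat poly)" where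
  "hecke_T i = (\<Sum>\<mu> | is_partition \<mu> \<and> sum_list \<mu> = i. Poly_Mapping.single \<mu> 1)"


section \<open>Polynomials in the variables X(1), X(2), ... over the integer-valued polynomials\<close>

text \<open>Monomials are finitely supported exponent vectors, and the product of polynomials is the
  convolution product of \<^typ>\<open>(nat \<Rightarrow>\<^sub>0 nat) \<Rightarrow>\<^sub>0 rat poly\<close>. The index 0 is excluded.\<close>

definition polynomial_algebra :: "(rat poly, (nat \<Rightarrow>\<^sub>0 nat) \<Rightarrow>\<^sub>0 rat poly) module" where
  "polynomial_algebra =
    \<lparr>carrier = {P. \<forall>m\<in>Poly_Mapping.keys P.
        Poly_Mapping.keys m \<subseteq> {1..} \<and> Poly_Mapping.lookup P m \<in> carrier int_valued_polys},
     mult = (*), one = 1, zero = 0, add = (+),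
     module.smult = (\<lambda>c P. Poly_Mapping.map ((*) c) P)\<rparr>"

definition poly_var :: "nat \<Rightarrow> ((nat \<Rightarrow>\<^sub>0 nat) \<Rightarrow>\<^sub>0 rat poly)" where
  "poly_var i = Poly_Mapping.single (Poly_Mapping.single i 1) 1"

text \<open>\<open>A\<close> is the polynomial algebra freely generated by the algebraically independent elements
  \<open>T\<^sub>1, T\<^sub>2, \<dots>\<close>: some isomorphism of algebras from the polynomial algebra onto \<open>A\<close> maps each
  variable \<open>X\<^sub>i\<close> to \<open>T\<^sub>i\<close>. Such a map is evaluation at the \<open>T\<^sub>i\<close>; its injectivity is the
  algebraic independence of the \<open>T\<^sub>i\<close>, and its surjectivity says that they generate \<open>A\<close>.\<close>

definition freely_generated_by ::
  "(rat poly, 'a) module \<Rightarrow> (nat \<Rightarrow> 'a) \<Rightarrow> bool" where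
  "freely_generated_by A T \<longleftrightarrow>
     algebra int_valued_polys A \<and>
     (\<exists>\<phi> \<in> ring_iso polynomial_algebra A.
        (\<forall>c\<in>carrier int_valued_polys. \<forall>P\<in>carrier polynomial_algebra.
           \<phi> (c \<odot>\<^bsub>polynomial_algebra\<^esub> P) = c \<odot>\<^bsub>A\<^esub> \<phi> P) \<and>
        (\<forall>i\<ge>1. \<phi> (poly_var i) = T i))"

end

theory Submission
  imports Defs
begin

text \<open>The Hecke ring of level \<open>n\<close> acts on the perfect matchings of \<open>{1..2 * n}\<close>, seen as fixed-point
  free involutions. The union of two matchings is a disjoint union of even cycles, and the double
  coset of \<open>w\<close> is the type, i.e. the list of cycle sizes, of the pair formed by the base matching
  \<open>t\<close> and its conjugate by \<open>w\<close>. Pairs of matchings are classified by their type up to permutations of the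
  vertices (\<open>pair_type_classification\<close>). Hence a structure constant counts two-step paths from \<open>t\<close> to a
  matching \<open>y\<close> whose steps have prescribed types (\<open>hecke_coeff_eq\<close>). All matchings that agree with
  \<open>t\<close> up to finitely many vertices live in one picture, independent of \<open>n\<close>; the midpoint of a path
  chooses some of the \<open>n - wt \<nu>\<close> pairs off the support of \<open>y\<close> and a configuration on them, so the count
  is a combination of binomial coefficients in \<open>n\<close> (\<open>path_count_binomial\<close>). Elements of the universal
  ring are determined by their specializations at all \<open>n\<close> (\<open>specialization_ext\<close>), and so the laws of
  an algebra reduce to manipulations of path sums.

  For the generators, the idea is to pass to symmetric functions. The sum of the transpositions
  \<open>(b 2k-1)\<close> with \<open>b < 2k-1\<close> is the Jucys--Murphy operator \<open>J\<^sub>k\<close>, and these operators commute. Each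
  matching is produced exactly once by the product of all \<open>1 + J\<^sub>k\<close> applied to \<open>t\<close>, and therefore \<open>T\<^sub>i\<close>
  specializes to the elementary symmetric function \<open>e\<^sub>i(J)\<close> applied to \<open>t\<close> (\<open>elementary_jm\<close>); as the
  Hecke ring commutes with permutations, a product of generators becomes the product of
  elementary symmetric functions (\<open>specialization_T_product\<close>). Two unitriangular changes of basis
  finish the argument.

  Firstly, \<open>e\<^sub>l(J)\<close> equals the monomial symmetric function of the conjugate partition of \<open>l\<close> plus
  monomial symmetric functions of partitions with a smaller sum of squares
  (\<open>expansion_coeff_triangular\<close>): the sum of squares of the exponents in a product of squarefree
  monomials is the sum of the sizes of all pairwise intersections, which is largest if the monomials are
  nested. Secondly, the monomial symmetric function of \<open>\<nu>\<close>, applied to \<open>t\<close>, equals \<open>K\<^sub>\<nu>\<close> plus terms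
  \<open>K\<^sub>\<kappa>\<close> where \<open>\<kappa>\<close> is smaller, or of the same size with fewer parts (\<open>msum_triangular\<close>,
  \<open>msum_diagonal\<close>): a transposition changes the distance from \<open>t\<close> by at most one, and in top degree
  each factor merges two components, so that the factors are distributed over the nontrivial
  components, with at least one index in each. The coefficients of the second change of basis may
  depend on \<open>n\<close>, but they are values of integer-valued polynomials, which is all that inverting a unitriangular
  matrix needs. So the monomials in the \<open>T\<^sub>i\<close> generate (\<open>basis_in_span\<close>) and are
  independent (\<open>T_evaluation_kernel\<close>).\<close>

section \<open>Pairs of matchings and their components\<close>

text \<open>The vertices are the positive numbers; \<open>0\<close> is a dummy fixed point.\<close>

definition base_matching :: "nat \<Rightarrow> nat" where
  "base_matching i = (if i = 0 then 0 else if odd i then i + 1 else i - 1)"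

text \<open>Matchings are continued by the base matching, so that the sets grow with \<open>n\<close> and types do not depend
  on \<open>n\<close>.\<close>

definition matchings :: "nat \<Rightarrow> (nat \<Rightarrow> nat) set" where
  "matchings n = {x. (\<forall>i. x (x i) = i) \<and> (\<forall>i\<ge>1. x i \<noteq> i) \<and>
     (\<forall>i. i \<notin> {1..2 * n} \<longrightarrow> x i = base_matching i)}"

text \<open>The connected component of \<open>v\<close> in the graph with edges \<open>{i, x i}\<close> and \<open>{i, y i}\<close>.\<close>

definition component :: "('a \<Rightarrow> 'a) \<Rightarrow> ('a \<Rightarrow> 'a) \<Rightarrow> 'a \<Rightarrow> 'a set" where
  "component x y v = {w. (v, w) \<in> {(i, j). j = x i \<or> j = y i}\<^sup>*}"

definition involution :: "('a \<Rightarrow> 'a) \<Rightarrow> bool" where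
  "involution x \<longleftrightarrow> (\<forall>i. x (x i) = i)"

text \<open>Conjugation by a transposition, i.e. its action on matchings.\<close>

definition switch :: "'a \<Rightarrow> 'a \<Rightarrow> ('a \<Rightarrow> 'a) \<Rightarrow> 'a \<Rightarrow> 'a" where
  "switch a b y = transpose a b \<circ> y \<circ> transpose a b"

lemma base_matching_simps:
  "base_matching (base_matching i) = i" "1 \<le> i \<Longrightarrow> base_matching i \<noteq> i"
  by (auto simp: base_matching_def)

lemma base_matching_odd_even:
  "1 \<le> k \<Longrightarrow> base_matching (2 * k - 1) = 2 * k" "1 \<le> k \<Longrightarrow> base_matching (2 * k) = 2 * k - 1"
  by (auto simp: base_matching_def)

lemma base_matching_range: "i \<in> {1..2 * n} \<longleftrightarrow> base_matching i \<in> {1..2 * n}"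
  by (auto simp: base_matching_def elim!: oddE evenE) presburger+

lemma base_matching_in: "base_matching \<in> matchings n"
  by (simp add: matchings_def base_matching_simps)

lemma matchings_involution: "x \<in> matchings n \<Longrightarrow> involution x"
  by (simp add: matchings_def involution_def)

lemma involutionD: "involution x \<Longrightarrow> x (x i) = i"
  by (simp add: involution_def)

lemma matchings_no_fixpoint: "x \<in> matchings n \<Longrightarrow> 1 \<le> i \<Longrightarrow> x i \<noteq> i"
  by (simp add: matchings_def)

lemma matchings_outside: "x \<in> matchings n \<Longrightarrow> i \<notin> {1..2 * n} \<Longrightarrow> x i = base_matching i"
  by (simp add: matchings_def)

lemma matchings_range:
  assumes "x \<in> matchings n" shows "x i \<in> {1..2 * n} \<longleftrightarrow> i \<in> {1..2 * n}"
proof -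
  have inv: "x (x i) = i" using assms by (simp add: matchings_def)
  show ?thesis
    using matchings_outside[OF assms, of i] matchings_outside[OF assms, of "x i"] inv
      base_matching_range[of i n] base_matching_range[of "x i" n] by metis
qed

lemma matchings_mono: "m \<le> n \<Longrightarrow> matchings m \<subseteq> matchings n"
  by (auto simp: matchings_def)

lemma matchings_pos: "x \<in> matchings n \<Longrightarrow> 1 \<le> x i \<longleftrightarrow> 1 \<le> i"
  using matchings_range[of x "n + i + x i" i] matchings_mono[of n "n + i + x i"] by auto

lemma finite_matchings: "finite (matchings n)"
proof -
  have "matchings n \<subseteq> (\<lambda>p i. if i \<in> {1..2 * n} then p i else base_matching i) `
    (PiE {1..2 * n} (\<lambda>_. {1..2 * n}))"
  proof
    fix x assume x: "x \<in> matchings n"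
    let ?p = "restrict x {1..2 * n}"
    have "?p \<in> PiE {1..2 * n} (\<lambda>_. {1..2 * n})"
      using matchings_range[OF x] by (simp add: PiE_def)
    moreover have "x = (\<lambda>i. if i \<in> {1..2 * n} then ?p i else base_matching i)"
      using matchings_outside[OF x] by auto
    ultimately show "x \<in> (\<lambda>p i. if i \<in> {1..2 * n} then p i else base_matching i) `
      (PiE {1..2 * n} (\<lambda>_. {1..2 * n}))" by blast
  qed
  thus ?thesis by (meson finite_PiE finite_atLeastAtMost finite_imageI finite_subset)
qed

lemma matchings_0: "matchings 0 = {base_matching}"
proof -
  have "x = base_matching" if "x \<in> matchings 0" for x
    using matchings_outside[OF that] by (intro ext) simp
  thus ?thesis using base_matching_in by blast
qed

subsection \<open>Components\<close>

lemma component_refl: "v \<in> component x y v"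
  by (simp add: component_def)

lemma component_closed:
  assumes "w \<in> component x y v" shows "x w \<in> component x y v" "y w \<in> component x y v"
  using assms unfolding component_def by (auto intro: rtrancl_into_rtrancl)

lemma component_least:
  assumes "v \<in> S" "\<And>w. w \<in> S \<Longrightarrow> x w \<in> S" "\<And>w. w \<in> S \<Longrightarrow> y w \<in> S"
  shows "component x y v \<subseteq> S"
proof
  fix w assume "w \<in> component x y v"
  hence "(v, w) \<in> {(i, j). j = x i \<or> j = y i}\<^sup>*" by (simp add: component_def)
  thus "w \<in> S" by (induction rule: rtrancl_induct) (use assms in auto)
qed

lemma component_eq:
  assumes "involution x" "involution y" "w \<in> component x y v"
  shows "component x y w = component x y v"
proof -
  let ?R = "{(i, j). j = x i \<or> j = y i}"
  have "sym ?R" using assms(1,2) by (auto simp: sym_def involution_def)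
  hence s: "sym (?R\<^sup>*)" by (rule sym_rtrancl)
  have "(v, w) \<in> ?R\<^sup>*" using assms(3) by (simp add: component_def)
  moreover hence "(w, v) \<in> ?R\<^sup>*" using s by (meson symE)
  ultimately show ?thesis unfolding component_def by (auto intro: rtrancl_trans)
qed

lemma component_sym:
  assumes "involution x" "involution y" "w \<in> component x y v"
  shows "v \<in> component x y w"
  using component_eq[OF assms] component_refl by metis

lemma component_disjoint:
  assumes "involution x" "involution y" "w \<notin> component x y v"
  shows "component x y w \<inter> component x y v = {}"
proof (rule ccontr)
  assume "component x y w \<inter> component x y v \<noteq> {}"
  then obtain u where u: "u \<in> component x y w" "u \<in> component x y v" by blast
  hence "component x y w = component x y v" using component_eq[OF assms(1,2)] by metis
  thus False using assms(3) component_refl[of w x y] by simp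
qed

lemma component_commute: "component x y v = component y x v"
proof -
  have "{(i, j). j = x i \<or> j = y i} = {(i, j). j = y i \<or> j = x i}" by blast
  thus ?thesis by (simp add: component_def)
qed

lemma component_trivial:
  assumes "involution x" "y v = x v" "involution y"
  shows "component x y v = {v, x v}"
proof
  have "y (x v) = v" using assms by (metis involutionD)
  thus "component x y v \<subseteq> {v, x v}"
    using assms by (intro component_least) (auto simp: involutionD)
  show "{v, x v} \<subseteq> component x y v" using component_refl component_closed(1) by fast
qed

lemma component_same:
  assumes "\<And>w. w \<in> component x y v \<Longrightarrow> y w = y' w"
    and "\<And>w. w \<in> component x y v \<Longrightarrow> x w = x' w"
  shows "component x' y' v = component x y v"
proof
  show "component x' y' v \<subseteq> component x y v"
    using component_refl[of v x y] component_closed[of _ x y v] assms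
    by (intro component_least) metis+
  have "component x y v \<subseteq> component x y v \<inter> component x' y' v"
    using component_refl[of v] component_closed[of _ x y v] component_closed[of _ x' y' v] assms
    by (intro component_least) fastforce+
  thus "component x y v \<subseteq> component x' y' v" by blast
qed

lemma component_conj:
  assumes "\<And>i. g (x i) = x' (g i)" "\<And>i. g (y i) = y' (g i)"
  shows "component x' y' (g v) = g ` component x y v"
proof
  show "component x' y' (g v) \<subseteq> g ` component x y v"
    using component_refl[of v] component_closed[of _ x y v]
    by (intro component_least) (auto simp: assms[symmetric])
  have "component x y v \<subseteq> {w. g w \<in> component x' y' (g v)}"
    using component_refl component_closed[of _ x' y' "g v"]
    by (intro component_least) (auto simp: assms)
  thus "g ` component x y v \<subseteq> component x' y' (g v)" by auto
qed

text \<open>Parity replaces the cycle shape of a component when edges are exchanged.\<close>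

lemma even_card_involution:
  assumes "finite S" "\<And>w. w \<in> S \<Longrightarrow> x w \<in> S" "\<And>w. w \<in> S \<Longrightarrow> x w \<noteq> w" "\<And>w. w \<in> S \<Longrightarrow> x (x w) = w"
  shows "even (card S)"
  using assms
proof (induction "card S" arbitrary: S rule: less_induct)
  case less
  show ?case
  proof (cases "S = {}")
    case False
    then obtain w where w: "w \<in> S" by blast
    let ?T = "S - {w, x w}"
    have sub: "{w, x w} \<subseteq> S" "card {w, x w} = 2" using less.prems(2,3)[OF w] w by auto
    have c: "card ?T = card S - 2" using sub less.prems(1) by (simp add: card_Diff_subset)
    have c2: "2 \<le> card S" using card_mono[OF less.prems(1) sub(1)] sub(2) by simp
    have clos: "x u \<in> ?T" if u: "u \<in> ?T" for u
      using u less.prems(2,4) w by (metis DiffE DiffI insertCI insertE singletonD)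
    have "even (card ?T)"
      using less.prems c c2 by (intro less.hyps clos) auto
    thus ?thesis using c c2 by simp
  qed simp
qed

lemma component_subset:
  assumes "x \<in> matchings n" "y \<in> matchings n" "v \<in> {1..2 * n}"
  shows "component x y v \<subseteq> {1..2 * n}"
  using assms matchings_range by (intro component_least) blast+

lemma component_outside:
  assumes "x \<in> matchings n" "y \<in> matchings n" "v \<notin> {1..2 * n}"
  shows "component x y v = {v, base_matching v}"
  using component_trivial[of x y v] assms by (metis matchings_involution matchings_outside)

lemma finite_component:
  assumes "x \<in> matchings n" "y \<in> matchings n" shows "finite (component x y v)"
  using component_subset[OF assms] component_outside[OF assms, of v]
  by (cases "v \<in> {1..2 * n}") (auto intro: finite_subset)

lemma component_pos:
  assumes "x \<in> matchings n" "y \<in> matchings n" "1 \<le> v" "w \<in> component x y v"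
  shows "1 \<le> w"
proof -
  have "component x y v \<subseteq> {1..}"
    using assms by (intro component_least) (auto simp: matchings_pos simp flip: One_nat_def)
  thus ?thesis using assms(4) by auto
qed

lemma even_card_component:
  assumes "x \<in> matchings n" "y \<in> matchings n" "1 \<le> v"
  shows "even (card (component x y v))"
  using assms component_closed(1)[of _ x y v] component_pos[OF assms]
  by (intro even_card_involution[of _ x] finite_component)
    (auto simp: matchings_no_fixpoint involutionD[OF matchings_involution])

lemma component_card_gt2_iff:
  assumes "x \<in> matchings n" "y \<in> matchings n"
  shows "2 < card (component x y v) \<longleftrightarrow> x v \<noteq> y v"
proof
  assume "2 < card (component x y v)"
  moreover have "card {v, x v} \<le> 2" by (simp add: card_insert_if)
  ultimately show "x v \<noteq> y v" using component_trivial[of x y v] assms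
    by (metis matchings_involution not_less)
next
  assume ne: "x v \<noteq> y v"
  hence v: "1 \<le> v" using assms by (metis matchings_outside atLeastAtMost_iff)
  have "{v, x v, y v} \<subseteq> component x y v"
    using component_refl component_closed by fast
  hence "card {v, x v, y v} \<le> card (component x y v)"
    by (rule card_mono[OF finite_component[OF assms]])
  moreover have "card {v, x v, y v} = 3"
    using ne matchings_no_fixpoint[OF assms(1) v, symmetric] matchings_no_fixpoint[OF assms(2) v, symmetric]
    by simp
  ultimately show "2 < card (component x y v)" by linarith
qed

lemma component_card_ge2:
  assumes "x \<in> matchings n" "y \<in> matchings n" "1 \<le> v"
  shows "2 \<le> card (component x y v)"
proof -
  have "{v, x v} \<subseteq> component x y v"
    using component_refl component_closed by fast
  hence "card {v, x v} \<le> card (component x y v)"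
    by (rule card_mono[OF finite_component[OF assms(1,2)]])
  moreover have "card {v, x v} = 2" using matchings_no_fixpoint[OF assms(1,3), symmetric] by simp
  ultimately show ?thesis by linarith
qed

subsection \<open>Switching\<close>

lemma switch_switch [simp]: "switch a b (switch a b y) = y"
  by (simp add: switch_def fun_eq_iff)

lemma switch_commute: "switch a b = switch b a"
  by (simp add: switch_def fun_eq_iff transpose_commute)

lemma switch_involution: "involution y \<Longrightarrow> involution (switch a b y)"
  by (simp add: involution_def switch_def)

lemma switch_matchings:
  assumes "y \<in> matchings n" "a \<in> {1..2 * n}" "b \<in> {1..2 * n}"
  shows "switch a b y \<in> matchings n"
proof -
  have "switch a b y i = base_matching i" if "i \<notin> {1..2 * n}" for i
  proof -
    have "y i \<notin> {1..2 * n}" using that matchings_range[OF assms(1)] by blast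
    hence "y i \<noteq> a" "y i \<noteq> b" "i \<noteq> a" "i \<noteq> b" using that assms(2,3) by blast+
    thus ?thesis using that assms by (simp add: switch_def matchings_outside)
  qed
  moreover have "switch a b y i \<noteq> i" if "1 \<le> i" for i
  proof
    assume "switch a b y i = i"
    hence "y (transpose a b i) = transpose a b i" by (metis comp_apply switch_def transpose_involutory)
    moreover have "1 \<le> transpose a b i" using assms(2,3) that by (auto simp: transpose_def)
    ultimately show False using assms(1) by (simp add: matchings_no_fixpoint)
  qed
  ultimately show ?thesis using assms(1) by (auto simp: matchings_def switch_def)
qed

lemma component_switch_other:
  assumes x: "involution x" and y: "involution y"
    and v: "v \<notin> component x y a" "v \<notin> component x y b"
  shows "component x (switch a b y) v = component x y v"
proof (rule component_same)
  fix w assume "w \<in> component x y v"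
  hence "w \<notin> component x y a" "w \<notin> component x y b"
    using v component_eq[OF x y] component_refl by metis+
  moreover from this have "y w \<notin> component x y a" "y w \<notin> component x y b"
    using component_closed(2)[of "y w" x y] involutionD[OF y] by metis+
  ultimately have "w \<noteq> a" "w \<noteq> b" "y w \<noteq> a" "y w \<noteq> b" using component_refl by metis+
  thus "y w = switch a b y w" by (simp add: switch_def)
qed simp

text \<open>Otherwise the part \<open>D\<close> of the old component that is still reachable from \<open>a\<close> would be a union of
  \<open>x\<close>-edges, whereas \<open>D - {a}\<close> would be a union of \<open>y\<close>-edges, contradicting parity.\<close>

lemma component_merge_aux:
  assumes x: "x \<in> matchings n" and y: "y \<in> matchings n" and a: "1 \<le> a" and b: "1 \<le> b"
    and ab: "b \<notin> component x y a"
  shows "y a \<in> component x (switch a b y) a"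
proof (rule ccontr)
  let ?y = "switch a b y"
  let ?N = "n + a + b"
  have x': "x \<in> matchings ?N" and y': "y \<in> matchings ?N"
    using x y matchings_mono[of n ?N] by auto
  have yy: "?y \<in> matchings ?N" using switch_matchings[OF y'] a b by simp
  have ix: "involution x" and iy: "involution y" using x y matchings_involution by blast+
  assume c: "y a \<notin> component x ?y a"
  let ?D = "component x ?y a \<inter> component x y a"
  have pos: "1 \<le> w" if "w \<in> ?D" for w using component_pos[OF x y a, of w] that by blast
  have fin: "finite ?D" using finite_component[OF x y] by blast
  \<comment> \<open>\<open>?D\<close> is closed under \<open>x\<close>; it is closed under \<open>y\<close> except at \<open>a\<close>.\<close>
  have "even (card ?D)"
    using component_closed(1) pos fin
    by (intro even_card_involution[of _ x])
      (auto simp: matchings_no_fixpoint[OF x] involutionD[OF ix])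
  moreover have "even (card (?D - {a}))"
  proof (intro even_card_involution[of _ y])
    fix w assume w: "w \<in> ?D - {a}"
    hence "y w \<noteq> a" using c involutionD[OF iy] by (metis DiffE IntE)
    moreover have "w \<noteq> b" using w ab by blast
    moreover have yw: "y w \<in> component x y a" using w component_closed(2) by fast
    moreover have "y w \<noteq> b" using yw ab by metis
    ultimately have "?y w = y w" using w by (simp add: switch_def)
    hence "y w \<in> component x ?y a" using w component_closed(2) by (metis DiffE IntE)
    thus "y w \<in> ?D - {a}" using yw \<open>y w \<noteq> a\<close> by blast
    show "y w \<noteq> w" using pos w matchings_no_fixpoint[OF y] by blast
    show "y (y w) = w" by (rule involutionD[OF iy])
  qed (use fin in simp)
  moreover have "a \<in> ?D" by (simp add: component_refl)
  ultimately show False using fin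
    by (metis card_Suc_Diff1 even_Suc)
qed

text \<open>The \<open>y\<close>-edges at \<open>a\<close> and \<open>b\<close> are replaced by two edges joining the components, each of which stays
  connected when it loses one edge.\<close>

lemma component_merge:
  assumes x: "x \<in> matchings n" and y: "y \<in> matchings n" and a: "1 \<le> a" and b: "1 \<le> b"
    and ab: "b \<notin> component x y a"
  shows "component x (switch a b y) a = component x y a \<union> component x y b"
proof
  let ?y = "switch a b y"
  have ix: "involution x" and iy: "involution y" using x y matchings_involution by blast+
  note iy' = switch_involution[OF iy, of a b]
  have ba: "a \<notin> component x y b" using ab component_sym[OF ix iy] by blast
  let ?U = "component x y a \<union> component x y b"
  have tau: "transpose a b w \<in> ?U" if "w \<in> ?U" for w
    using that component_refl[of a] component_refl[of b] by (auto simp: transpose_def)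
  have Uy: "y w \<in> ?U" if "w \<in> ?U" for w using that component_closed(2) by fast
  have Ux: "x w \<in> ?U" if "w \<in> ?U" for w using that component_closed(1) by fast
  show "component x ?y a \<subseteq> ?U"
  proof (rule component_least)
    show "a \<in> ?U" by (simp add: component_refl)
    fix w assume w: "w \<in> ?U"
    show "x w \<in> ?U" by (rule Ux[OF w])
    show "?y w \<in> ?U" unfolding switch_def comp_apply using tau[OF Uy[OF tau[OF w]]] .
  qed
  let ?D = "component x ?y a"
  have ya: "y a \<in> ?D" by (rule component_merge_aux[OF assms])
  have ne: "y a \<noteq> a" "y b \<noteq> b" "a \<noteq> b" "y a \<noteq> b" "y b \<noteq> a"
    using matchings_no_fixpoint[OF y a] matchings_no_fixpoint[OF y b] ab ba
      component_refl[of a x y] component_closed(2)[OF component_refl[of a x y]]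
      component_closed(2)[OF component_refl[of b x y]] by auto
  have ne2: "y a \<noteq> y b" using ne(3) iy by (metis involutionD)
  have sy: "?y (y a) = b" "?y a = y b"
    using ne ne2 involutionD[OF iy] by (simp_all add: switch_def)
  have b: "b \<in> ?D" using component_closed(2)[OF ya] sy by simp
  have yb: "y b \<in> ?D" using component_closed(2)[OF component_refl[of a x ?y]] sy by simp
  have D: "component x y v \<subseteq> ?D" if "v \<in> ?D" for v
  proof (rule component_least)
    fix w assume w: "w \<in> ?D"
    show "x w \<in> ?D" using w by (rule component_closed(1))
    show "y w \<in> ?D"
    proof (cases "w \<in> {a, b, y a, y b}")
      case True thus ?thesis using ya yb b component_refl[of a] involutionD[OF iy] by auto
    next
      case False
      have "y w \<noteq> a" "y w \<noteq> b" using involutionD[OF iy, of w] False by auto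
      hence "?y w = y w" using False by (simp add: switch_def)
      thus ?thesis using component_closed(2)[OF w] by simp
    qed
  qed (rule that)
  show "?U \<subseteq> ?D" using D[OF component_refl] D[OF b] by simp
qed

lemma component_switch_same:
  assumes x: "involution x" and y: "involution y"
    and b: "b \<in> component x y a" "b \<in> component x (switch a b y) a"
  shows "component x (switch a b y) v = component x y v"
proof -
  have sub: "component x (switch a b y) a \<subseteq> component x y a"
    if "involution y" "b \<in> component x y a" for y
  proof (rule component_least)
    show "a \<in> component x y a" by (rule component_refl)
    fix w assume w: "w \<in> component x y a"
    show "x w \<in> component x y a" using w by (rule component_closed(1))
    have tau: "transpose a b u \<in> component x y a" if "u \<in> component x y a" for u
      using that \<open>b \<in> component x y a\<close> component_refl[of a] by (auto simp: transpose_def)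
    show "switch a b y w \<in> component x y a"
      unfolding switch_def comp_apply using tau[OF component_closed(2)[OF tau[OF w]]] .
  qed
  have eq: "component x (switch a b y) a = component x y a"
    using sub[OF y b(1)] sub[OF switch_involution[OF y] b(2)] by simp
  show ?thesis
  proof (cases "v \<in> component x y a")
    case True
    thus ?thesis using eq component_eq[OF x y True]
        component_eq[OF x switch_involution[OF y], of v a b a] by simp
  next
    case False
    thus ?thesis using component_switch_other[OF x y False] component_eq[OF x y b(1)] by simp
  qed
qed

section \<open>The type of a pair of matchings\<close>

text \<open>A component on \<open>2 * (r + 1)\<close> vertices contributes the part \<open>r\<close> to the stable type.\<close>

definition excess :: "'a set \<Rightarrow> nat" where
  "excess C = card C div 2 - 1"

definition nontrivial_components :: "('a \<Rightarrow> 'a) \<Rightarrow> ('a \<Rightarrow> 'a) \<Rightarrow> 'a set set" where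
  "nontrivial_components x y = {C \<in> range (component x y). 2 < card C}"

definition pair_type :: "('a \<Rightarrow> 'a) \<Rightarrow> ('a \<Rightarrow> 'a) \<Rightarrow> nat multiset" where
  "pair_type x y = image_mset excess (mset_set (nontrivial_components x y))"

text \<open>The least number of transpositions that transform one matching into the other.\<close>

definition distance :: "('a \<Rightarrow> 'a) \<Rightarrow> ('a \<Rightarrow> 'a) \<Rightarrow> nat" where
  "distance x y = sum_mset (pair_type x y)"

definition list_of :: "nat multiset \<Rightarrow> nat list" where
  "list_of A = rev (sorted_list_of_multiset A)"

subsection \<open>Partitions as multisets\<close>

lemma mset_list_of [simp]: "mset (list_of A) = A"
  by (simp add: list_of_def)

lemma list_of_inject: "list_of A = list_of B \<longleftrightarrow> A = B"
  by (metis mset_list_of)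

lemma sum_list_list_of [simp]: "sum_list (list_of A) = sum_mset A"
  by (metis mset_list_of sum_mset_sum_list)

lemma length_list_of [simp]: "length (list_of A) = size A"
  by (metis mset_list_of size_mset)

lemma list_of_empty [simp]: "list_of {#} = []"
  by (simp add: list_of_def)

lemma is_partition_list_of: "0 \<notin># A \<Longrightarrow> is_partition (list_of A)"
  by (auto simp: is_partition_def list_of_def sorted_wrt_rev intro: gr0I)

lemma sorted_rev_eqI:
  fixes xs ys :: "nat list"
  assumes "sorted_wrt (\<ge>) xs" "sorted_wrt (\<ge>) ys" "mset xs = mset ys" shows "xs = ys"
proof -
  have "rev xs = rev ys"
    using assms properties_for_sort[of "rev xs" "rev ys"] by (simp add: sorted_wrt_rev sorted_sort_id)
  thus ?thesis by simp
qed

lemma list_of_mset: "is_partition xs \<Longrightarrow> list_of (mset xs) = xs"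
  by (rule sorted_rev_eqI) (auto simp: is_partition_def list_of_def sorted_wrt_rev)

lemma is_partition_nonzero: "is_partition xs \<Longrightarrow> 0 \<notin># mset xs"
  by (auto simp: is_partition_def)

lemma finite_partitions: "finite {xs. is_partition xs \<and> sum_list xs \<le> k}"
proof (rule finite_subset)
  show "{xs. is_partition xs \<and> sum_list xs \<le> k} \<subseteq> {xs. set xs \<subseteq> {..k} \<and> length xs \<le> k}"
  proof clarify
    fix xs assume a: "is_partition xs" "sum_list xs \<le> k"
    have "length xs \<le> sum_list xs" if "\<forall>x\<in>set xs. 0 < x" for xs :: "nat list"
      using that by (induction xs) auto
    hence "length xs \<le> sum_list xs" using a(1) by (simp add: is_partition_def)
    thus "set xs \<subseteq> {..k} \<and> length xs \<le> k" using a(2) member_le_sum_list[of _ xs] by fastforce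
  qed
qed (rule finite_lists_length_le, simp)

subsection \<open>Types and supports\<close>

lemma nontrivial_components_subset:
  assumes "x \<in> matchings n" "y \<in> matchings n" "C \<in> nontrivial_components x y"
  shows "C \<subseteq> {1..2 * n}"
proof -
  obtain v where v: "C = component x y v" "2 < card C"
    using assms(3) by (auto simp: nontrivial_components_def)
  hence "x v \<noteq> y v" using component_card_gt2_iff[OF assms(1,2)] by blast
  hence "v \<in> {1..2 * n}" using assms(1,2) matchings_outside by metis
  thus ?thesis using component_subset[OF assms(1,2)] v(1) by blast
qed

lemma finite_nontrivial_components:
  assumes "x \<in> matchings n" "y \<in> matchings n"
  shows "finite (nontrivial_components x y)"
proof (rule finite_subset)
  show "nontrivial_components x y \<subseteq> Pow {1..2 * n}"
    using nontrivial_components_subset[OF assms] by blast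
qed simp

lemma nontrivial_components_eq_component:
  assumes "involution x" "involution y" "C \<in> nontrivial_components x y" "v \<in> C"
  shows "C = component x y v"
  using assms component_eq[OF assms(1,2)] by (auto simp: nontrivial_components_def)

lemma nontrivial_components_disjoint:
  assumes "involution x" "involution y" "C \<in> nontrivial_components x y"
    "D \<in> nontrivial_components x y" "C \<noteq> D"
  shows "C \<inter> D = {}"
proof (rule ccontr)
  assume "C \<inter> D \<noteq> {}"
  then obtain v where "v \<in> C" "v \<in> D" by blast
  thus False using assms nontrivial_components_eq_component by metis
qed

lemma excess_pos:
  assumes "x \<in> matchings n" "y \<in> matchings n" "C \<in> nontrivial_components x y"
  shows "0 < excess C" "card C = 2 * (excess C + 1)"
proof -
  obtain v where v: "C = component x y v" "2 < card C"
    using assms(3) by (auto simp: nontrivial_components_def)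
  have "x v \<noteq> y v" using v component_card_gt2_iff[OF assms(1,2)] by blast
  hence "v \<in> {1..2 * n}" using assms(1,2) matchings_outside by metis
  hence "even (card C)" using even_card_component[OF assms(1,2), of v] v(1) by simp
  then obtain m where "card C = 2 * m" by blast
  thus "0 < excess C" "card C = 2 * (excess C + 1)" using v(2) by (auto simp: excess_def)
qed

lemma pair_type_nonzero:
  assumes "x \<in> matchings n" "y \<in> matchings n" shows "0 \<notin># pair_type x y"
proof
  assume "0 \<in># pair_type x y"
  then obtain C where "C \<in> nontrivial_components x y" "excess C = 0"
    using finite_nontrivial_components[OF assms] by (auto simp: pair_type_def)
  thus False using excess_pos(1)[OF assms] by fastforce
qed

lemma distance_eq_sum: "distance x y = sum excess (nontrivial_components x y)"
  by (simp add: distance_def pair_type_def sum_unfold_sum_mset)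

lemma size_pair_type: "size (pair_type x y) = card (nontrivial_components x y)"
  by (simp add: pair_type_def)

lemma pair_type_commute: "pair_type x y = pair_type y x"
  by (simp add: pair_type_def nontrivial_components_def component_commute[of x y])

lemma pair_type_conj:
  assumes "bij g" "\<And>i. g (x i) = x' (g i)" "\<And>i. g (y i) = y' (g i)"
  shows "pair_type x' y' = pair_type x y"
proof -
  have inj: "inj g" and surj: "surj g" using assms(1) by (auto simp: bij_def)
  have card: "card (g ` C) = card C" for C by (rule card_image) (rule inj_on_subset[OF inj], simp)
  have "nontrivial_components x' y' = (`) g ` nontrivial_components x y"
  proof -
    have "range (component x' y') = range (\<lambda>v. component x' y' (g v))"
      using surj by (simp add: image_image[of "component x' y'" g UNIV, symmetric])
    also have "\<dots> = (`) g ` range (component x y)"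
      by (simp add: component_conj[of g x x' y y', OF assms(2,3)] image_image)
    finally show ?thesis using card by (auto simp: nontrivial_components_def)
  qed
  moreover have "inj_on ((`) g) (nontrivial_components x y)"
    by (simp add: inj_on_def inj_image_eq_iff[OF inj])
  ultimately have "mset_set (nontrivial_components x' y')
    = image_mset ((`) g) (mset_set (nontrivial_components x y))"
    by (simp add: image_mset_mset_set)
  moreover have "excess (g ` C) = excess C" for C by (simp add: excess_def card)
  ultimately show ?thesis by (simp add: pair_type_def multiset.map_comp comp_def)
qed

lemma distance_conj:
  assumes "bij g" "\<And>i. g (x i) = x' (g i)" "\<And>i. g (y i) = y' (g i)"
  shows "distance x' y' = distance x y"
  using pair_type_conj[of g x x' y y'] assms by (simp add: distance_def)

lemma pair_type_self:
  assumes "involution x" shows "pair_type x x = {#}"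
proof -
  have "\<not> 2 < card (component x x v)" for v
    using component_trivial[OF assms refl assms, of v] by (simp add: card_insert_if)
  hence "nontrivial_components x x = {}" by (auto simp: nontrivial_components_def)
  thus ?thesis by (simp add: pair_type_def)
qed

lemma nontrivial_componentsI:
  assumes "x \<in> matchings n" "y \<in> matchings n" "x v \<noteq> y v"
  shows "component x y v \<in> nontrivial_components x y"
  using component_card_gt2_iff[OF assms(1,2)] assms(3) by (simp add: nontrivial_components_def)

lemma pair_type_empty_iff:
  assumes "x \<in> matchings n" "y \<in> matchings n"
  shows "pair_type x y = {#} \<longleftrightarrow> x = y"
proof
  assume "pair_type x y = {#}"
  hence "nontrivial_components x y = {}"
    using finite_nontrivial_components[OF assms]
    by (simp add: pair_type_def mset_set_empty_iff)
  thus "x = y" using nontrivial_componentsI[OF assms] by blast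
next
  assume "x = y" thus "pair_type x y = {#}"
    using pair_type_self matchings_involution[OF assms(1)] by blast
qed

lemma distance_eq_0_iff:
  assumes "x \<in> matchings n" "y \<in> matchings n"
  shows "distance x y = 0 \<longleftrightarrow> x = y"
proof -
  have "distance x y = 0 \<longleftrightarrow> pair_type x y = {#}"
    using pair_type_nonzero[OF assms] by (auto simp: distance_def) (metis multiset_nonemptyE)
  thus ?thesis using pair_type_empty_iff[OF assms] by simp
qed

lemma Union_nontrivial_components:
  assumes "x \<in> matchings n" "y \<in> matchings n"
  shows "\<Union> (nontrivial_components x y) = {v. x v \<noteq> y v}"
proof
  show "{v. x v \<noteq> y v} \<subseteq> \<Union> (nontrivial_components x y)"
    using nontrivial_componentsI[OF assms] component_refl by fast
  show "\<Union> (nontrivial_components x y) \<subseteq> {v. x v \<noteq> y v}"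
  proof clarify
    fix v C assume C: "C \<in> nontrivial_components x y" "v \<in> C" and eq: "x v = y v"
    have "C = component x y v"
      using nontrivial_components_eq_component C assms matchings_involution by metis
    thus False using C eq component_card_gt2_iff[OF assms] by (simp add: nontrivial_components_def)
  qed
qed

text \<open>The support is the union of the nontrivial components, and a component of excess \<open>r\<close> has
  \<open>2 * (r + 1)\<close> vertices.\<close>

lemma card_support:
  assumes "x \<in> matchings n" "y \<in> matchings n"
  shows "card {v. x v \<noteq> y v} = 2 * (distance x y + size (pair_type x y))"
proof -
  have "card {v. x v \<noteq> y v} = sum card (nontrivial_components x y)"
    unfolding Union_nontrivial_components[OF assms, symmetric]
  proof (rule card_Union_disjoint)
    show "disjoint (nontrivial_components x y)"
      unfolding disjoint_def
      using nontrivial_components_disjoint[OF matchings_involution[OF assms(1)] matchings_involution[OF assms(2)]]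
      by blast
    show "finite C" if "C \<in> nontrivial_components x y" for C
      using nontrivial_components_subset[OF assms that] finite_subset by blast
  qed
  also have "\<dots> = (\<Sum>C\<in>nontrivial_components x y. 2 * (excess C + 1))"
    using excess_pos(2)[OF assms] by (intro sum.cong) auto
  also have "\<dots> = 2 * (distance x y + size (pair_type x y))"
    unfolding distance_eq_sum size_pair_type sum_distrib_left[symmetric] sum.distrib by simp
  finally show ?thesis .
qed

lemma wt_pair_type_le:
  assumes "x \<in> matchings n" "y \<in> matchings n"
  shows "wt (list_of (pair_type x y)) \<le> n"
proof -
  have "card {v. x v \<noteq> y v} \<le> card {1..2 * n}"
    using matchings_outside[OF assms(1)] matchings_outside[OF assms(2)]
    by (intro card_mono) (auto, metis+)
  thus ?thesis by (simp add: card_support[OF assms] wt_def distance_def)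
qed

subsection \<open>The effect of a switch on the type\<close>

lemma nontrivial_components_merge:
  assumes x: "x \<in> matchings n" and y: "y \<in> matchings n" and a: "1 \<le> a" and b: "1 \<le> b"
    and ab: "b \<notin> component x y a"
  shows "nontrivial_components x (switch a b y) =
    insert (component x y a \<union> component x y b)
      (nontrivial_components x y - {component x y a, component x y b})" (is "_ = insert ?U ?N")
proof -
  let ?y = "switch a b y"
  have ix: "involution x" and iy: "involution y" using x y matchings_involution by blast+
  note iy' = switch_involution[OF iy, of a b]
  have Ua: "component x ?y a = ?U" by (rule component_merge[OF assms])
  have finU: "finite ?U" using finite_component[OF x y] by simp
  have "card ?U = card (component x y a) + card (component x y b)"
    using component_disjoint[OF ix iy ab] finite_component[OF x y]
    by (intro card_Un_disjoint) auto
  hence cU: "2 < card ?U"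
    using component_card_ge2[OF x y a] component_card_ge2[OF x y b] by simp
  have in': "component x ?y v = ?U" if "v \<in> ?U" for v
    using component_eq[OF ix iy', of v a] that Ua by simp
  have out': "component x ?y v = component x y v" if "v \<notin> ?U" for v
    using component_switch_other[OF ix iy] that by blast
  show ?thesis
  proof (intro equalityI subsetI)
    fix C assume "C \<in> nontrivial_components x ?y"
    then obtain v where v: "C = component x ?y v" "2 < card C"
      by (auto simp: nontrivial_components_def)
    show "C \<in> insert ?U ?N"
    proof (cases "v \<in> ?U")
      case True thus ?thesis using in' v by simp
    next
      case False
      hence "C = component x y v" using out' v by simp
      moreover from this have "C \<noteq> component x y a" "C \<noteq> component x y b"
        using False component_refl[of v x y] by auto
      ultimately show ?thesis using v(2) by (simp add: nontrivial_components_def)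
    qed
  next
    fix C assume C: "C \<in> insert ?U ?N"
    show "C \<in> nontrivial_components x ?y"
    proof (cases "C = ?U")
      case True thus ?thesis using Ua cU by (auto simp: nontrivial_components_def)
    next
      case False
      then obtain v where v: "C = component x y v" "2 < card C"
        "C \<noteq> component x y a" "C \<noteq> component x y b"
        using C by (auto simp: nontrivial_components_def)
      hence "v \<notin> ?U" using component_eq[OF ix iy] by blast
      hence "C = component x ?y v" using out' v(1) by simp
      thus ?thesis using v(2) by (simp add: nontrivial_components_def)
    qed
  qed
qed

lemma excess_component_trivial:
  assumes "component x y a \<notin> nontrivial_components x y" shows "excess (component x y a) = 0"
  using assms by (auto simp: nontrivial_components_def excess_def)

lemma excess_merge:
  assumes x: "x \<in> matchings n" and y: "y \<in> matchings n" and a: "1 \<le> a" and b: "1 \<le> b"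
    and ab: "b \<notin> component x y a"
  shows "excess (component x y a \<union> component x y b)
    = excess (component x y a) + excess (component x y b) + 1"
proof -
  have ix: "involution x" and iy: "involution y" using x y matchings_involution by blast+
  have "card (component x y a \<union> component x y b) = card (component x y a) + card (component x y b)"
    using component_disjoint[OF ix iy ab] finite_component[OF x y]
    by (intro card_Un_disjoint) auto
  moreover obtain p q where "card (component x y a) = 2 * p" "card (component x y b) = 2 * q"
    using even_card_component[OF x y] a b by (meson evenE)
  ultimately show ?thesis
    using component_card_ge2[OF x y a] component_card_ge2[OF x y b] by (simp add: excess_def)
qed

text \<open>Merging components with \<open>2 * (p + 1)\<close> and \<open>2 * (q + 1)\<close> vertices gives excess \<open>p + q + 1\<close>, also if one
  of them is trivial.\<close>

lemma distance_merge:
  assumes x: "x \<in> matchings n" and y: "y \<in> matchings n" and a: "1 \<le> a" and b: "1 \<le> b"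
    and ab: "b \<notin> component x y a"
  shows "distance x (switch a b y) = distance x y + 1"
proof -
  let ?A = "component x y a" and ?B = "component x y b"
  let ?N = "nontrivial_components x y"
  have fin: "finite ?N" by (rule finite_nontrivial_components[OF x y])
  have ne: "?A \<noteq> ?B" using ab component_refl by metis
  have "?A \<union> ?B \<notin> ?N - {?A, ?B}"
  proof
    assume "?A \<union> ?B \<in> ?N - {?A, ?B}"
    moreover have "a \<in> ?A \<union> ?B" using component_refl by fast
    ultimately show False
      using nontrivial_components_eq_component[of x y "?A \<union> ?B" a] matchings_involution x y by blast
  qed
  hence "distance x (switch a b y) = excess (?A \<union> ?B) + sum excess (?N - {?A, ?B})"
    unfolding distance_eq_sum nontrivial_components_merge[OF assms] using fin by simp
  also have "sum excess (?N - {?A, ?B}) + excess ?A + excess ?B = sum excess (?N \<union> {?A, ?B})"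
  proof -
    have "sum excess (?N \<union> {?A, ?B}) = sum excess (?N - {?A, ?B}) + sum excess {?A, ?B}"
      using fin by (subst sum.union_disjoint[symmetric]) (auto intro: arg_cong[of _ _ "sum excess"])
    thus ?thesis using ne by simp
  qed
  moreover have "sum excess (?N \<union> {?A, ?B}) = sum excess ?N"
    using fin excess_component_trivial by (intro sum.mono_neutral_right) auto
  ultimately show ?thesis by (simp add: distance_eq_sum excess_merge[OF assms])
qed

text \<open>As \<open>switch a b\<close> is its own inverse, splitting a component is the reverse of merging two.\<close>

lemma distance_switch_cases:
  assumes x: "x \<in> matchings n" and y: "y \<in> matchings n" and a: "1 \<le> a" and b: "1 \<le> b"
  obtains (merge) "b \<notin> component x y a" "distance x (switch a b y) = distance x y + 1"
  | (same) "b \<in> component x y a" "distance x (switch a b y) = distance x y"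
  | (split) "b \<in> component x y a" "b \<notin> component x (switch a b y) a"
      "distance x y = distance x (switch a b y) + 1"
proof -
  let ?N = "n + a + b"
  have x': "x \<in> matchings ?N" and y': "switch a b y \<in> matchings ?N"
    using x y matchings_mono[of n ?N] a b switch_matchings[of y ?N a b] by auto
  have ix: "involution x" and iy: "involution y" using x y matchings_involution by blast+
  consider "b \<notin> component x y a" | "b \<in> component x y a" "b \<in> component x (switch a b y) a"
    | "b \<in> component x y a" "b \<notin> component x (switch a b y) a" by blast
  thus thesis
  proof cases
    case 1 thus thesis using distance_merge[OF assms] merge by blast
  next
    case 2
    have "component x (switch a b y) = component x y"
      using component_switch_same[OF ix iy 2] by blast
    hence "distance x (switch a b y) = distance x y"
      by (simp add: distance_eq_sum nontrivial_components_def)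
    thus thesis using same 2 by blast
  next
    case 3
    thus thesis using distance_merge[OF x' y' a b 3(2)] split by simp
  qed
qed

lemma distance_switch_le:
  assumes "x \<in> matchings n" "y \<in> matchings n" "1 \<le> a" "1 \<le> b"
  shows "distance x (switch a b y) \<le> distance x y + 1"
  by (rule distance_switch_cases[OF assms]) auto

subsection \<open>Every partition is a type\<close>

text \<open>A new component with \<open>2 * (j + 1)\<close> vertices is grown on fresh pairs next to \<open>y\<close>, one pair at a time.\<close>

lemma pair_type_extend:
  assumes y: "y \<in> matchings m"
  shows "\<exists>z \<in> matchings (m + 1 + j). card (component base_matching z (2 * (m + 1 + j))) = 2 * (j + 1) \<and>
    nontrivial_components base_matching z =
      (if j = 0 then nontrivial_components base_matching y
       else insert (component base_matching z (2 * (m + 1 + j))) (nontrivial_components base_matching y))"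
proof (induction j)
  case 0
  have t: "involution base_matching" "involution y"
    using base_matching_in y matchings_involution by blast+
  have "y (2 * (m + 1)) = base_matching (2 * (m + 1))" using y by (intro matchings_outside) auto
  hence "component base_matching y (2 * (m + 1)) = {2 * (m + 1), 2 * m + 1}"
    using component_trivial[OF t(1) _ t(2)] base_matching_odd_even(2)[of "m + 1"] by simp
  moreover have "y \<in> matchings (m + 1)" using y matchings_mono[of m "m + 1"] by auto
  ultimately show ?case by (intro bexI[of _ y]) auto
next
  case (Suc j)
  let ?t = base_matching and ?k = "m + 1 + j"
  let ?a = "2 * ?k" and ?b = "2 * (?k + 1) - 1"
  obtain z where z: "z \<in> matchings ?k" and c: "card (component ?t z ?a) = 2 * (j + 1)"
    and N: "nontrivial_components ?t z = (if j = 0 then nontrivial_components ?t y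
       else insert (component ?t z ?a) (nontrivial_components ?t y))"
    using Suc by blast
  have z': "z \<in> matchings (?k + 1)" using z matchings_mono[of ?k "?k + 1"] by auto
  have t: "?t \<in> matchings (?k + 1)" by (rule base_matching_in)
  have it: "involution ?t" "involution z" using base_matching_in z matchings_involution by blast+
  have sub: "component ?t z ?a \<subseteq> {1..2 * ?k}"
    by (rule component_subset[OF base_matching_in z]) simp
  have ab: "?b \<notin> component ?t z ?a" using sub by auto
  have "z ?b = ?t ?b" using z by (intro matchings_outside) auto
  hence cb: "component ?t z ?b = {?b, 2 * (?k + 1)}"
    using component_trivial[OF it(1) _ it(2)] base_matching_odd_even(1)[of "?k + 1"] by simp
  let ?z = "switch ?a ?b z"
  have zm: "?z \<in> matchings (?k + 1)" by (rule switch_matchings[OF z']) auto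
  have merge: "component ?t ?z ?a = component ?t z ?a \<union> component ?t z ?b"
    by (rule component_merge[OF t z' _ _ ab]) auto
  hence eq: "component ?t ?z (2 * (?k + 1)) = component ?t z ?a \<union> component ?t z ?b"
    using component_eq[OF it(1) switch_involution[OF it(2)], of "2 * (?k + 1)" ?a ?b ?a] cb by simp
  have "card (component ?t z ?a \<union> component ?t z ?b) = 2 * (j + 1) + 2"
    using sub cb c by (subst card_Un_disjoint) (auto intro: finite_subset)
  hence card: "card (component ?t ?z (2 * (?k + 1))) = 2 * (Suc j + 1)" using eq by simp
  have nb: "component ?t z ?b \<notin> nontrivial_components ?t z"
    using cb by (auto simp: nontrivial_components_def)
  have na: "component ?t z ?a \<notin> nontrivial_components ?t y"
  proof
    assume "component ?t z ?a \<in> nontrivial_components ?t y"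
    hence "?a \<in> {1..2 * m}"
      using nontrivial_components_subset[OF base_matching_in y] component_refl[of ?a ?t z] by blast
    thus False by simp
  qed
  have nby: "component ?t z ?b \<notin> nontrivial_components ?t y"
    using cb by (auto simp: nontrivial_components_def)
  have "nontrivial_components ?t ?z = insert (component ?t z ?a \<union> component ?t z ?b)
      (nontrivial_components ?t z - {component ?t z ?a, component ?t z ?b})"
    by (rule nontrivial_components_merge[OF t z' _ _ ab]) auto
  also have "nontrivial_components ?t z - {component ?t z ?a, component ?t z ?b}
    = nontrivial_components ?t y"
    using N na nby by auto
  finally have "nontrivial_components ?t ?z
    = insert (component ?t ?z (2 * (?k + 1))) (nontrivial_components ?t y)" using eq by simp
  thus ?case using zm card by (intro bexI[of _ ?z]) auto
qed

lemma pair_type_exists: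
  assumes "0 \<notin># A"
  shows "\<exists>y \<in> matchings (sum_mset A + size A). pair_type base_matching y = A"
  using assms
proof (induction A)
  case empty
  thus ?case using base_matching_in pair_type_self matchings_involution by fastforce
next
  case (add r A)
  let ?t = base_matching and ?m = "sum_mset A + size A"
  obtain y where y: "y \<in> matchings ?m" "pair_type ?t y = A" using add by auto
  have r: "r \<noteq> 0" using add.prems by auto
  obtain z where z: "z \<in> matchings (?m + 1 + r)"
    and c: "card (component ?t z (2 * (?m + 1 + r))) = 2 * (r + 1)"
    and N: "nontrivial_components ?t z
      = insert (component ?t z (2 * (?m + 1 + r))) (nontrivial_components ?t y)"
    using pair_type_extend[OF y(1), of r] r by auto
  let ?C = "component ?t z (2 * (?m + 1 + r))"
  have "?C \<notin> nontrivial_components ?t y"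
  proof
    assume "?C \<in> nontrivial_components ?t y"
    hence "2 * (?m + 1 + r) \<in> {1..2 * ?m}"
      using nontrivial_components_subset[OF base_matching_in y(1)]
        component_refl[of "2 * (?m + 1 + r)" ?t z] by blast
    thus False by simp
  qed
  hence "pair_type ?t z = add_mset (excess ?C) (pair_type ?t y)"
    unfolding pair_type_def N using finite_nontrivial_components[OF base_matching_in y(1)] by simp
  hence "pair_type ?t z = add_mset r A" using y(2) c by (simp add: excess_def)
  moreover have "?m + 1 + r = sum_mset (add_mset r A) + size (add_mset r A)" by simp
  ultimately show ?case using z by metis
qed

section \<open>Pairs of matchings are classified by their type\<close>

text \<open>Alternating steps, beginning with a step along \<open>y\<close>.\<close>

primrec walk :: "('a \<Rightarrow> 'a) \<Rightarrow> ('a \<Rightarrow> 'a) \<Rightarrow> 'a \<Rightarrow> nat \<Rightarrow> 'a" where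
  "walk x y v 0 = v"
| "walk x y v (Suc i) = (if even i then y else x) (walk x y v i)"

context
  fixes x y :: "nat \<Rightarrow> nat" and n v :: nat
  assumes x: "x \<in> matchings n" and y: "y \<in> matchings n" and v: "1 \<le> v"
begin

private lemma ix: "x (x i) = i" and iy: "y (y i) = i"
  using x y by (simp_all add: matchings_def)

private abbreviation "a \<equiv> walk x y v"

private lemma walk_in: "a i \<in> component x y v"
  by (induction i) (auto simp: component_refl intro: component_closed)

private lemma walk_pos: "1 \<le> a i"
  using component_pos[OF x y v walk_in] .

private lemma walk_back: "(if even i then y else x) (a (Suc i)) = a i"
  by (simp add: ix iy)

text \<open>If a walk returned to a vertex after an odd number of steps, then walking inwards from both ends would
  lead to a step that does not move.\<close>

private lemma walk_parity: "a i = a (i + m) \<Longrightarrow> even m"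
proof (induction m arbitrary: i rule: less_induct)
  case (less m)
  show ?case
  proof (rule ccontr)
    assume odd: "odd m"
    then obtain l where l: "m = Suc l" by (metis odd_pos gr0_implies_Suc)
    have op: "even (i + l) = even i" using odd l by simp
    have "a (Suc i) = a (i + l)"
      using less.prems walk_back[of "i + l"] op l by simp
    moreover have ne: "a (Suc i) \<noteq> a i"
      using matchings_no_fixpoint[OF x walk_pos] matchings_no_fixpoint[OF y walk_pos] by simp
    have "l \<noteq> 0"
    proof
      assume "l = 0"
      hence "a (Suc i) = a i" using \<open>a (Suc i) = a (i + l)\<close> by (simp only: add_0_right)
      thus False using ne by blast
    qed
    then obtain k where k: "l = Suc k" by (cases l) auto
    have "a (Suc i) = a (Suc i + k)" using \<open>a (Suc i) = a (i + l)\<close> unfolding k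
      by (simp only: add_Suc add_Suc_right)
    moreover have "k < m" using l k by simp
    ultimately have "even k" using less.IH by blast
    thus False using odd l k by simp
  qed
qed

private lemma walk_shift_back: "a i = a (i + m) \<Longrightarrow> a m = v"
proof (induction i)
  case (Suc i)
  have "even m" using walk_parity[OF Suc.prems] .
  hence "even (i + m) = even i" by simp
  hence "a i = a (i + m)" using Suc.prems walk_back[of i] walk_back[of "i + m"] by (metis add_Suc)
  thus ?case by (rule Suc.IH)
qed simp

private lemma walk_shift: "a m = v \<Longrightarrow> a (i + m) = a i"
proof (induction i)
  case (Suc i)
  have "even m" using walk_parity[of 0 m] Suc.prems by simp
  thus ?case using Suc by simp
qed simp

private definition "N = (LEAST m. 0 < m \<and> a m = v)"

private lemma N: "0 < N" "a N = v"
proof -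
  have "\<not> inj a"
    using finite_component[OF x y, of v] walk_in finite_subset[of "range a"] finite_imageD[of a UNIV]
    by (metis image_subsetI infinite_UNIV_nat)
  then obtain i j where "i < j" "a i = a j" by (metis injI linorder_neqE_nat)
  hence "a (j - i) = v" "0 < j - i" using walk_shift_back[of i "j - i"] by auto
  hence "\<exists>m. 0 < m \<and> a m = v" by blast
  thus "0 < N" "a N = v" unfolding N_def by (metis (mono_tags, lifting) LeastI)+
qed

private lemma walk_mod: "a (i mod N) = a i"
proof -
  have "a (r + N * q) = a r" for r q
  proof (induction q)
    case (Suc q)
    have "a (r + N * Suc q) = a ((r + N * q) + N)" by (simp add: algebra_simps)
    thus ?case using walk_shift[OF N(2)] Suc by simp
  qed simp
  from this[of "i mod N" "i div N"] show ?thesis by simp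
qed

private lemma walk_inj: "inj_on a {..<N}"
proof (rule inj_onI)
  have *: "\<not> i < j" if "i < N" "j < N" "a i = a j" for i j
  proof
    assume "i < j"
    hence "a (j - i) = v" using walk_shift_back[of i "j - i"] that by simp
    hence "N \<le> j - i" using \<open>i < j\<close> unfolding N_def by (intro Least_le) simp
    thus False using that \<open>i < j\<close> by simp
  qed
  fix i j assume "i \<in> {..<N}" "j \<in> {..<N}" "a i = a j"
  thus "i = j" using *[of i j] *[of j i] by simp
qed

text \<open>The step that is not taken at time \<open>i\<close> goes back to time \<open>i - 1\<close>, written as \<open>i + N - 1\<close> by
  periodicity in order to cover \<open>i = 0\<close>.\<close>

private lemma walk_other: "(if even i then x else y) (a i) = a (i + N - 1)"
proof -
  obtain k where k: "N = Suc k" using N(1) gr0_implies_Suc by blast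
  have "even N" using walk_parity[of 0 N] N by simp
  hence "odd k" using k by simp
  have "a i = a (Suc (i + k))" using walk_shift[OF N(2), of i] k by simp
  moreover have "even (i + k) \<longleftrightarrow> odd i" using \<open>odd k\<close> by simp
  ultimately show ?thesis using walk_back[of "i + k"] k by (auto split: if_splits)
qed

private lemma walk_range: "range a = component x y v"
proof
  show "range a \<subseteq> component x y v" using walk_in by blast
  show "component x y v \<subseteq> range a"
  proof (rule component_least)
    show "v \<in> range a" using rangeI[of a 0] by simp
    fix w assume "w \<in> range a"
    then obtain i where i: "w = a i" by blast
    have "x w = (if even i then a (i + N - 1) else a (Suc i))"
      using walk_other[of i] i by auto
    thus "x w \<in> range a" by (metis rangeI)
    have "y w = (if even i then a (Suc i) else a (i + N - 1))"
      using walk_other[of i] i by auto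
    thus "y w \<in> range a" by (metis rangeI)
  qed
qed

private lemma N_eq: "N = card (component x y v)"
proof -
  have "range a = a ` {..<N}"
  proof
    show "range a \<subseteq> a ` {..<N}"
    proof clarify
      fix i show "a i \<in> a ` {..<N}" using walk_mod[of i] N(1) by (metis imageI lessThan_iff mod_less_divisor)
    qed
  qed blast
  thus ?thesis using walk_range card_image[OF walk_inj] by simp
qed

lemma component_walk: "component x y v = range (walk x y v)"
  using walk_range by simp

text \<open>A component is a cycle: alternating steps run through it with period its size.\<close>

lemma walk_eq_iff:
  "walk x y v i = walk x y v j \<longleftrightarrow> i mod card (component x y v) = j mod card (component x y v)"
proof
  assume "a i = a j"
  hence "a (i mod N) = a (j mod N)" by (simp add: walk_mod)
  moreover have "i mod N < N" "j mod N < N" using N(1) by simp_all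
  ultimately show "i mod card (component x y v) = j mod card (component x y v)"
    unfolding N_eq[symmetric] using inj_onD[OF walk_inj, of "i mod N" "j mod N"] by simp
next
  assume "i mod card (component x y v) = j mod card (component x y v)"
  hence "a (i mod N) = a (j mod N)" by (simp add: N_eq)
  thus "a i = a j" by (simp add: walk_mod)
qed

lemma walk_step:
  "x (walk x y v i) = walk x y v (if even i then i + card (component x y v) - 1 else Suc i)"
  "y (walk x y v i) = walk x y v (if even i then Suc i else i + card (component x y v) - 1)"
  using walk_other[of i] by (auto simp: N_eq split: if_splits)

end

text \<open>The map between components that follows corresponding walks from \<open>v\<close> and from \<open>v'\<close>.\<close>

definition transport ::
  "(nat \<Rightarrow> nat) \<Rightarrow> (nat \<Rightarrow> nat) \<Rightarrow> nat \<Rightarrow> (nat \<Rightarrow> nat) \<Rightarrow> (nat \<Rightarrow> nat) \<Rightarrow> nat \<Rightarrow> nat \<Rightarrow> nat" where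
  "transport x y v x' y' v' w = walk x' y' v' (LEAST i. walk x y v i = w)"

lemma transport_props:
  assumes x: "x \<in> matchings n" and y: "y \<in> matchings n" and v: "1 \<le> v"
    and x': "x' \<in> matchings n" and y': "y' \<in> matchings n" and v': "1 \<le> v'"
    and card: "card (component x y v) = card (component x' y' v')"
  defines "g \<equiv> transport x y v x' y' v'"
  shows "w \<in> component x y v \<Longrightarrow> g (x w) = x' (g w)"
    and "w \<in> component x y v \<Longrightarrow> g (y w) = y' (g w)"
    and "g ` component x y v = component x' y' v'"
proof -
  have g: "g (walk x y v i) = walk x' y' v' i" for i
  proof -
    have "walk x y v (LEAST j. walk x y v j = walk x y v i) = walk x y v i"
      by (rule LeastI[of "\<lambda>j. walk x y v j = walk x y v i" i]) simp
    thus ?thesis unfolding g_def transport_def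
      using walk_eq_iff[OF x y v] walk_eq_iff[OF x' y' v'] card by simp
  qed
  show "g ` component x y v = component x' y' v'"
    unfolding component_walk[OF x y v] component_walk[OF x' y' v'] image_image g by simp
  assume "w \<in> component x y v"
  then obtain i where i: "w = walk x y v i" using component_walk[OF x y v] by blast
  show "g (x w) = x' (g w)" "g (y w) = y' (g w)"
    unfolding i walk_step[OF x y v] g walk_step[OF x' y' v'] card by simp_all
qed

text \<open>Here trivial components are included, as they have to be matched up as well.\<close>

definition components :: "nat \<Rightarrow> (nat \<Rightarrow> nat) \<Rightarrow> (nat \<Rightarrow> nat) \<Rightarrow> nat set set" where
  "components n x y = component x y ` {1..2 * n}"

context
  fixes x y :: "nat \<Rightarrow> nat" and n :: nat
  assumes x: "x \<in> matchings n" and y: "y \<in> matchings n"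
begin

lemma nontrivial_components_alt:
  "nontrivial_components x y = {C \<in> components n x y. 0 < excess C}"
proof (intro equalityI subsetI)
  fix C assume C: "C \<in> nontrivial_components x y"
  then obtain v where v: "C = component x y v" by (auto simp: nontrivial_components_def)
  hence "v \<in> {1..2 * n}"
    using nontrivial_components_subset[OF x y C] component_refl[of v x y] by blast
  thus "C \<in> {C \<in> components n x y. 0 < excess C}"
    using v excess_pos(1)[OF x y C] by (simp add: components_def)
next
  fix C assume "C \<in> {C \<in> components n x y. 0 < excess C}"
  thus "C \<in> nontrivial_components x y"
    by (auto simp: nontrivial_components_def components_def excess_def)
qed

lemma card_components_mem:
  assumes "C \<in> components n x y" shows "card C = 2 * (excess C + 1)"
proof -
  obtain v where v: "C = component x y v" "1 \<le> v" using assms by (auto simp: components_def)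
  obtain m where "card C = 2 * m" using even_card_component[OF x y v(2)] v(1) by blast
  thus ?thesis using component_card_ge2[OF x y v(2)] v(1) by (simp add: excess_def)
qed

lemma Union_components: "\<Union> (components n x y) = {1..2 * n}"
proof
  show "\<Union> (components n x y) \<subseteq> {1..2 * n}"
    unfolding components_def using component_subset[OF x y] by blast
  show "{1..2 * n} \<subseteq> \<Union> (components n x y)"
  proof
    fix v assume "v \<in> {1..2 * n}"
    thus "v \<in> \<Union> (components n x y)"
      unfolding components_def using component_refl[of v x y] by blast
  qed
qed

lemma components_disjoint: "disjoint (components n x y)"
  unfolding disjoint_def
proof (intro ballI impI)
  fix C D assume "C \<in> components n x y" "D \<in> components n x y" and ne: "C \<noteq> D"
  then obtain v w where vw: "C = component x y v" "D = component x y w"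
    by (auto simp: components_def)
  have i: "involution x" "involution y" using x y matchings_involution by blast+
  have "w \<notin> component x y v" using ne vw component_eq[OF i, of w v] by auto
  thus "C \<inter> D = {}" using component_disjoint[OF i] vw by blast
qed

lemma distance_plus_card_components: "distance x y + card (components n x y) = n"
proof -
  have fin: "finite (components n x y)" by (simp add: components_def)
  have "2 * n = card (\<Union> (components n x y))" by (simp add: Union_components)
  also have "\<dots> = sum card (components n x y)"
    by (rule card_Union_disjoint[OF components_disjoint])
      (auto simp: components_def finite_component[OF x y])
  also have "\<dots> = (\<Sum>C\<in>components n x y. 2 * (excess C + 1))"
    by (rule sum.cong) (auto simp: card_components_mem)
  also have "\<dots> = 2 * (sum excess (components n x y) + card (components n x y))"
    unfolding sum_distrib_left[symmetric] sum.distrib by simp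
  also have "sum excess (components n x y) = distance x y"
    unfolding distance_eq_sum nontrivial_components_alt
    using fin by (intro sum.mono_neutral_right) auto
  finally show ?thesis by simp
qed

lemma excess_components_mset:
  "image_mset excess (mset_set (components n x y))
    = pair_type x y + replicate_mset (n - distance x y - size (pair_type x y)) 0"
proof -
  let ?T = "{C \<in> components n x y. excess C = 0}"
  have fin: "finite (components n x y)" by (simp add: components_def)
  have un: "components n x y = nontrivial_components x y \<union> ?T"
    and dis: "nontrivial_components x y \<inter> ?T = {}"
    by (auto simp: nontrivial_components_alt)
  have finN: "finite (nontrivial_components x y)" and finT: "finite ?T"
    using fin by (auto simp: nontrivial_components_alt)
  have "card (components n x y) = size (pair_type x y) + card ?T"
    unfolding size_pair_type by (subst un) (rule card_Un_disjoint[OF finN finT dis])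
  hence c: "card ?T = n - distance x y - size (pair_type x y)"
    using distance_plus_card_components by linarith
  have "image_mset excess (mset_set (components n x y))
    = pair_type x y + image_mset excess (mset_set ?T)"
    unfolding pair_type_def by (subst un) (simp add: mset_set_Union[OF finN finT dis])
  also have "image_mset excess (mset_set ?T) = image_mset (\<lambda>_. 0) (mset_set ?T)"
    using finT by (intro image_mset_cong) auto
  also have "\<dots> = replicate_mset (card ?T) 0" by (simp add: image_mset_const_eq)
  finally show ?thesis by (simp add: c)
qed

end

lemma bij_of_image_mset_eq:
  assumes "finite A" "finite B" "image_mset f (mset_set A) = image_mset g (mset_set B)"
  shows "\<exists>\<beta>. bij_betw \<beta> A B \<and> (\<forall>a\<in>A. g (\<beta> a) = f a)"
  using assms
proof (induction A arbitrary: B rule: finite_induct)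
  case empty
  thus ?case by (auto simp: mset_set_empty_iff bij_betw_def)
next
  case (insert a A)
  hence "f a \<in># image_mset g (mset_set B)" by (metis finite_insert image_eqI insertI1 set_image_mset finite_set_mset_mset_set)
  then obtain b where b: "b \<in> B" "g b = f a" using insert.prems by auto
  hence "mset_set B = add_mset b (mset_set (B - {b}))"
    using insert.prems(1) by (simp add: mset_set.remove)
  hence "image_mset f (mset_set A) = image_mset g (mset_set (B - {b}))"
    using insert b by simp
  then obtain \<beta> where \<beta>: "bij_betw \<beta> A (B - {b})" "\<forall>a\<in>A. g (\<beta> a) = f a"
    using insert.IH[of "B - {b}"] insert.prems(1) by auto
  let ?\<beta> = "\<beta>(a := b)"
  have "bij_betw ?\<beta> A (B - {b})" using \<beta>(1) insert.hyps(2)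
    by (subst bij_betw_cong[of A ?\<beta> \<beta>]) auto
  hence "bij_betw ?\<beta> (insert a A) (insert b (B - {b}))"
    using insert.hyps(2) notIn_Un_bij_betw[of a A ?\<beta> "B - {b}"] by simp
  hence "bij_betw ?\<beta> (insert a A) B" using b by (simp add: insert_absorb)
  moreover have "\<forall>c\<in>insert a A. g (?\<beta> c) = f c" using \<beta>(2) b insert.hyps(2) by auto
  ultimately show ?case by blast
qed

text \<open>Match the components by size and transport each one along alternating walks from chosen base points.
  The edges of both matchings are steps of the walks, so that they are carried along.\<close>

theorem pair_type_classification:
  assumes x: "x \<in> matchings n" and y: "y \<in> matchings n"
    and x': "x' \<in> matchings n" and y': "y' \<in> matchings n"
    and type: "pair_type x y = pair_type x' y'"
  shows "\<exists>g. g permutes {1..2 * n} \<and> (\<forall>i. g (x i) = x' (g i)) \<and> (\<forall>i. g (y i) = y' (g i))"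
proof -
  have dist: "distance x y = distance x' y'" using type by (simp add: distance_def)
  have i: "involution x" "involution y" using x y matchings_involution by blast+
  have i': "involution x'" "involution y'" using x' y' matchings_involution by blast+
  have fin: "finite (components n x y)" "finite (components n x' y')" by (auto simp: components_def)
  obtain \<beta> where \<beta>: "bij_betw \<beta> (components n x y) (components n x' y')"
    and ex: "\<forall>C\<in>components n x y. excess (\<beta> C) = excess C"
    using bij_of_image_mset_eq[OF fin, of excess excess]
    unfolding excess_components_mset[OF x y] excess_components_mset[OF x' y'] type dist by auto
  define r where "r C = (SOME v. v \<in> C)" for C :: "nat set"
  have r: "C = component x y (r C) \<and> 1 \<le> r C" if "C \<in> components n x y" for C
  proof -
    obtain v where v: "C = component x y v" "1 \<le> v" using \<open>C \<in> components n x y\<close> by (auto simp: components_def)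
    hence "r C \<in> C" unfolding r_def using component_refl[of v x y] by (metis someI_ex)
    thus ?thesis using v component_eq[OF i, of "r C" v] component_pos[OF x y v(2)] by auto
  qed
  have r': "C = component x' y' (r C) \<and> 1 \<le> r C" if "C \<in> components n x' y'" for C
  proof -
    obtain v where v: "C = component x' y' v" "1 \<le> v" using \<open>C \<in> components n x' y'\<close> by (auto simp: components_def)
    hence "r C \<in> C" unfolding r_def using component_refl[of v x' y'] by (metis someI_ex)
    thus ?thesis using v component_eq[OF i', of "r C" v] component_pos[OF x' y' v(2)] by auto
  qed
  define tr where "tr C = transport x y (r C) x' y' (r (\<beta> C))" for C
  have tr: "w \<in> C \<Longrightarrow> tr C (x w) = x' (tr C w)" "w \<in> C \<Longrightarrow> tr C (y w) = y' (tr C w)"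
    "tr C ` C = \<beta> C" if C: "C \<in> components n x y" for C w
  proof -
    have bC: "\<beta> C \<in> components n x' y'" using C \<beta> by (auto simp: bij_betw_def)
    have "card C = card (\<beta> C)"
      using card_components_mem[OF x y C] card_components_mem[OF x' y' bC] ex C by simp
    hence card: "card (component x y (r C)) = card (component x' y' (r (\<beta> C)))"
      using r[OF C] r'[OF bC] by simp
    note t = transport_props[OF x y _ x' y' _ card, folded tr_def]
    show "w \<in> C \<Longrightarrow> tr C (x w) = x' (tr C w)" "w \<in> C \<Longrightarrow> tr C (y w) = y' (tr C w)"
      "tr C ` C = \<beta> C" using t r[OF C] r'[OF bC] by auto
  qed
  define g where "g w = (if w \<in> {1..2 * n} then tr (component x y w) w else w)" for w
  have comp: "component x y w \<in> components n x y" if "w \<in> {1..2 * n}" for w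
    using that by (simp add: components_def)
  have inter: "g (x w) = x' (g w) \<and> g (y w) = y' (g w)" for w
  proof (cases "w \<in> {1..2 * n}")
    case True
    have "component x y (x w) = component x y w" "component x y (y w) = component x y w"
      using component_eq[OF i component_closed(1)[OF component_refl]]
        component_eq[OF i component_closed(2)[OF component_refl]] by blast+
    moreover have "x w \<in> {1..2 * n}" "y w \<in> {1..2 * n}"
      using True matchings_range[OF x] matchings_range[OF y] by blast+
    ultimately have "g (x w) = tr (component x y w) (x w)" "g (y w) = tr (component x y w) (y w)"
      "g w = tr (component x y w) w" unfolding g_def using True by simp_all
    thus ?thesis using tr(1,2)[OF comp[OF True] component_refl] by simp
  next
    case False
    moreover have "x w \<notin> {1..2 * n}" "y w \<notin> {1..2 * n}"
      using False matchings_range[OF x] matchings_range[OF y] by blast+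
    moreover have "x w = x' w" "y w = y' w"
      using False x y x' y' matchings_outside by metis+
    ultimately show ?thesis unfolding g_def by metis
  qed
  have gC: "g ` C = \<beta> C" if C: "C \<in> components n x y" for C
  proof -
    have "g w = tr C w" if "w \<in> C" for w
    proof -
      have "w \<in> {1..2 * n}" using that C Union_components[OF x y] by blast
      moreover have "component x y w = C" using r[OF C] component_eq[OF i, of w "r C"] that by simp
      ultimately show ?thesis by (simp add: g_def)
    qed
    thus ?thesis using tr(3)[OF C] by simp
  qed
  have "g ` {1..2 * n} = (\<Union>C\<in>components n x y. g ` C)"
    unfolding Union_components[OF x y, symmetric] by blast
  also have "\<dots> = \<Union> (\<beta> ` components n x y)" using gC by simp
  also have "\<dots> = {1..2 * n}"
    using \<beta> Union_components[OF x' y'] by (simp add: bij_betw_def)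
  finally have surj: "g ` {1..2 * n} = {1..2 * n}" .
  hence "bij_betw g {1..2 * n} {1..2 * n}"
    by (simp add: bij_betw_def eq_card_imp_inj_on)
  hence "g permutes {1..2 * n}" by (rule bij_imp_permutes) (auto simp: g_def)
  thus ?thesis using inter by blast
qed

section \<open>Permutations and matchings\<close>

definition matching_of :: "(nat \<Rightarrow> nat) \<Rightarrow> nat \<Rightarrow> nat" where
  "matching_of w = inv' w \<circ> base_matching \<circ> w"

definition stable_type :: "(nat \<Rightarrow> nat) \<Rightarrow> (nat \<Rightarrow> nat) \<Rightarrow> nat list" where
  "stable_type x y = list_of (pair_type x y)"

lemma matching_of_in:
  assumes w: "w permutes {1..2 * n}" shows "matching_of w \<in> matchings n"
proof -
  have out: "matching_of w i = base_matching i" if "i \<notin> {1..2 * n}" for i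
  proof -
    have "w i = i" using w that by (rule permutes_not_in)
    moreover have "inv' w (base_matching i) = base_matching i"
      using permutes_not_in[OF permutes_inv[OF w]] that base_matching_range[of i n] by blast
    ultimately show ?thesis by (simp add: matching_of_def)
  qed
  have "matching_of w i \<noteq> i" if "1 \<le> i" for i
  proof
    assume "matching_of w i = i"
    hence "base_matching (w i) = w i"
      by (metis comp_apply matching_of_def permutes_inverses(1)[OF w])
    moreover have "1 \<le> w i"
      using that permutes_in_image[OF w, of i] permutes_not_in[OF w, of i] by (cases "i \<in> {1..2 * n}") auto
    ultimately show False using base_matching_simps(2) by blast
  qed
  thus ?thesis using out
    by (auto simp: matchings_def matching_of_def permutes_inverses[OF w] base_matching_simps)
qed

lemma matching_of_apply:
  assumes "w permutes {1..2 * n}" shows "w (matching_of w i) = base_matching (w i)"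
  by (simp add: matching_of_def permutes_inverses[OF assms])

text \<open>The pair \<open>(z, z)\<close> has the same type as the pair formed by the base matching twice.\<close>

lemma matching_of_surj:
  assumes "z \<in> matchings n" shows "\<exists>w. w permutes {1..2 * n} \<and> matching_of w = z"
proof -
  have "pair_type z z = pair_type base_matching base_matching"
    using pair_type_self matchings_involution assms base_matching_in by metis
  then obtain g where g: "g permutes {1..2 * n}" "\<forall>i. g (z i) = base_matching (g i)"
    using pair_type_classification[OF assms assms base_matching_in base_matching_in] by blast
  have "matching_of g = z"
    by (rule ext) (simp add: matching_of_def g(2)[rule_format, symmetric] permutes_inverses[OF g(1)])
  thus ?thesis using g by blast
qed

lemma hyperoctahedral_iff:
  "b \<in> hyperoctahedral n \<longleftrightarrow> b permutes {1..2 * n} \<and> (\<forall>i. b (base_matching i) = base_matching (b i))"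
proof -
  have ps: "pair_swap n i = base_matching i" if "i \<in> {1..2 * n}" for i
    using that by (auto simp: pair_swap_def base_matching_def)
  have "b \<circ> pair_swap n = pair_swap n \<circ> b \<longleftrightarrow> (\<forall>i. b (base_matching i) = base_matching (b i))"
    if b: "b permutes {1..2 * n}"
  proof -
    have "b (pair_swap n i) = pair_swap n (b i) \<longleftrightarrow> b (base_matching i) = base_matching (b i)" for i
    proof (cases "i \<in> {1..2 * n}")
      case True
      thus ?thesis using ps[of i] ps[of "b i"] permutes_in_image[OF b, of i] by simp
    next
      case False
      hence "b i = i" "b (base_matching i) = base_matching i"
        using permutes_not_in[OF b] base_matching_range[of i n] by blast+
      thus ?thesis using False by (auto simp: pair_swap_def)
    qed
    thus ?thesis by (simp add: fun_eq_iff)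
  qed
  thus ?thesis by (auto simp: hyperoctahedral_def sym_group_carrier)
qed

text \<open>The fibres are right cosets of the stabilizer of the base matching.\<close>

lemma card_matching_of_fibre:
  assumes z: "z \<in> matchings n"
  shows "card {w \<in> carrier (sym_group (2 * n)). matching_of w = z} = card (hyperoctahedral n)"
proof -
  obtain w where w: "w permutes {1..2 * n}" "matching_of w = z" using matching_of_surj[OF z] by blast
  note wi = permutes_inverses[OF w(1)]
  have "bij_betw (\<lambda>b. b \<circ> w) (hyperoctahedral n) {w \<in> carrier (sym_group (2 * n)). matching_of w = z}"
  proof (rule bij_betwI[where g = "\<lambda>u. u \<circ> inv' w"])
    show "(\<lambda>b. b \<circ> w) \<in> hyperoctahedral n \<rightarrow> {w \<in> carrier (sym_group (2 * n)). matching_of w = z}"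
    proof
      fix b assume "b \<in> hyperoctahedral n"
      hence b: "b permutes {1..2 * n}" "\<And>i. b (base_matching i) = base_matching (b i)"
        by (auto simp: hyperoctahedral_iff)
      have bw: "(b \<circ> w) permutes {1..2 * n}" using b(1) w(1) permutes_compose by blast
      have "matching_of (b \<circ> w) = matching_of w"
      proof
        fix i
        have "(b \<circ> w) (matching_of (b \<circ> w) i) = (b \<circ> w) (matching_of w i)"
          unfolding matching_of_apply[OF bw] by (simp add: matching_of_apply[OF w(1)] b(2))
        thus "matching_of (b \<circ> w) i = matching_of w i"
          using permutes_inj[OF bw] by (metis injD)
      qed
      thus "b \<circ> w \<in> {w \<in> carrier (sym_group (2 * n)). matching_of w = z}"
        using bw w(2) by (simp add: sym_group_carrier)
    qed
    show "(\<lambda>u. u \<circ> inv' w) \<in> {w \<in> carrier (sym_group (2 * n)). matching_of w = z} \<rightarrow> hyperoctahedral n"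
    proof
      fix u assume "u \<in> {w \<in> carrier (sym_group (2 * n)). matching_of w = z}"
      hence u: "u permutes {1..2 * n}" "matching_of u = z" by (auto simp: sym_group_carrier)
      have "(u \<circ> inv' w) (base_matching i) = base_matching ((u \<circ> inv' w) i)" for i
      proof -
        have "inv' w (base_matching i) = matching_of w (inv' w i)"
          by (simp add: matching_of_def wi)
        hence "(u \<circ> inv' w) (base_matching i) = u (matching_of u (inv' w i))" using u w by simp
        thus ?thesis by (simp add: matching_of_apply[OF u(1)])
      qed
      thus "u \<circ> inv' w \<in> hyperoctahedral n"
        unfolding hyperoctahedral_iff using u(1) permutes_inv[OF w(1)] permutes_compose by blast
    qed
  qed (auto simp: fun_eq_iff wi)
  thus ?thesis using bij_betw_same_card by fastforce
qed

lemma sum_matching_of: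
  fixes F :: "(nat \<Rightarrow> nat) \<Rightarrow> rat"
  shows "(\<Sum>w\<in>carrier (sym_group (2 * n)). F (matching_of w))
    = of_nat (card (hyperoctahedral n)) * (\<Sum>z\<in>matchings n. F z)"
proof -
  let ?S = "carrier (sym_group (2 * n))"
  have fin: "finite ?S" by (simp add: sym_group_def finite_permutations)
  have "(\<Sum>w\<in>?S. F (matching_of w))
    = (\<Sum>z\<in>matchings n. \<Sum>w | w \<in> ?S \<and> matching_of w = z. F (matching_of w))"
    using fin finite_matchings matching_of_in
    by (intro sum.group[symmetric]) (auto simp: sym_group_carrier)
  also have "\<dots> = (\<Sum>z\<in>matchings n. of_nat (card (hyperoctahedral n)) * F z)"
    using card_matching_of_fibre by (intro sum.cong) auto
  finally show ?thesis by (simp add: sum_distrib_left)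
qed

lemma hyperoctahedral_nonempty: "0 < card (hyperoctahedral n)"
proof -
  have "id \<in> hyperoctahedral n" by (simp add: hyperoctahedral_iff permutes_id)
  moreover have "finite (hyperoctahedral n)"
  proof (rule finite_subset)
    show "hyperoctahedral n \<subseteq> {p. p permutes {1..2 * n}}" by (auto simp: hyperoctahedral_iff)
  qed (simp add: finite_permutations)
  ultimately show ?thesis by (auto simp: card_gt_0_iff)
qed

subsection \<open>Coset types\<close>

lemma base_edge_iff:
  "(\<exists>k\<in>{1..n}. {i, j} = {2 * k - 1, 2 * k}) \<longleftrightarrow> i \<in> {1..2 * n} \<and> j = base_matching i"
proof
  assume "\<exists>k\<in>{1..n}. {i, j} = {2 * k - 1, 2 * k}"
  then obtain k where k: "1 \<le> k" "k \<le> n" "{i, j} = {2 * k - 1, 2 * k}" by auto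
  hence "(i = 2 * k - 1 \<and> j = 2 * k) \<or> (i = 2 * k \<and> j = 2 * k - 1)" by (simp add: doubleton_eq_iff)
  thus "i \<in> {1..2 * n} \<and> j = base_matching i" using k base_matching_odd_even[of k] by auto
next
  assume a: "i \<in> {1..2 * n} \<and> j = base_matching i"
  define k where "k = (i + 1) div 2"
  have k: "k \<in> {1..n}" using a by (auto simp: k_def)
  show "\<exists>k\<in>{1..n}. {i, j} = {2 * k - 1, 2 * k}"
  proof (cases "odd i")
    case True
    hence "i = 2 * k - 1" by (auto simp: k_def elim: oddE)
    thus ?thesis using a k base_matching_odd_even(1)[of k] by (intro bexI[of _ k]) auto
  next
    case False
    hence "i = 2 * k" by (auto simp: k_def elim: evenE)
    thus ?thesis using a k base_matching_odd_even(2)[of k] by (intro bexI[of _ k]) auto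
  qed
qed

text \<open>The second family of edges is the matching obtained by conjugating the base matching with \<open>w\<close>.\<close>

lemma gamma_edges_iff:
  assumes w: "w permutes {1..2 * n}"
  shows "{i, j} \<in> gamma_edges n w \<longleftrightarrow>
    i \<in> {1..2 * n} \<and> (j = base_matching i \<or> j = matching_of w i)"
proof -
  note wi = permutes_inverses[OF w]
  have "{i, j} = {inv' w p, inv' w q} \<longleftrightarrow> {w i, w j} = {p, q}" for p q
    by (metis (no_types, lifting) doubleton_eq_iff wi)
  hence "(\<exists>k\<in>{1..n}. {i, j} = {inv' w (2 * k - 1), inv' w (2 * k)}) \<longleftrightarrow>
      (\<exists>k\<in>{1..n}. {w i, w j} = {2 * k - 1, 2 * k})" by simp
  also have "\<dots> \<longleftrightarrow> w i \<in> {1..2 * n} \<and> w j = base_matching (w i)" by (rule base_edge_iff)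
  also have "\<dots> \<longleftrightarrow> i \<in> {1..2 * n} \<and> j = matching_of w i"
    using permutes_in_image[OF w, of i] by (metis comp_apply matching_of_def wi)
  finally show ?thesis using base_edge_iff[of n i j] by (auto simp: gamma_edges_def)
qed

lemma gamma_cycles_eq:
  assumes w: "w permutes {1..2 * n}"
  shows "gamma_cycles n w = components n base_matching (matching_of w)"
proof -
  let ?R = "{(i, j). {i, j} \<in> gamma_edges n w}"
  let ?Q = "{(i, j). j = base_matching i \<or> j = matching_of w i}"
  have RQ: "?R = {(i, j). i \<in> {1..2 * n} \<and> (j = base_matching i \<or> j = matching_of w i)}"
    using gamma_edges_iff[OF w] by simp
  have "?R\<^sup>* `` {v} = component base_matching (matching_of w) v" if v: "v \<in> {1..2 * n}" for v
  proof
    have "?R \<subseteq> ?Q" unfolding RQ by blast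
    hence "?R\<^sup>* \<subseteq> ?Q\<^sup>*" by (rule rtrancl_mono)
    thus "?R\<^sup>* `` {v} \<subseteq> component base_matching (matching_of w) v"
      unfolding component_def by blast
    have "component base_matching (matching_of w) v \<subseteq> ?R\<^sup>* `` {v} \<inter> {1..2 * n}"
    proof (rule component_least)
      fix u assume u: "u \<in> ?R\<^sup>* `` {v} \<inter> {1..2 * n}"
      have "(u, base_matching u) \<in> ?R" "(u, matching_of w u) \<in> ?R" using u RQ by auto
      hence "base_matching u \<in> ?R\<^sup>* `` {v}" "matching_of w u \<in> ?R\<^sup>* `` {v}"
        using u by (auto intro: rtrancl_into_rtrancl)
      moreover have "base_matching u \<in> {1..2 * n}" "matching_of w u \<in> {1..2 * n}"
        using u base_matching_range[of u n] matchings_range[OF matching_of_in[OF w]] by blast+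
      ultimately show "base_matching u \<in> ?R\<^sup>* `` {v} \<inter> {1..2 * n}"
        "matching_of w u \<in> ?R\<^sup>* `` {v} \<inter> {1..2 * n}" by blast+
    qed (use v in auto)
    thus "component base_matching (matching_of w) v \<subseteq> ?R\<^sup>* `` {v}" by blast
  qed
  thus ?thesis by (auto simp: gamma_cycles_def components_def quotient_def)
qed

text \<open>Both sides are non-increasing lists, so that it suffices to compare them as multisets.\<close>

lemma stable_coset_type_eq:
  assumes w: "w permutes {1..2 * n}"
  shows "stable_coset_type n w = stable_type base_matching (matching_of w)"
proof (rule sorted_rev_eqI)
  let ?m = "matching_of w" and ?c = "components n base_matching (matching_of w)"
  note m = matching_of_in[OF w]
  show "sorted_wrt (\<ge>) (stable_type base_matching ?m)"
    by (simp add: stable_type_def list_of_def sorted_wrt_rev)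
  have "sorted_wrt (\<ge>) (coset_type n w)" by (simp add: coset_type_def sorted_wrt_rev)
  hence "sorted_wrt (\<ge>) (map (\<lambda>r. r - 1) (coset_type n w))"
    unfolding sorted_wrt_map by (rule sorted_wrt_mono_rel[rotated]) auto
  thus "sorted_wrt (\<ge>) (stable_coset_type n w)"
    unfolding stable_coset_type_def by (rule sorted_wrt_filter)
  have "mset (stable_coset_type n w)
    = filter_mset (\<lambda>r. 0 < r) (image_mset (\<lambda>r. r - 1) (image_mset (\<lambda>C. card C div 2) (mset_set ?c)))"
    by (simp add: stable_coset_type_def coset_type_def gamma_cycles_eq[OF w])
  also have "\<dots> = filter_mset (\<lambda>r. 0 < r) (image_mset excess (mset_set ?c))"
    by (simp add: multiset.map_comp comp_def excess_def[abs_def])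
  also have "\<dots> = image_mset excess (filter_mset (\<lambda>C. 0 < excess C) (mset_set ?c))"
    by (simp add: filter_mset_image_mset)
  also have "\<dots> = pair_type base_matching ?m"
    by (simp add: pair_type_def nontrivial_components_alt[OF base_matching_in m] components_def)
  finally show "mset (stable_coset_type n w) = mset (stable_type base_matching ?m)"
    by (simp add: stable_type_def)
qed

section \<open>Structure constants of the Hecke rings\<close>

text \<open>Two-step paths from \<open>u\<close> to \<open>v\<close>; that \<open>\<kappa>\<close> belongs to the last step reflects the order of the factors in
  the convolution product.\<close>

definition path_count :: "nat \<Rightarrow> nat list \<Rightarrow> nat list \<Rightarrow> (nat \<Rightarrow> nat) \<Rightarrow> (nat \<Rightarrow> nat) \<Rightarrow> nat" where
  "path_count n \<kappa> \<mu> u v = card {z \<in> matchings n. stable_type u z = \<mu> \<and> stable_type z v = \<kappa>}"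

lemma path_count_eq_sum:
  "of_nat (path_count n \<kappa> \<mu> u v) = (\<Sum>z\<in>matchings n.
    (if stable_type z v = \<kappa> then 1 else 0) * (if stable_type u z = \<mu> then 1 else (0::rat)))"
proof -
  have "(\<Sum>z\<in>matchings n.
    (if stable_type z v = \<kappa> then 1 else 0) * (if stable_type u z = \<mu> then 1 else (0::rat)))
    = (\<Sum>z\<in>matchings n. if stable_type u z = \<mu> \<and> stable_type z v = \<kappa> then 1 else 0)"
    by (intro sum.cong) auto
  also have "\<dots> = (\<Sum>z | z \<in> matchings n \<and> (stable_type u z = \<mu> \<and> stable_type z v = \<kappa>). 1)"
    using finite_matchings by (simp only: sum.inter_filter)
  finally show ?thesis by (simp add: path_count_def)
qed

lemma conj_matchings:
  assumes g: "g permutes {1..2 * n}" and z: "z \<in> matchings n"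
  shows "g \<circ> z \<circ> inv' g \<in> matchings n"
proof -
  note gi = permutes_inverses[OF g]
  have "(g \<circ> z \<circ> inv' g) i = base_matching i" if i: "i \<notin> {1..2 * n}" for i
  proof -
    have "inv' g i = i" using permutes_not_in[OF permutes_inv[OF g] i] .
    moreover have "z i \<notin> {1..2 * n}" using matchings_range[OF z] i by blast
    ultimately show ?thesis using permutes_not_in[OF g] matchings_outside[OF z i] by simp
  qed
  moreover have "(g \<circ> z \<circ> inv' g) i \<noteq> i" if i: "1 \<le> i" for i
  proof
    assume "(g \<circ> z \<circ> inv' g) i = i"
    hence "z (inv' g i) = inv' g i" by (metis comp_apply gi(2))
    moreover have "1 \<le> inv' g i"
      using i permutes_in_image[OF permutes_inv[OF g], of i] permutes_not_in[OF permutes_inv[OF g], of i]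
      by (cases "i \<in> {1..2 * n}") auto
    ultimately show False using matchings_no_fixpoint[OF z] by blast
  qed
  ultimately show ?thesis using involutionD[OF matchings_involution[OF z]]
    by (auto simp: matchings_def gi)
qed

lemma bij_betw_conj_matchings:
  assumes g: "g permutes {1..2 * n}"
  shows "bij_betw (\<lambda>z. g \<circ> z \<circ> inv' g) (matchings n) (matchings n)"
proof (rule bij_betwI[where g = "\<lambda>z. inv' g \<circ> z \<circ> g"])
  note gi = permutes_inverses[OF g]
  show "(\<lambda>z. g \<circ> z \<circ> inv' g) \<in> matchings n \<rightarrow> matchings n" using conj_matchings[OF g] by blast
  show "(\<lambda>z. inv' g \<circ> z \<circ> g) \<in> matchings n \<rightarrow> matchings n"
    using conj_matchings[OF permutes_inv[OF g]] inv_inv_eq[OF permutes_bij[OF g]] by auto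
qed (auto simp: fun_eq_iff permutes_inverses[OF g])

lemma stable_type_conj:
  assumes "g permutes {1..2 * n}" "\<And>i. g (x i) = x' (g i)" "\<And>i. g (y i) = y' (g i)"
  shows "stable_type x' y' = stable_type x y"
  using pair_type_conj[of g x x' y y'] permutes_bij[OF assms(1)] assms by (simp add: stable_type_def)

lemma stable_type_commute: "stable_type x y = stable_type y x"
  by (simp add: stable_type_def pair_type_commute)

lemma stable_type_classification:
  assumes "x \<in> matchings n" "y \<in> matchings n" "x' \<in> matchings n" "y' \<in> matchings n"
    and "stable_type x y = stable_type x' y'"
  shows "\<exists>g. g permutes {1..2 * n} \<and> (\<forall>i. g (x i) = x' (g i)) \<and> (\<forall>i. g (y i) = y' (g i))"
  using pair_type_classification[of x n y x' y'] assms by (simp add: stable_type_def list_of_inject)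

lemma is_partition_stable_type:
  "x \<in> matchings n \<Longrightarrow> y \<in> matchings n \<Longrightarrow> is_partition (stable_type x y)"
  by (simp add: stable_type_def is_partition_list_of pair_type_nonzero)

lemma wt_stable_type_le:
  "x \<in> matchings n \<Longrightarrow> y \<in> matchings n \<Longrightarrow> wt (stable_type x y) \<le> n"
  by (simp add: stable_type_def wt_pair_type_le)

lemma sum_list_stable_type: "sum_list (stable_type x y) = distance x y"
  by (simp add: stable_type_def distance_def)

text \<open>Conjugation by a permutation relating the two pairs permutes the midpoints and preserves all types.\<close>

lemma sum_paths_cong:
  fixes F :: "nat list \<Rightarrow> nat list \<Rightarrow> 'a::comm_monoid_add"
  assumes "u \<in> matchings n" "v \<in> matchings n" "u' \<in> matchings n" "v' \<in> matchings n"
    and "stable_type u v = stable_type u' v'"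
  shows "(\<Sum>z\<in>matchings n. F (stable_type u z) (stable_type z v))
    = (\<Sum>z\<in>matchings n. F (stable_type u' z) (stable_type z v'))"
proof -
  obtain g where g: "g permutes {1..2 * n}"
    and gu: "\<And>i. g (u i) = u' (g i)" and gv: "\<And>i. g (v i) = v' (g i)"
    using stable_type_classification[OF assms] by blast
  have z: "g (z i) = (g \<circ> z \<circ> inv' g) (g i)" for z i by (simp add: permutes_inverses[OF g])
  show ?thesis
    using stable_type_conj[of g n u u' _ "g \<circ> _ \<circ> inv' g", OF g gu z]
      stable_type_conj[of g n _ "g \<circ> _ \<circ> inv' g" v v', OF g z gv]
    by (subst sum.reindex_bij_betw[OF bij_betw_conj_matchings[OF g], symmetric]) simp
qed

lemma path_count_cong:
  assumes "u \<in> matchings n" "v \<in> matchings n" "u' \<in> matchings n" "v' \<in> matchings n"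
    and "stable_type u v = stable_type u' v'"
  shows "path_count n \<kappa> \<mu> u v = path_count n \<kappa> \<mu> u' v'"
proof -
  have "(of_nat (path_count n \<kappa> \<mu> u v) :: rat) = of_nat (path_count n \<kappa> \<mu> u' v')"
    unfolding path_count_eq_sum
    using sum_paths_cong[OF assms, of "\<lambda>p q. (if q = \<kappa> then 1 else 0) * (if p = \<mu> then 1 else 0)"] .
  thus ?thesis by simp
qed

text \<open>Conjugating by \<open>y\<close> turns the type of \<open>w \<circ> inv' y\<close> into that of the pair of matchings of \<open>y\<close> and \<open>w\<close>; the
  normalization by the order of the hyperoctahedral group then cancels against the size of the fibres.\<close>

lemma hecke_mult:
  assumes w: "w permutes {1..2 * n}"
  shows "(hecke_K n \<kappa> \<otimes>\<^bsub>hecke_ring n\<^esub> hecke_K n \<mu>) w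
    = of_nat (path_count n \<kappa> \<mu> base_matching (matching_of w))"
proof -
  let ?S = "carrier (sym_group (2 * n))"
  have "(\<Sum>y\<in>?S. hecke_K n \<kappa> (w \<circ> inv' y) * hecke_K n \<mu> y)
    = (\<Sum>y\<in>?S. (if stable_type (matching_of y) (matching_of w) = \<kappa> then 1 else 0) *
        (if stable_type base_matching (matching_of y) = \<mu> then 1 else (0::rat)))"
  proof (rule sum.cong[OF refl])
    fix y assume "y \<in> ?S"
    hence y: "y permutes {1..2 * n}" by (simp add: sym_group_carrier)
    have wy: "(w \<circ> inv' y) permutes {1..2 * n}" using permutes_compose[OF permutes_inv[OF y] w] .
    have "stable_coset_type n (w \<circ> inv' y) = stable_type base_matching (matching_of (w \<circ> inv' y))"
      by (rule stable_coset_type_eq[OF wy])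
    also have "\<dots> = stable_type (matching_of y) (matching_of w)"
    proof (rule stable_type_conj[OF y])
      fix i
      show "y (matching_of y i) = base_matching (y i)" by (rule matching_of_apply[OF y])
      have "(w \<circ> inv' y) (matching_of (w \<circ> inv' y) (y i)) = base_matching (w i)"
        unfolding matching_of_apply[OF wy] by (simp add: permutes_inverses[OF y])
      also have "\<dots> = (w \<circ> inv' y) (y (matching_of w i))"
        by (simp add: permutes_inverses[OF y] matching_of_apply[OF w])
      finally show "y (matching_of w i) = matching_of (w \<circ> inv' y) (y i)"
        using permutes_inj[OF wy] by (metis injD)
    qed
    finally show "hecke_K n \<kappa> (w \<circ> inv' y) * hecke_K n \<mu> y =
      (if stable_type (matching_of y) (matching_of w) = \<kappa> then 1 else 0) *
        (if stable_type base_matching (matching_of y) = \<mu> then 1 else 0)"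
      using y wy stable_coset_type_eq[OF y] by (simp add: hecke_K_def sym_group_carrier)
  qed
  also have "\<dots> = of_nat (card (hyperoctahedral n)) *
      of_nat (path_count n \<kappa> \<mu> base_matching (matching_of w))"
    unfolding path_count_eq_sum by (rule sum_matching_of)
  finally show ?thesis using w hyperoctahedral_nonempty[of n]
    by (simp add: hecke_ring_def sym_group_carrier)
qed

lemma stable_type_exists:
  assumes "is_partition \<nu>"
  shows "\<exists>y \<in> matchings (wt \<nu>). stable_type base_matching y = \<nu>"
  using pair_type_exists[OF is_partition_nonzero[OF assms]] list_of_mset[OF assms]
  by (simp add: wt_def stable_type_def sum_mset_sum_list) metis

lemma finite_partitions_wt: "finite {\<nu>. is_partition \<nu> \<and> wt \<nu> \<le> n}"
  by (rule finite_subset[OF _ finite_partitions[of n]]) (auto simp: wt_def)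

lemma sum_hecke_K:
  assumes w: "w permutes {1..2 * n}"
  shows "(\<Sum>\<nu> | is_partition \<nu> \<and> wt \<nu> \<le> n. of_int (b \<nu>) * hecke_K n \<nu> w)
    = of_int (b (stable_type base_matching (matching_of w)))"
proof -
  let ?s = "stable_type base_matching (matching_of w)"
  note m = matching_of_in[OF w]
  have "(\<Sum>\<nu> | is_partition \<nu> \<and> wt \<nu> \<le> n. of_int (b \<nu>) * hecke_K n \<nu> w)
    = (\<Sum>\<nu> | is_partition \<nu> \<and> wt \<nu> \<le> n. if \<nu> = ?s then of_int (b \<nu>) else 0)"
    using w by (intro sum.cong) (auto simp: hecke_K_def sym_group_carrier stable_coset_type_eq[OF w])
  also have "\<dots> = of_int (b ?s)"
    using is_partition_stable_type[OF base_matching_in m] wt_stable_type_le[OF base_matching_in m]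
      finite_partitions_wt by simp
  finally show ?thesis .
qed

text \<open>The functions \<open>hecke_K n \<nu>\<close> with \<open>wt \<nu> \<le> n\<close> are the indicators of nonempty disjoint sets, so that a
  coefficient can be read off at any permutation of the given type.\<close>

lemma hecke_coeff_eq:
  assumes \<nu>: "is_partition \<nu>" "wt \<nu> \<le> n" and y: "y \<in> matchings n" "stable_type base_matching y = \<nu>"
  shows "hecke_coeff n \<kappa> \<mu> \<nu> = int (path_count n \<kappa> \<mu> base_matching y)"
proof -
  let ?P = "\<lambda>b. (\<forall>\<nu>. \<not> (is_partition \<nu> \<and> wt \<nu> \<le> n) \<longrightarrow> b \<nu> = 0) \<and>
       hecke_K n \<kappa> \<otimes>\<^bsub>hecke_ring n\<^esub> hecke_K n \<mu> =
         (\<lambda>w. \<Sum>\<nu> | is_partition \<nu> \<and> wt \<nu> \<le> n. of_int (b \<nu>) * hecke_K n \<nu> w)"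
  have key: "b \<nu> = int (path_count n \<kappa> \<mu> base_matching y)"
    if b: "?P b" and \<nu>: "is_partition \<nu>" "wt \<nu> \<le> n" and y: "y \<in> matchings n" "stable_type base_matching y = \<nu>"
    for b \<nu> y
  proof -
    obtain w where w: "w permutes {1..2 * n}" "matching_of w = y" using matching_of_surj[OF y(1)] by blast
    have "(of_int (b \<nu>) :: rat) = (\<Sum>\<nu> | is_partition \<nu> \<and> wt \<nu> \<le> n. of_int (b \<nu>) * hecke_K n \<nu> w)"
      using sum_hecke_K[OF w(1), of b] w(2) y(2) by simp
    also have "\<dots> = (hecke_K n \<kappa> \<otimes>\<^bsub>hecke_ring n\<^esub> hecke_K n \<mu>) w"
      using b by simp
    also have "\<dots> = of_int (int (path_count n \<kappa> \<mu> base_matching y))"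
      using hecke_mult[OF w(1)] w(2) by simp
    finally show ?thesis using of_int_eq_iff by blast
  qed
  define r where "r \<nu> = (SOME y. y \<in> matchings n \<and> stable_type base_matching y = \<nu>)" for \<nu>
  have r: "r \<nu> \<in> matchings n \<and> stable_type base_matching (r \<nu>) = \<nu>"
    if "is_partition \<nu>" "wt \<nu> \<le> n" for \<nu>
  proof -
    have "\<exists>y. y \<in> matchings n \<and> stable_type base_matching y = \<nu>"
      using stable_type_exists[OF that(1)] matchings_mono[OF that(2)] by blast
    thus ?thesis unfolding r_def by (rule someI_ex)
  qed
  \<comment> \<open>The coefficients are read off at representatives \<open>r \<nu>\<close> of the types.\<close>
  define b0 where "b0 \<nu> = (if is_partition \<nu> \<and> wt \<nu> \<le> n
    then int (path_count n \<kappa> \<mu> base_matching (r \<nu>)) else 0)" for \<nu>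
  have "?P b0"
  proof (intro conjI allI impI ext)
    fix w
    show "(hecke_K n \<kappa> \<otimes>\<^bsub>hecke_ring n\<^esub> hecke_K n \<mu>) w
      = (\<Sum>\<nu> | is_partition \<nu> \<and> wt \<nu> \<le> n. of_int (b0 \<nu>) * hecke_K n \<nu> w)"
    proof (cases "w permutes {1..2 * n}")
      case True
      let ?m = "matching_of w"
      let ?s = "stable_type base_matching ?m"
      note m = matching_of_in[OF True]
      have s: "is_partition ?s" "wt ?s \<le> n"
        using is_partition_stable_type[OF base_matching_in m] wt_stable_type_le[OF base_matching_in m] .
      have "path_count n \<kappa> \<mu> base_matching ?m = path_count n \<kappa> \<mu> base_matching (r ?s)"
        using r[OF s] m by (intro path_count_cong[OF base_matching_in _ base_matching_in]) auto
      hence "int (path_count n \<kappa> \<mu> base_matching ?m) = b0 ?s" using s by (simp add: b0_def)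
      thus ?thesis unfolding hecke_mult[OF True] sum_hecke_K[OF True] by (metis of_int_of_nat_eq)
    next
      case False
      thus ?thesis by (simp add: hecke_ring_def hecke_K_def sym_group_carrier)
    qed
  qed (auto simp: b0_def)
  moreover have "b = b0" if "?P b" for b
  proof
    fix \<nu>
    show "b \<nu> = b0 \<nu>"
    proof (cases "is_partition \<nu> \<and> wt \<nu> \<le> n")
      case True
      thus ?thesis using key[OF that, of \<nu> "r \<nu>"] r[of \<nu>] by (simp add: b0_def)
    next
      case False
      thus ?thesis using that by (auto simp: b0_def)
    qed
  qed
  ultimately have "?P (hecke_coeff n \<kappa> \<mu>)"
    unfolding hecke_coeff_def by (rule theI)
  thus ?thesis using key \<nu> y by blast
qed

section \<open>The triangle inequality\<close>

text \<open>Where \<open>x\<close> and \<open>y\<close> differ, one switch splits an \<open>x\<close>-edge off the component. It brings \<open>y\<close> one step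
  closer to \<open>x\<close>.\<close>

lemma switch_reduce:
  assumes x: "x \<in> matchings n" and y: "y \<in> matchings n" and ne: "x a \<noteq> y a"
  defines "b \<equiv> x (y a)"
  shows "a \<in> {1..2 * n}" "b \<in> {1..2 * n}" "switch a b y \<in> matchings n"
    and "component x (switch a b y) b = {b, y a}"
    and "b \<notin> component x (switch a b y) a"
    and "b \<in> component x y a"
    and "distance x y = Suc (distance x (switch a b y))"
proof -
  have ix: "involution x" and iy: "involution y" using x y matchings_involution by blast+
  show a: "a \<in> {1..2 * n}" using ne x y matchings_outside by metis
  show b: "b \<in> {1..2 * n}" unfolding b_def using a matchings_range[OF x] matchings_range[OF y] by blast
  show y': "switch a b y \<in> matchings n" by (rule switch_matchings[OF y a b])
  have pos: "1 \<le> a" "1 \<le> b" using a b by auto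
  have n1: "y a \<noteq> a" using matchings_no_fixpoint[OF y pos(1)] .
  have xb: "x b = y a" unfolding b_def using ix involutionD by metis
  have n2: "y a \<noteq> b" using matchings_no_fixpoint[OF x pos(2)] xb by metis
  have n3: "a \<noteq> b" using ne xb by metis
  have "switch a b y b = x b" using n1 n2 xb by (simp add: switch_def)
  thus cb: "component x (switch a b y) b = {b, y a}"
    using component_trivial[OF ix _ switch_involution[OF iy]] xb by metis
  show nb: "b \<notin> component x (switch a b y) a"
  proof
    assume "b \<in> component x (switch a b y) a"
    hence "a \<in> component x (switch a b y) b"
      by (rule component_sym[OF ix switch_involution[OF iy]])
    thus False using cb n1 n3 by auto
  qed
  show "b \<in> component x y a"
    unfolding b_def using component_closed(1)[OF component_closed(2)[OF component_refl]] .
  show "distance x y = Suc (distance x (switch a b y))"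
    using distance_merge[OF x y' pos nb] by simp
qed

text \<open>Walk from \<open>v\<close> to \<open>z\<close> by \<open>distance z v\<close> switches; each of them changes the distance from \<open>u\<close> by at
  most one.\<close>

lemma distance_triangle:
  assumes u: "u \<in> matchings n" and z: "z \<in> matchings n" and v: "v \<in> matchings n"
  shows "distance u v \<le> distance u z + distance z v"
  using v
proof (induction "distance z v" arbitrary: v)
  case 0
  thus ?case using distance_eq_0_iff[OF z, of v] by simp
next
  case (Suc d)
  hence "z \<noteq> v" using distance_eq_0_iff[OF z, of v] by auto
  then obtain a where a: "z a \<noteq> v a" by blast
  note r = switch_reduce[OF z Suc.prems a]
  let ?v = "switch a (z (v a)) v"
  have "distance u ?v \<le> distance u z + distance z ?v"
    using Suc r by (intro Suc.hyps(1)) auto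
  moreover have "distance u v \<le> distance u ?v + 1"
    using distance_switch_le[OF u r(3), of a "z (v a)"] r(1,2) by simp
  ultimately show ?case using r(7) by simp
qed

lemma path_count_eq_0:
  assumes "u \<in> matchings n" "v \<in> matchings n" "sum_list \<kappa> + sum_list \<mu> < distance u v"
  shows "path_count n \<kappa> \<mu> u v = 0"
proof -
  have "False" if "z \<in> matchings n" "stable_type u z = \<mu>" "stable_type z v = \<kappa>" for z
    using distance_triangle[OF assms(1) that(1) assms(2)] assms(3) that(2,3) sum_list_stable_type by auto
  hence "{z \<in> matchings n. stable_type u z = \<mu> \<and> stable_type z v = \<kappa>} = {}" by blast
  thus ?thesis unfolding path_count_def by (simp only: card.empty)
qed

section \<open>Structure constants are integer-valued polynomials\<close>

text \<open>The permutation of vertices induced by a permutation of the pairs \<open>{2 * k - 1, 2 * k}\<close>.\<close>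

definition pair_lift :: "(nat \<Rightarrow> nat) \<Rightarrow> nat \<Rightarrow> nat" where
  "pair_lift \<pi> i = (if i = 0 then 0 else if odd i then 2 * \<pi> ((i + 1) div 2) - 1 else 2 * \<pi> (i div 2))"

lemma pair_cases:
  obtains (zero) "i = 0" | (odd) k where "1 \<le> k" "i = 2 * k - 1" | (even) k where "1 \<le> k" "i = 2 * (k::nat)"
proof (cases "i = 0")
  case False
  show thesis
  proof (cases "odd i")
    case True
    then obtain m where "i = 2 * m + 1" by (elim oddE)
    thus thesis using odd[of "m + 1"] by simp
  next
    case False
    then obtain m where "i = 2 * m" by blast
    thus thesis using even[of m] \<open>i \<noteq> 0\<close> by simp
  qed
qed (rule zero)

lemma pair_lift_simps:
  "pair_lift \<pi> 0 = 0" "1 \<le> k \<Longrightarrow> pair_lift \<pi> (2 * k) = 2 * \<pi> k"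
  "1 \<le> k \<Longrightarrow> pair_lift \<pi> (2 * k - 1) = 2 * \<pi> k - 1"
  "1 \<le> k \<Longrightarrow> pair_lift \<pi> (2 * k - Suc 0) = 2 * \<pi> k - 1"
  by (auto simp: pair_lift_def)

lemma permutes_pos:
  assumes "\<pi> permutes {1..N}" "1 \<le> k" shows "1 \<le> \<pi> k"
  using assms permutes_in_image[OF assms(1), of k] permutes_not_in[OF assms(1), of k]
  by (cases "k \<in> {1..N}") auto

lemma pair_lift_inverse:
  assumes \<pi>: "\<pi> permutes {1..N}" and inv: "\<And>k. \<rho> (\<pi> k) = k"
  shows "pair_lift \<rho> (pair_lift \<pi> i) = i"
proof (cases i rule: pair_cases)
  case (odd k)
  thus ?thesis using permutes_pos[OF \<pi> odd(1)] by (simp add: pair_lift_simps inv)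
next
  case (even k)
  thus ?thesis using permutes_pos[OF \<pi> even(1)] by (simp add: pair_lift_simps inv)
qed (simp add: pair_lift_simps)

lemma pair_lift_permutes:
  assumes \<pi>: "\<pi> permutes {1..N}" shows "pair_lift \<pi> permutes {1..2 * N}"
proof -
  note pi = permutes_inverses[OF \<pi>]
  have out: "pair_lift \<pi> i = i" if "i \<notin> {1..2 * N}" for i
  proof (cases i rule: pair_cases)
    case (odd k)
    hence "\<pi> k = k" using that by (intro permutes_not_in[OF \<pi>]) auto
    thus ?thesis using odd by (simp add: pair_lift_simps)
  next
    case (even k)
    hence "\<pi> k = k" using that by (intro permutes_not_in[OF \<pi>]) auto
    thus ?thesis using even by (simp add: pair_lift_simps)
  qed (simp add: pair_lift_simps)
  have "\<exists>!i. pair_lift \<pi> i = j" for j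
    using pair_lift_inverse[OF \<pi>, of "inv' \<pi>", OF pi(2)]
      pair_lift_inverse[OF permutes_inv[OF \<pi>], of \<pi>, OF pi(1)] by metis
  thus ?thesis using out by (simp add: permutes_def)
qed

lemma pair_lift_base:
  assumes \<pi>: "\<pi> permutes {1..N}"
  shows "pair_lift \<pi> (base_matching i) = base_matching (pair_lift \<pi> i)"
proof (cases i rule: pair_cases)
  case (odd k)
  thus ?thesis using permutes_pos[OF \<pi> odd(1)] base_matching_odd_even[of k]
      base_matching_odd_even[of "\<pi> k"] by (simp add: pair_lift_simps)
next
  case (even k)
  thus ?thesis using permutes_pos[OF \<pi> even(1)] base_matching_odd_even[of k]
      base_matching_odd_even[of "\<pi> k"] by (simp add: pair_lift_simps)
qed (simp add: pair_lift_simps base_matching_def)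

lemma permutes_subset_exists:
  assumes "E \<subseteq> A" "E' \<subseteq> A" "finite A" "card E = card E'"
  shows "\<exists>\<pi>. \<pi> permutes A \<and> \<pi> ` E = E'"
proof -
  have fin: "finite E" "finite E'" using assms finite_subset by blast+
  obtain f where f: "bij_betw f E E'" using finite_same_card_bij[OF fin assms(4)] by blast
  have "card (A - E) = card (A - E')" using assms fin by (simp add: card_Diff_subset)
  then obtain h where h: "bij_betw h (A - E) (A - E')" using finite_same_card_bij assms(3) by blast
  \<comment> \<open>Glue a bijection of the sets with one of their complements.\<close>
  let ?p = "\<lambda>x. if x \<in> E then f x else if x \<in> A then h x else x"
  have 1: "bij_betw ?p E E'" using f by (subst bij_betw_cong[of E ?p f]) auto
  have "bij_betw ?p (A - E) (A - E')" using h by (subst bij_betw_cong[of "A - E" ?p h]) auto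
  hence "bij_betw ?p (E \<union> (A - E)) (E' \<union> (A - E'))" using 1 by (intro bij_betw_combine) auto
  moreover have "E \<union> (A - E) = A" "E' \<union> (A - E') = A" using assms by auto
  ultimately have "?p permutes A" using assms(1) by (intro bij_imp_permutes) auto
  moreover have "?p ` E = E'" using 1 by (simp add: bij_betw_def)
  ultimately show ?thesis by blast
qed

text \<open>Used when \<open>z\<close> is compared with a matching supported on the first \<open>m\<close> pairs.\<close>

definition outer_pairs :: "nat \<Rightarrow> (nat \<Rightarrow> nat) \<Rightarrow> nat set" where
  "outer_pairs m z = {k. m < k \<and> z (2 * k - 1) \<noteq> 2 * k}"

text \<open>Matchings of all levels are admitted, so that the set does not depend on \<open>n\<close>.\<close>

definition midpoints :: "nat \<Rightarrow> nat list \<Rightarrow> nat list \<Rightarrow> (nat \<Rightarrow> nat) \<Rightarrow> nat set \<Rightarrow> (nat \<Rightarrow> nat) set" where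
  "midpoints m \<kappa> \<mu> y E = {z. (\<exists>N. z \<in> matchings N) \<and> stable_type base_matching z = \<mu> \<and>
     stable_type z y = \<kappa> \<and> outer_pairs m z = E}"

lemma outer_pairs_matchings:
  assumes z: "z \<in> matchings N"
  shows "m \<le> n \<Longrightarrow> outer_pairs m z \<subseteq> {..n} \<Longrightarrow> z \<in> matchings n"
    and "z \<in> matchings n \<Longrightarrow> outer_pairs m z \<subseteq> {m + 1..n}"
proof -
  assume mn: "m \<le> n" and sub: "outer_pairs m z \<subseteq> {..n}"
  have odd: "z (2 * k - 1) = 2 * k" if "n < k" for k
  proof (rule ccontr)
    assume "z (2 * k - 1) \<noteq> 2 * k"
    hence "k \<in> outer_pairs m z" using that mn by (simp add: outer_pairs_def)
    thus False using sub that by auto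
  qed
  have "z i = base_matching i" if i: "i \<notin> {1..2 * n}" for i
  proof (cases i rule: pair_cases)
    case zero thus ?thesis using matchings_outside[OF z, of i] by simp
  next
    case (odd k)
    thus ?thesis using i \<open>\<And>k. n < k \<Longrightarrow> z (2 * k - 1) = 2 * k\<close>[of k] base_matching_odd_even(1)[of k] by auto
  next
    case (even k)
    hence "z (2 * k - 1) = 2 * k" using i odd[of k] by auto
    hence "z (2 * k) = 2 * k - 1" using involutionD[OF matchings_involution[OF z]] by metis
    thus ?thesis using even base_matching_odd_even(2)[of k] by simp
  qed
  thus "z \<in> matchings n" using z by (auto simp: matchings_def)
next
  assume z: "z \<in> matchings n"
  show "outer_pairs m z \<subseteq> {m + 1..n}"
  proof
    fix k assume k: "k \<in> outer_pairs m z"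
    have "k \<le> n"
    proof (rule ccontr)
      assume "\<not> k \<le> n"
      hence "z (2 * k - 1) = base_matching (2 * k - 1)" by (intro matchings_outside[OF z]) auto
      thus False using k base_matching_odd_even(1)[of k] by (auto simp: outer_pairs_def)
    qed
    thus "k \<in> {m + 1..n}" using k by (auto simp: outer_pairs_def)
  qed
qed

lemma midpoints_subset:
  assumes "m \<le> n" "E \<subseteq> {..n}" shows "midpoints m \<kappa> \<mu> y E \<subseteq> matchings n"
  using assms outer_pairs_matchings(1) by (auto simp: midpoints_def)

lemma finite_midpoints:
  assumes "finite E" shows "finite (midpoints m \<kappa> \<mu> y E)"
proof -
  obtain n where "E \<subseteq> {..n}" using assms finite_nat_iff_bounded_le by blast
  hence "midpoints m \<kappa> \<mu> y E \<subseteq> matchings (max m n)" by (intro midpoints_subset) auto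
  thus ?thesis using finite_matchings finite_subset by blast
qed

text \<open>A permutation of the outer pairs that maps \<open>E\<close> to \<open>E'\<close> fixes the base matching and \<open>y\<close> under
  conjugation, because \<open>y\<close> is the base matching on the outer pairs.\<close>

lemma card_midpoints_le:
  assumes y: "y \<in> matchings m" and E: "finite E" "E \<subseteq> {m<..}" and E': "finite E'" "E' \<subseteq> {m<..}"
    and card: "card E = card E'"
  shows "card (midpoints m \<kappa> \<mu> y E) \<le> card (midpoints m \<kappa> \<mu> y E')"
proof -
  obtain n where n: "E \<union> E' \<subseteq> {..n}"
    using E(1) E'(1) finite_nat_iff_bounded_le[of "E \<union> E'"] by blast
  let ?A = "{m + 1..max m n}"
  have "x \<in> ?A" if "x \<in> E \<union> E'" for x
  proof -
    have "m < x" "x \<le> n" using that n E(2) E'(2) by auto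
    thus ?thesis by simp
  qed
  hence sub: "E \<subseteq> ?A" "E' \<subseteq> ?A" by blast+
  obtain \<pi> where \<pi>: "\<pi> permutes ?A" "\<pi> ` E = E'"
    using permutes_subset_exists[OF sub _ card] by auto
  have \<pi>': "\<pi> permutes {1..max m n}" using permutes_subset[OF \<pi>(1)] by auto
  have fix_low: "\<pi> k = k" if "k \<le> m" for k using permutes_not_in[OF \<pi>(1)] that by auto
  have high: "m < \<pi> k \<longleftrightarrow> m < k" for k
  proof -
    have "\<pi> k = k" if "\<not> m < k" using fix_low that by simp
    moreover have "m < \<pi> k" if "m < k"
      using permutes_in_image[OF \<pi>(1), of k] permutes_not_in[OF \<pi>(1), of k] that
      by (cases "k \<in> ?A") auto
    ultimately show ?thesis by metis
  qed
  let ?g = "pair_lift \<pi>"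
  note g = pair_lift_permutes[OF \<pi>']
  note gi = permutes_inverses[OF g]
  have gbase: "?g (base_matching i) = base_matching (?g i)" for i by (rule pair_lift_base[OF \<pi>'])
  have glow: "?g i = i" if "i \<in> {1..2 * m}" for i
  proof (cases i rule: pair_cases)
    case (odd k)
    hence "k \<le> m" using that by auto
    thus ?thesis using fix_low[of k] odd by (simp add: pair_lift_simps)
  next
    case (even k)
    hence "k \<le> m" using that by auto
    thus ?thesis using fix_low[of k] even by (simp add: pair_lift_simps)
  qed (simp add: pair_lift_simps)
  have gy: "?g (y i) = y (?g i)" for i
  proof (cases "i \<in> {1..2 * m}")
    case True
    hence "y i \<in> {1..2 * m}" using matchings_range[OF y] by blast
    thus ?thesis using glow True by simp
  next
    case False
    have "?g i \<notin> {1..2 * m}"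
    proof
      assume a: "?g i \<in> {1..2 * m}"
      hence "?g (?g i) = ?g i" by (rule glow)
      thus False using a False permutes_inj[OF g] by (metis injD)
    qed
    thus ?thesis using matchings_outside[OF y] False gbase by simp
  qed
  let ?c = "\<lambda>z. ?g \<circ> z \<circ> inv' ?g"
  have "?c z \<in> midpoints m \<kappa> \<mu> y E'" if z: "z \<in> midpoints m \<kappa> \<mu> y E" for z
  proof -
    have z': "z \<in> matchings (max m n)"
    proof -
      have "E \<subseteq> {..max m n}" using n by auto
      thus ?thesis using midpoints_subset[of m "max m n" E \<kappa> \<mu> y] z by auto
    qed
    have cz: "?g (z i) = ?c z (?g i)" for i by (simp add: gi)
    have "?c z \<in> matchings (max m n)" by (rule conj_matchings[OF g z'])
    moreover have "stable_type base_matching (?c z) = \<mu>"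
      using stable_type_conj[of ?g "max m n" base_matching base_matching z "?c z", OF g gbase cz] z
      by (simp add: midpoints_def)
    moreover have "stable_type (?c z) y = \<kappa>"
      using stable_type_conj[of ?g "max m n" z "?c z" y y, OF g cz gy] z by (simp add: midpoints_def)
    moreover have "outer_pairs m (?c z) = \<pi> ` outer_pairs m z"
    proof -
      have *: "\<pi> k \<in> outer_pairs m (?c z) \<longleftrightarrow> k \<in> outer_pairs m z" for k
      proof (cases "m < k")
        case True
        hence "?c z (2 * \<pi> k - 1) = ?g (z (2 * k - 1))" "2 * \<pi> k = ?g (2 * k)"
          using cz[of "2 * k - 1"] by (simp_all add: pair_lift_simps)
        hence "?c z (2 * \<pi> k - 1) = 2 * \<pi> k \<longleftrightarrow> z (2 * k - 1) = 2 * k"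
          using permutes_inj[OF g] by (metis injD)
        thus ?thesis using True high by (simp add: outer_pairs_def)
      next
        case False thus ?thesis using high by (simp add: outer_pairs_def)
      qed
      show ?thesis
      proof (intro equalityI subsetI)
        fix j assume j: "j \<in> outer_pairs m (?c z)"
        obtain k where "j = \<pi> k" using permutes_surj[OF \<pi>(1)] by (metis surjD)
        thus "j \<in> \<pi> ` outer_pairs m z" using * j by blast
      qed (use * in blast)
    qed
    ultimately show ?thesis using z \<pi>(2) unfolding midpoints_def by blast
  qed
  moreover have "inj_on ?c (midpoints m \<kappa> \<mu> y E)"
  proof (rule inj_onI)
    fix z z' assume "?c z = ?c z'"
    hence "?c z (?g i) = ?c z' (?g i)" for i by simp
    hence "?g (z i) = ?g (z' i)" for i by (simp add: gi)
    thus "z = z'" using permutes_inj[OF g] by (metis injD ext)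
  qed
  ultimately show ?thesis
    by (intro card_inj_on_le[OF _ _ finite_midpoints[OF E'(1)]]) auto
qed

text \<open>Each pair in \<open>E\<close> has its odd vertex in the support of a pair of matchings of type \<open>\<mu>\<close>, which consists
  of \<open>2 * wt \<mu>\<close> vertices.\<close>

lemma card_midpoints_bound:
  assumes z: "z \<in> midpoints m \<kappa> \<mu> y E" shows "card E \<le> 2 * wt \<mu>"
proof -
  obtain N where zN: "z \<in> matchings N" and \<mu>: "stable_type base_matching z = \<mu>"
    and E: "outer_pairs m z = E" using z by (auto simp: midpoints_def)
  have fin: "finite {v. base_matching v \<noteq> z v}"
    by (rule finite_subset[of _ "{1..2 * N}"]) (use matchings_outside[OF zN] in \<open>force\<close>, simp)
  have "card E \<le> card {v. base_matching v \<noteq> z v}"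
  proof (rule card_inj_on_le[of "\<lambda>k. 2 * k - 1"])
    show "inj_on (\<lambda>k. 2 * k - 1) E" using E by (auto simp: inj_on_def outer_pairs_def)
    show "(\<lambda>k. 2 * k - 1) ` E \<subseteq> {v. base_matching v \<noteq> z v}"
    proof clarify
      fix k assume "k \<in> E" "base_matching (2 * k - 1) = z (2 * k - 1)"
      thus False using E base_matching_odd_even(1)[of k] by (auto simp: outer_pairs_def)
    qed
  qed (rule fin)
  also have "\<dots> = 2 * wt \<mu>" using card_support[OF base_matching_in zN] \<mu>
    by (auto simp: stable_type_def wt_def distance_def)
  finally show ?thesis .
qed

lemma sum_Pow_card:
  fixes f :: "nat \<Rightarrow> nat"
  assumes "finite A"
  shows "(\<Sum>E\<in>Pow A. f (card E)) = (\<Sum>m\<le>card A. (card A choose m) * f m)"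
proof -
  have "(\<Sum>E\<in>Pow A. f (card E)) = (\<Sum>m\<le>card A. \<Sum>E | E \<in> Pow A \<and> card E = m. f (card E))"
    using assms card_mono by (intro sum.group[symmetric]) auto
  also have "\<dots> = (\<Sum>m\<le>card A. (card A choose m) * f m)"
    using assms by (intro sum.cong) (auto simp: n_subsets)
  finally show ?thesis .
qed

text \<open>A midpoint is given by the set of outer pairs that it moves and a configuration on this set. The
  number \<open>c j\<close> of configurations depends only on the cardinality \<open>j\<close> of the set and vanishes for large
  \<open>j\<close>.\<close>

lemma path_count_binomial:
  assumes y: "y \<in> matchings m"
  shows "\<exists>c::nat \<Rightarrow> nat. \<forall>n\<ge>m. path_count n \<kappa> \<mu> base_matching y
    = (\<Sum>j\<le>2 * wt \<mu>. (n - m choose j) * c j)"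
proof -
  let ?Z = "midpoints m \<kappa> \<mu> y"
  define c where "c j = card (?Z {m + 1..m + j})" for j
  have c: "card (?Z E) = c (card E)" if "finite E" "E \<subseteq> {m<..}" for E
    unfolding c_def using that by (intro antisym card_midpoints_le[OF y]) auto
  have c0: "c j = 0" if "2 * wt \<mu> < j" for j
  proof -
    have "?Z {m + 1..m + j} = {}" using card_midpoints_bound[of _ m \<kappa> \<mu> y "{m + 1..m + j}"] that by auto
    thus ?thesis by (simp add: c_def)
  qed
  have "path_count n \<kappa> \<mu> base_matching y = (\<Sum>j\<le>2 * wt \<mu>. (n - m choose j) * c j)" if mn: "m \<le> n" for n
  proof -
    let ?A = "{m + 1..n}"
    have "{z \<in> matchings n. stable_type base_matching z = \<mu> \<and> stable_type z y = \<kappa>} = (\<Union>E\<in>Pow ?A. ?Z E)"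
    proof (intro equalityI subsetI)
      fix z assume "z \<in> {z \<in> matchings n. stable_type base_matching z = \<mu> \<and> stable_type z y = \<kappa>}"
      thus "z \<in> (\<Union>E\<in>Pow ?A. ?Z E)" using outer_pairs_matchings(2)[of z n n m] by (auto simp: midpoints_def)
    next
      fix z assume "z \<in> (\<Union>E\<in>Pow ?A. ?Z E)"
      then obtain E where E: "E \<subseteq> ?A" "z \<in> ?Z E" by blast
      moreover from E(1) have "E \<subseteq> {..n}" by auto
      ultimately have "z \<in> matchings n" using midpoints_subset[OF mn, of E \<kappa> \<mu> y] by blast
      thus "z \<in> {z \<in> matchings n. stable_type base_matching z = \<mu> \<and> stable_type z y = \<kappa>}"
        using E by (simp add: midpoints_def)
    qed
    hence "path_count n \<kappa> \<mu> base_matching y = card (\<Union>E\<in>Pow ?A. ?Z E)" by (simp add: path_count_def)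
    also have "\<dots> = (\<Sum>E\<in>Pow ?A. card (?Z E))"
    proof (rule card_UN_disjoint)
      show "\<forall>E\<in>Pow ?A. finite (?Z E)" using finite_midpoints finite_subset[of _ ?A] by auto
      show "\<forall>E\<in>Pow ?A. \<forall>E'\<in>Pow ?A. E \<noteq> E' \<longrightarrow> ?Z E \<inter> ?Z E' = {}" by (auto simp: midpoints_def)
    qed simp
    also have "\<dots> = (\<Sum>E\<in>Pow ?A. c (card E))"
      by (intro sum.cong refl c) (auto intro: finite_subset)
    also have "\<dots> = (\<Sum>j\<le>n - m. (n - m choose j) * c j)" using sum_Pow_card[of ?A c] by simp
    also have "\<dots> = (\<Sum>j\<le>n - m + 2 * wt \<mu>. (n - m choose j) * c j)"
      by (intro sum.mono_neutral_left) (auto simp: binomial_eq_0)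
    also have "\<dots> = (\<Sum>j\<le>2 * wt \<mu>. (n - m choose j) * c j)"
      by (intro sum.mono_neutral_right) (auto simp: c0)
    finally show ?thesis .
  qed
  thus ?thesis by blast
qed

definition binomial_poly :: "nat \<Rightarrow> nat \<Rightarrow> rat poly" where
  "binomial_poly m j = smult (1 / fact j) (\<Prod>i<j. [:- of_nat m - of_nat i, 1:])"

lemma poly_binomial_poly: "poly (binomial_poly m j) x = (x - of_nat m) gchoose j"
  by (simp add: binomial_poly_def poly_prod gbinomial_prod_rev algebra_simps lessThan_atLeast0)

text \<open>Negative upper arguments are reduced to natural ones by reflection.\<close>

lemma gbinomial_Ints: "(of_int a gchoose j :: rat) \<in> \<int>"
proof -
  have nat: "(of_nat b gchoose j :: rat) \<in> \<int>" for b by (simp flip: binomial_gbinomial)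
  show ?thesis
  proof (cases "0 \<le> a")
    case True
    hence "of_int a = (of_nat (nat a) :: rat)" by simp
    thus ?thesis using nat by metis
  next
    case False
    have "of_nat j - of_int a - 1 = (of_nat (nat (int j - a - 1)) :: rat)" using False by simp
    thus ?thesis using nat gbinomial_negated_upper[of "of_int a :: rat" j]
      by (metis Ints_mult Ints_power Ints_1 Ints_minus)
  qed
qed

lemma int_valued_polysI: "(\<And>z::int. poly p (of_int z) \<in> \<int>) \<Longrightarrow> p \<in> carrier int_valued_polys"
  by (simp add: int_valued_polys_def)

lemma poly_eqI_nat:
  fixes p q :: "rat poly"
  assumes "\<And>n. m \<le> n \<Longrightarrow> poly p (of_nat n) = poly q (of_nat n)" shows "p = q"
proof (rule ccontr)
  assume "p \<noteq> q"
  hence "finite {x. poly (p - q) x = 0}" by (intro poly_roots_finite) simp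
  moreover have "of_nat ` {m..} \<subseteq> {x. poly (p - q) x = 0}" using assms by auto
  ultimately have "finite (of_nat ` {m..} :: rat set)" using finite_subset by blast
  hence "finite {m..}" by (rule finite_imageD) (simp add: inj_on_def)
  thus False using infinite_Ici by blast
qed

lemma universal_coeff_props:
  assumes \<nu>: "is_partition \<nu>"
  shows "universal_coeff \<kappa> \<mu> \<nu> \<in> carrier int_valued_polys"
    and "wt \<nu> \<le> n \<Longrightarrow> poly (universal_coeff \<kappa> \<mu> \<nu>) (of_nat n) = of_int (hecke_coeff n \<kappa> \<mu> \<nu>)"
proof -
  obtain y where y: "y \<in> matchings (wt \<nu>)" "stable_type base_matching y = \<nu>"
    using stable_type_exists[OF \<nu>] by blast
  let ?m = "wt \<nu>"
  obtain c :: "nat \<Rightarrow> nat" where c: "\<And>n. ?m \<le> n \<Longrightarrow> path_count n \<kappa> \<mu> base_matching y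
    = (\<Sum>j\<le>2 * wt \<mu>. (n - ?m choose j) * c j)" using path_count_binomial[OF y(1)] by blast
  define f where "f = (\<Sum>j\<le>2 * wt \<mu>. smult (of_nat (c j)) (binomial_poly ?m j))"
  have pf: "poly f x = (\<Sum>j\<le>2 * wt \<mu>. of_nat (c j) * ((x - of_nat ?m) gchoose j))" for x
    by (simp add: f_def poly_sum poly_binomial_poly)
  let ?P = "\<lambda>f. f \<in> carrier int_valued_polys \<and>
       (\<forall>n\<ge>?m. poly f (of_nat n) = of_int (hecke_coeff n \<kappa> \<mu> \<nu>))"
  have "?P f"
  proof (intro conjI allI impI)
    show "f \<in> carrier int_valued_polys"
    proof (rule int_valued_polysI)
      fix z :: int
      have "(of_int z - of_nat ?m gchoose j :: rat) \<in> \<int>" for j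
        using gbinomial_Ints[of "z - int ?m" j] by simp
      thus "poly f (of_int z) \<in> \<int>" unfolding pf by (intro Ints_sum Ints_mult) auto
    qed
    fix n assume n: "?m \<le> n"
    have "(of_nat n - of_nat ?m :: rat) = of_nat (n - ?m)" using n by simp
    hence "poly f (of_nat n) = (\<Sum>j\<le>2 * wt \<mu>. of_nat (c j) * (of_nat (n - ?m) gchoose j))"
      unfolding pf by (simp only:)
    also have "\<dots> = of_nat (path_count n \<kappa> \<mu> base_matching y)"
      unfolding c[OF n] of_nat_sum of_nat_mult binomial_gbinomial
      by (intro sum.cong refl mult.commute)
    finally have "poly f (of_nat n) = of_nat (path_count n \<kappa> \<mu> base_matching y)" .
    moreover have "y \<in> matchings n" using y(1) matchings_mono[OF n] by blast
    ultimately show "poly f (of_nat n) = of_int (hecke_coeff n \<kappa> \<mu> \<nu>)"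
      using hecke_coeff_eq[OF \<nu> n _ y(2)] by simp
  qed
  moreover have "g = f" if "?P g" for g
    using that \<open>?P f\<close> by (intro poly_eqI_nat[of ?m]) simp
  ultimately have "?P (universal_coeff \<kappa> \<mu> \<nu>)"
    unfolding universal_coeff_def by (rule theI)
  thus "universal_coeff \<kappa> \<mu> \<nu> \<in> carrier int_valued_polys"
    and "wt \<nu> \<le> n \<Longrightarrow> poly (universal_coeff \<kappa> \<mu> \<nu>) (of_nat n) = of_int (hecke_coeff n \<kappa> \<mu> \<nu>)"
    by auto
qed

lemma poly_universal_coeff:
  assumes u: "u \<in> matchings n" and v: "v \<in> matchings n"
  shows "poly (universal_coeff \<kappa> \<mu> (stable_type u v)) (of_nat n) = of_nat (path_count n \<kappa> \<mu> u v)"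
proof -
  let ?\<nu> = "stable_type u v"
  note \<nu> = is_partition_stable_type[OF u v] wt_stable_type_le[OF u v]
  obtain y where y: "y \<in> matchings n" "stable_type base_matching y = ?\<nu>"
    using stable_type_exists[OF \<nu>(1)] matchings_mono[OF \<nu>(2)] by blast
  show ?thesis
    using universal_coeff_props(2)[OF \<nu>] hecke_coeff_eq[OF \<nu> y]
      path_count_cong[OF u v base_matching_in y(1) y(2)[symmetric]] by simp
qed

text \<open>The size of a type is the distance of the pair, which satisfies the triangle inequality.\<close>

lemma universal_coeff_eq_0:
  assumes \<nu>: "is_partition \<nu>" and "sum_list \<kappa> + sum_list \<mu> < sum_list \<nu>"
  shows "universal_coeff \<kappa> \<mu> \<nu> = 0"
proof (rule poly_eqI_nat[of "wt \<nu>"])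
  fix n assume n: "wt \<nu> \<le> n"
  obtain y where y: "y \<in> matchings n" "stable_type base_matching y = \<nu>"
    using stable_type_exists[OF \<nu>] matchings_mono[OF n] by blast
  have "path_count n \<kappa> \<mu> base_matching y = 0"
    using assms(2) y sum_list_stable_type[of base_matching y]
    by (intro path_count_eq_0[OF base_matching_in]) auto
  thus "poly (universal_coeff \<kappa> \<mu> \<nu>) (of_nat n) = poly 0 (of_nat n)"
    using poly_universal_coeff[OF base_matching_in y(1), of \<kappa> \<mu>] y(2) by simp
qed

section \<open>The universal Hecke ring is a commutative algebra\<close>

lemma int_valued_polys_closed:
  assumes "p \<in> carrier int_valued_polys" "q \<in> carrier int_valued_polys"
  shows "p + q \<in> carrier int_valued_polys" "p * q \<in> carrier int_valued_polys"
  using assms by (auto simp: int_valued_polys_def)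

lemma int_valued_polys_uminus:
  "p \<in> carrier int_valued_polys \<Longrightarrow> - p \<in> carrier int_valued_polys"
  by (auto simp: int_valued_polys_def)

lemma int_valued_polys_const:
  "0 \<in> carrier int_valued_polys" "1 \<in> carrier int_valued_polys" "of_nat k \<in> carrier int_valued_polys"
  by (auto simp: int_valued_polys_def)

lemma int_valued_polys_sum:
  "(\<And>i. i \<in> I \<Longrightarrow> p i \<in> carrier int_valued_polys) \<Longrightarrow> sum p I \<in> carrier int_valued_polys"
  by (induction I rule: infinite_finite_induct)
    (auto simp: int_valued_polys_const intro: int_valued_polys_closed)

lemma int_valued_polys_ops:
  "p \<oplus>\<^bsub>int_valued_polys\<^esub> q = p + q" "p \<otimes>\<^bsub>int_valued_polys\<^esub> q = p * q"
  "\<zero>\<^bsub>int_valued_polys\<^esub> = 0" "\<one>\<^bsub>int_valued_polys\<^esub> = 1"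
  by (simp_all add: int_valued_polys_def)

lemma cring_int_valued_polys: "cring int_valued_polys"
proof (rule cringI)
  show "abelian_group int_valued_polys"
  proof (rule abelian_groupI)
    fix p assume "p \<in> carrier int_valued_polys"
    thus "\<exists>q\<in>carrier int_valued_polys. q \<oplus>\<^bsub>int_valued_polys\<^esub> p = \<zero>\<^bsub>int_valued_polys\<^esub>"
      by (intro bexI[of _ "- p"]) (simp_all add: int_valued_polys_ops int_valued_polys_uminus)
  qed (simp_all add: int_valued_polys_ops int_valued_polys_closed int_valued_polys_const algebra_simps)
  show "Group.comm_monoid int_valued_polys"
    by (rule comm_monoidI)
      (simp_all add: int_valued_polys_ops int_valued_polys_closed int_valued_polys_const algebra_simps)
qed (simp add: int_valued_polys_ops algebra_simps)

abbreviation universal_mult (infixl \<open>\<star>\<close> 70) where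
  "x \<star> y \<equiv> x \<otimes>\<^bsub>universal_hecke\<^esub> y"

lemma universal_hecke_ops:
  "x \<oplus>\<^bsub>universal_hecke\<^esub> y = x + y" "\<zero>\<^bsub>universal_hecke\<^esub> = 0"
  "\<one>\<^bsub>universal_hecke\<^esub> = Poly_Mapping.single [] 1"
  "c \<odot>\<^bsub>universal_hecke\<^esub> x = Poly_Mapping.map ((*) c) x"
  by (simp_all add: universal_hecke_def)

abbreviation scale :: "rat poly \<Rightarrow> ('k \<Rightarrow>\<^sub>0 rat poly) \<Rightarrow> 'k \<Rightarrow>\<^sub>0 rat poly" where
  "scale c x \<equiv> Poly_Mapping.map ((*) c) x"

lemma lookup_scale: "Poly_Mapping.lookup (scale c x) k = c * Poly_Mapping.lookup x k"
  by (simp add: Poly_Mapping.map.rep_eq when_def)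

lemma universal_hecke_carrierI:
  assumes "\<And>\<mu>. Poly_Mapping.lookup x \<mu> \<noteq> 0 \<Longrightarrow> is_partition \<mu>"
    and "\<And>\<mu>. is_partition \<mu> \<Longrightarrow> Poly_Mapping.lookup x \<mu> \<in> carrier int_valued_polys"
  shows "x \<in> carrier universal_hecke"
  using assms by (auto simp: universal_hecke_def in_keys_iff)

lemma universal_hecke_carrierD:
  assumes "x \<in> carrier universal_hecke"
  shows "\<not> is_partition \<mu> \<Longrightarrow> Poly_Mapping.lookup x \<mu> = 0"
    and "Poly_Mapping.lookup x \<mu> \<in> carrier int_valued_polys"
proof -
  have *: "\<forall>\<mu>\<in>Poly_Mapping.keys x. is_partition \<mu> \<and> Poly_Mapping.lookup x \<mu> \<in> carrier int_valued_polys"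
    using assms by (simp add: universal_hecke_def)
  show "\<not> is_partition \<mu> \<Longrightarrow> Poly_Mapping.lookup x \<mu> = 0" using * by (auto simp: in_keys_iff)
  show "Poly_Mapping.lookup x \<mu> \<in> carrier int_valued_polys"
    using * int_valued_polys_const(1) by (cases "\<mu> \<in> Poly_Mapping.keys x") (auto simp: in_keys_iff)
qed

text \<open>The value at level \<open>n\<close> of an element of the universal ring, as a matrix on matchings. Products become
  matrix products (\<open>specialization_mult\<close>).\<close>

definition specialization ::
  "nat \<Rightarrow> (nat list \<Rightarrow>\<^sub>0 rat poly) \<Rightarrow> (nat \<Rightarrow> nat) \<Rightarrow> (nat \<Rightarrow> nat) \<Rightarrow> rat" where
  "specialization n x u v = poly (Poly_Mapping.lookup x (stable_type u v)) (of_nat n)"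

lemma specialization_linear:
  "specialization n (x + y) u v = specialization n x u v + specialization n y u v"
  "specialization n 0 u v = 0"
  "specialization n (- x) u v = - specialization n x u v"
  "specialization n (x - y) u v = specialization n x u v - specialization n y u v"
  "specialization n (scale c x) u v = poly c (of_nat n) * specialization n x u v"
  by (simp_all add: specialization_def lookup_add lookup_minus lookup_scale)

lemma specialization_sum: "specialization n (sum f I) u v = (\<Sum>i\<in>I. specialization n (f i) u v)"
  by (simp add: specialization_def lookup_sum poly_sum)

text \<open>Each coefficient is a polynomial whose values are known for all large \<open>n\<close>, because the type \<open>\<nu>\<close> occurs
  among the matchings of level \<open>n\<close> as soon as \<open>wt \<nu> \<le> n\<close>.\<close>

lemma specialization_ext:
  assumes x: "x \<in> carrier universal_hecke" and y: "y \<in> carrier universal_hecke"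
    and eq: "\<And>n v. v \<in> matchings n \<Longrightarrow> specialization n x base_matching v = specialization n y base_matching v"
  shows "x = y"
proof (rule poly_mapping_eqI)
  fix \<nu>
  show "Poly_Mapping.lookup x \<nu> = Poly_Mapping.lookup y \<nu>"
  proof (cases "is_partition \<nu>")
    case True
    show ?thesis
    proof (rule poly_eqI_nat[of "wt \<nu>"])
      fix n assume n: "wt \<nu> \<le> n"
      obtain v where v: "v \<in> matchings n" "stable_type base_matching v = \<nu>"
        using stable_type_exists[OF True] matchings_mono[OF n] by blast
      show "poly (Poly_Mapping.lookup x \<nu>) (of_nat n) = poly (Poly_Mapping.lookup y \<nu>) (of_nat n)"
        using eq[OF v(1)] v(2) by (simp add: specialization_def)
    qed
  next
    case False
    thus ?thesis using universal_hecke_carrierD(1) x y by metis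
  qed
qed

lemma lookup_universal_mult:
  "Poly_Mapping.lookup (x \<star> y) \<nu> = (if is_partition \<nu> then
     \<Sum>\<kappa>\<in>Poly_Mapping.keys x. \<Sum>\<mu>\<in>Poly_Mapping.keys y.
       Poly_Mapping.lookup x \<kappa> * Poly_Mapping.lookup y \<mu> * universal_coeff \<kappa> \<mu> \<nu> else 0)"
proof -
  have inner: "(\<Sum>\<nu>' | is_partition \<nu>' \<and> sum_list \<nu>' \<le> sum_list \<kappa> + sum_list \<mu>.
      Poly_Mapping.lookup (Poly_Mapping.single \<nu>' (c * universal_coeff \<kappa> \<mu> \<nu>')) \<nu>)
    = (if is_partition \<nu> then c * universal_coeff \<kappa> \<mu> \<nu> else 0)" for \<kappa> \<mu> c
  proof -
    have "(\<Sum>\<nu>' | is_partition \<nu>' \<and> sum_list \<nu>' \<le> sum_list \<kappa> + sum_list \<mu>.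
      Poly_Mapping.lookup (Poly_Mapping.single \<nu>' (c * universal_coeff \<kappa> \<mu> \<nu>')) \<nu>)
      = (\<Sum>\<nu>' | is_partition \<nu>' \<and> sum_list \<nu>' \<le> sum_list \<kappa> + sum_list \<mu>.
      if \<nu>' = \<nu> then c * universal_coeff \<kappa> \<mu> \<nu>' else 0)"
      by (intro sum.cong) (auto simp: lookup_single)
    thus ?thesis using finite_partitions[of "sum_list \<kappa> + sum_list \<mu>"] universal_coeff_eq_0[of \<nu> \<kappa> \<mu>]
      by auto
  qed
  show ?thesis by (simp add: universal_hecke_def lookup_sum inner)
qed

lemma specialization_mult:
  assumes u: "u \<in> matchings n" and v: "v \<in> matchings n"
  shows "specialization n (x \<star> y) u v = (\<Sum>z\<in>matchings n. specialization n y u z * specialization n x z v)"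
proof -
  let ?X = "\<lambda>\<kappa>. poly (Poly_Mapping.lookup x \<kappa>) (of_nat n)"
  let ?Y = "\<lambda>\<mu>. poly (Poly_Mapping.lookup y \<mu>) (of_nat n)"
  \<comment> \<open>Exactly one basis element has a nonzero entry at a given pair of matchings.\<close>
  have sel: "(\<Sum>\<kappa>\<in>Poly_Mapping.keys x. poly (Poly_Mapping.lookup x \<kappa>) (of_nat n) * (if \<nu> = \<kappa> then 1 else 0))
    = poly (Poly_Mapping.lookup x \<nu>) (of_nat n)" for x :: "nat list \<Rightarrow>\<^sub>0 rat poly" and \<nu>
  proof -
    have "(\<Sum>\<kappa>\<in>Poly_Mapping.keys x. poly (Poly_Mapping.lookup x \<kappa>) (of_nat n) * (if \<nu> = \<kappa> then 1 else 0))
      = (\<Sum>\<kappa>\<in>Poly_Mapping.keys x. if \<nu> = \<kappa> then poly (Poly_Mapping.lookup x \<kappa>) (of_nat n) else 0)"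
      by (intro sum.cong) auto
    thus ?thesis by (auto simp: in_keys_iff)
  qed
  have "specialization n (x \<star> y) u v
    = (\<Sum>\<kappa>\<in>Poly_Mapping.keys x. \<Sum>\<mu>\<in>Poly_Mapping.keys y. ?X \<kappa> * ?Y \<mu> * of_nat (path_count n \<kappa> \<mu> u v))"
    using is_partition_stable_type[OF u v]
    by (simp add: specialization_def lookup_universal_mult poly_sum poly_universal_coeff[OF u v])
  also have "\<dots> = (\<Sum>\<kappa>\<in>Poly_Mapping.keys x. \<Sum>\<mu>\<in>Poly_Mapping.keys y. \<Sum>z\<in>matchings n.
      (?X \<kappa> * (if stable_type z v = \<kappa> then 1 else 0)) * (?Y \<mu> * (if stable_type u z = \<mu> then 1 else 0)))"
    unfolding path_count_eq_sum sum_distrib_left by (intro sum.cong refl) (simp only: mult_ac)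
  also have "\<dots> = (\<Sum>\<kappa>\<in>Poly_Mapping.keys x. \<Sum>z\<in>matchings n. \<Sum>\<mu>\<in>Poly_Mapping.keys y.
      (?X \<kappa> * (if stable_type z v = \<kappa> then 1 else 0)) * (?Y \<mu> * (if stable_type u z = \<mu> then 1 else 0)))"
    by (rule sum.cong[OF refl], rule sum.swap)
  also have "\<dots> = (\<Sum>z\<in>matchings n. \<Sum>\<kappa>\<in>Poly_Mapping.keys x. \<Sum>\<mu>\<in>Poly_Mapping.keys y.
      (?X \<kappa> * (if stable_type z v = \<kappa> then 1 else 0)) * (?Y \<mu> * (if stable_type u z = \<mu> then 1 else 0)))"
    by (rule sum.swap)
  also have "\<dots> = (\<Sum>z\<in>matchings n. ?X (stable_type z v) * ?Y (stable_type u z))"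
    by (simp only: sum_product[symmetric] sel)
  finally show ?thesis by (simp add: specialization_def mult.commute)
qed

lemma universal_mult_closed:
  assumes x: "x \<in> carrier universal_hecke" and y: "y \<in> carrier universal_hecke"
  shows "x \<star> y \<in> carrier universal_hecke"
  by (rule universal_hecke_carrierI)
    (auto simp: lookup_universal_mult split: if_splits intro!: int_valued_polys_sum
      int_valued_polys_closed universal_hecke_carrierD(2)[OF x] universal_hecke_carrierD(2)[OF y]
      universal_coeff_props(1))

lemma universal_add_closed:
  assumes x: "x \<in> carrier universal_hecke" and y: "y \<in> carrier universal_hecke"
  shows "x + y \<in> carrier universal_hecke"
proof (rule universal_hecke_carrierI)
  fix \<mu> assume "Poly_Mapping.lookup (x + y) \<mu> \<noteq> 0"
  thus "is_partition \<mu>"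
    using universal_hecke_carrierD(1)[OF x, of \<mu>] universal_hecke_carrierD(1)[OF y, of \<mu>]
    by (cases "is_partition \<mu>") (auto simp: lookup_add)
qed (simp add: lookup_add int_valued_polys_closed universal_hecke_carrierD x y)

lemma universal_scale_closed:
  assumes c: "c \<in> carrier int_valued_polys" and x: "x \<in> carrier universal_hecke"
  shows "scale c x \<in> carrier universal_hecke"
proof (rule universal_hecke_carrierI)
  fix \<mu> assume "Poly_Mapping.lookup (scale c x) \<mu> \<noteq> 0"
  thus "is_partition \<mu>" using universal_hecke_carrierD(1)[OF x, of \<mu>]
    by (cases "is_partition \<mu>") (auto simp: lookup_scale)
qed (simp add: lookup_scale int_valued_polys_closed universal_hecke_carrierD x c)

lemma universal_const_closed:
  "0 \<in> carrier universal_hecke"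
  "is_partition \<mu> \<Longrightarrow> Poly_Mapping.single \<mu> 1 \<in> carrier universal_hecke"
  by (auto intro!: universal_hecke_carrierI simp: lookup_single when_def int_valued_polys_const split: if_splits)

lemma universal_minus_closed:
  assumes x: "x \<in> carrier universal_hecke"
  shows "- x \<in> carrier universal_hecke"
proof (rule universal_hecke_carrierI)
  fix \<mu> assume "Poly_Mapping.lookup (- x) \<mu> \<noteq> 0"
  thus "is_partition \<mu>" using universal_hecke_carrierD(1)[OF x, of \<mu>]
    by (cases "is_partition \<mu>") auto
qed (simp add: int_valued_polys_uminus universal_hecke_carrierD x)

lemma universal_sum_closed:
  "(\<And>i. i \<in> I \<Longrightarrow> f i \<in> carrier universal_hecke) \<Longrightarrow> sum f I \<in> carrier universal_hecke"
  by (induction I rule: infinite_finite_induct)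
    (auto simp: universal_const_closed intro: universal_add_closed)

lemma is_partition_Nil: "is_partition []"
  by (simp add: is_partition_def)

lemma specialization_one:
  assumes "u \<in> matchings n" "v \<in> matchings n"
  shows "specialization n \<one>\<^bsub>universal_hecke\<^esub> u v = (if u = v then 1 else 0)"
proof -
  have "stable_type u v = [] \<longleftrightarrow> u = v"
    unfolding stable_type_def using pair_type_empty_iff[OF assms]
    by (metis list_of_empty list_of_inject)
  thus ?thesis by (auto simp: specialization_def universal_hecke_ops lookup_single when_def)
qed

text \<open>A pair of matchings and the reversed pair have the same type, so that reversing the two-step paths
  exchanges the factors.\<close>

lemma universal_mult_commute:
  assumes "x \<in> carrier universal_hecke" "y \<in> carrier universal_hecke"
  shows "x \<star> y = y \<star> x"
proof (rule specialization_ext)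
  fix n v assume v: "v \<in> matchings n"
  let ?t = base_matching
  let ?F = "\<lambda>p q. poly (Poly_Mapping.lookup y p) (of_nat n) * poly (Poly_Mapping.lookup x q) (of_nat n)"
  have "(\<Sum>z\<in>matchings n. ?F (stable_type ?t z) (stable_type z v))
    = (\<Sum>z\<in>matchings n. ?F (stable_type v z) (stable_type z ?t))"
    by (rule sum_paths_cong[OF base_matching_in v v base_matching_in stable_type_commute])
  thus "specialization n (x \<star> y) ?t v = specialization n (y \<star> x) ?t v"
    unfolding specialization_mult[OF base_matching_in v]
    by (simp add: specialization_def stable_type_commute[of v] stable_type_commute[of _ ?t] mult.commute)
qed (simp_all add: universal_mult_closed assms)

lemma universal_mult_assoc:
  assumes "x \<in> carrier universal_hecke" "y \<in> carrier universal_hecke" "z \<in> carrier universal_hecke"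
  shows "(x \<star> y) \<star> z
    = x \<star> (y \<star> z)"
proof (rule specialization_ext)
  fix n v assume v: "v \<in> matchings n"
  let ?t = base_matching
  have "specialization n ((x \<star> y) \<star> z) ?t v
    = (\<Sum>a\<in>matchings n. \<Sum>b\<in>matchings n. specialization n z ?t a * (specialization n y a b * specialization n x b v))"
    using v by (simp add: specialization_mult base_matching_in sum_distrib_left)
  also have "\<dots> = (\<Sum>b\<in>matchings n. \<Sum>a\<in>matchings n. specialization n z ?t a * specialization n y a b * specialization n x b v)"
    by (subst sum.swap) (simp only: mult.assoc)
  also have "\<dots> = specialization n (x \<star> (y \<star> z)) ?t v"
    using v by (simp add: specialization_mult base_matching_in sum_distrib_right)
  finally show "specialization n ((x \<star> y) \<star> z) ?t v
    = specialization n (x \<star> (y \<star> z)) ?t v" .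
qed (simp_all add: universal_mult_closed assms)

lemma universal_mult_one:
  assumes "x \<in> carrier universal_hecke"
  shows "\<one>\<^bsub>universal_hecke\<^esub> \<star> x = x"
proof (rule specialization_ext)
  fix n v assume v: "v \<in> matchings n"
  have "specialization n (\<one>\<^bsub>universal_hecke\<^esub> \<star> x) base_matching v
    = (\<Sum>z\<in>matchings n. if z = v then specialization n x base_matching z else 0)"
    unfolding specialization_mult[OF base_matching_in v] using v by (intro sum.cong) (auto simp: specialization_one)
  also have "\<dots> = specialization n x base_matching v" using v finite_matchings by simp
  finally show "specialization n (\<one>\<^bsub>universal_hecke\<^esub> \<star> x) base_matching v = specialization n x base_matching v" .
qed (use universal_mult_closed assms universal_const_closed(2)[OF is_partition_Nil] in
      \<open>auto simp: universal_hecke_ops\<close>)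

lemma universal_mult_distrib:
  assumes "x \<in> carrier universal_hecke" "y \<in> carrier universal_hecke" "z \<in> carrier universal_hecke"
  shows "(x + y) \<star> z = x \<star> z + y \<star> z"
  by (rule specialization_ext)
    (simp_all add: universal_mult_closed universal_add_closed assms specialization_mult base_matching_in
      specialization_linear sum.distrib algebra_simps)

lemma universal_mult_scale:
  assumes "c \<in> carrier int_valued_polys" "x \<in> carrier universal_hecke" "y \<in> carrier universal_hecke"
  shows "scale c x \<star> y
    = scale c (x \<star> y)"
  by (rule specialization_ext)
    (simp_all add: universal_mult_closed universal_scale_closed assms specialization_mult base_matching_in
      specialization_linear sum_distrib_left algebra_simps)

lemma cring_universal_hecke: "cring universal_hecke"
proof (rule cringI)
  show "abelian_group universal_hecke"
  proof (rule abelian_groupI)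
    fix x assume "x \<in> carrier universal_hecke"
    thus "\<exists>y\<in>carrier universal_hecke. y \<oplus>\<^bsub>universal_hecke\<^esub> x = \<zero>\<^bsub>universal_hecke\<^esub>"
      by (intro bexI[of _ "- x"]) (simp_all add: universal_hecke_ops universal_minus_closed)
  qed (simp_all add: universal_hecke_ops universal_add_closed universal_const_closed algebra_simps)
  show "Group.comm_monoid universal_hecke"
  proof (rule comm_monoidI)
    show "\<one>\<^bsub>universal_hecke\<^esub> \<in> carrier universal_hecke"
      using universal_const_closed(2)[OF is_partition_Nil] by (simp add: universal_hecke_ops)
  qed (fact universal_mult_closed universal_mult_assoc universal_mult_one universal_mult_commute)+
qed (simp add: universal_hecke_ops universal_mult_distrib)

lemma algebra_universal_hecke: "algebra int_valued_polys universal_hecke"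
proof (rule algebraI[OF cring_int_valued_polys cring_universal_hecke])
  fix c x y assume "c \<in> carrier int_valued_polys" "x \<in> carrier universal_hecke" "y \<in> carrier universal_hecke"
  thus "(c \<odot>\<^bsub>universal_hecke\<^esub> x) \<star> y = c \<odot>\<^bsub>universal_hecke\<^esub> (x \<star> y)"
    by (simp add: universal_hecke_ops universal_mult_scale)
qed (auto simp: universal_hecke_ops int_valued_polys_ops universal_scale_closed
    lookup_scale lookup_add algebra_simps intro!: poly_mapping_eqI)

section \<open>Products of the generators\<close>

lemma lookup_hecke_T:
  "Poly_Mapping.lookup (hecke_T i) \<nu> = (if is_partition \<nu> \<and> sum_list \<nu> = i then 1 else 0)"
proof -
  have fin: "finite {\<mu>. is_partition \<mu> \<and> sum_list \<mu> = i}"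
    by (rule finite_subset[OF _ finite_partitions[of i]]) auto
  have "Poly_Mapping.lookup (hecke_T i) \<nu> = (\<Sum>\<mu> | is_partition \<mu> \<and> sum_list \<mu> = i. if \<mu> = \<nu> then 1 else 0)"
    unfolding hecke_T_def lookup_sum by (intro sum.cong) (auto simp: lookup_single)
  thus ?thesis using fin by simp
qed

lemma hecke_T_closed: "hecke_T i \<in> carrier universal_hecke"
  by (rule universal_hecke_carrierI) (auto simp: lookup_hecke_T int_valued_polys_const split: if_splits)

lemma specialization_hecke_T:
  assumes "u \<in> matchings n" "v \<in> matchings n"
  shows "specialization n (hecke_T i) u v = (if distance u v = i then 1 else 0)"
  using is_partition_stable_type[OF assms] by (simp add: specialization_def lookup_hecke_T sum_list_stable_type)

definition T_product :: "nat list \<Rightarrow> nat list \<Rightarrow>\<^sub>0 rat poly" where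
  "T_product l = foldr (\<lambda>i x. hecke_T i \<star> x) l \<one>\<^bsub>universal_hecke\<^esub>"

lemma T_product_closed: "T_product l \<in> carrier universal_hecke"
proof (induction l)
  case Nil
  thus ?case using universal_const_closed(2)[OF is_partition_Nil] by (simp add: T_product_def universal_hecke_ops)
qed (simp add: T_product_def universal_mult_closed hecke_T_closed)

lemma T_product_append: "T_product (l @ l') = T_product l \<star> T_product l'"
proof (induction l)
  case Nil
  thus ?case using universal_mult_one[OF T_product_closed[of l']] by (simp add: T_product_def)
next
  case (Cons i l)
  have "T_product ((i # l) @ l') = hecke_T i \<star> T_product (l @ l')"
    by (simp add: T_product_def)
  also have "\<dots> = (hecke_T i \<star> T_product l) \<star> T_product l'"
    unfolding Cons.IH by (rule universal_mult_assoc[symmetric]) (simp_all add: hecke_T_closed T_product_closed)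
  finally show ?case by (simp add: T_product_def)
qed

lemma T_product_perm: "mset l = mset l' \<Longrightarrow> T_product l = T_product l'"
proof (induction l arbitrary: l')
  case (Cons i l)
  hence "i \<in> set l'" by (metis list.set_intros(1) set_mset_mset)
  then obtain a b where l': "l' = a @ i # b" by (meson split_list)
  hence "mset l = mset (a @ b)" using Cons.prems by simp
  hence IH: "T_product l = T_product (a @ b)" by (rule Cons.IH)
  have c: "T_product [i] \<in> carrier universal_hecke" "T_product a \<in> carrier universal_hecke"
    "T_product b \<in> carrier universal_hecke" by (rule T_product_closed)+
  have "T_product (i # l) = T_product [i] \<star> T_product l"
    using T_product_append[of "[i]" l] by simp
  also have "\<dots> = (T_product [i] \<star> T_product a) \<star> T_product b"
    unfolding IH T_product_append by (rule universal_mult_assoc[OF c, symmetric])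
  also have "\<dots> = T_product (a @ [i]) \<star> T_product b"
    unfolding T_product_append universal_mult_commute[OF c(1,2)] ..
  also have "\<dots> = T_product l'" using T_product_append[of "a @ [i]" b] l' by simp
  finally show ?case .
qed simp

section \<open>Jucys--Murphy operators\<close>

text \<open>The Jucys--Murphy operator: the sum of the transpositions of \<open>2 * k - 1\<close> with all smaller vertices,
  acting on functions of matchings.\<close>

definition jm :: "nat \<Rightarrow> ((nat \<Rightarrow> nat) \<Rightarrow> rat) \<Rightarrow> (nat \<Rightarrow> nat) \<Rightarrow> rat" where
  "jm k f v = (\<Sum>b\<in>{1..2 * k - 2}. f (switch b (2 * k - 1) v))"

text \<open>A multiset is a monomial in the commuting operators, here applied to the indicator of the base
  matching.\<close>

definition jm_monomial :: "nat multiset \<Rightarrow> (nat \<Rightarrow> nat) \<Rightarrow> rat" where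
  "jm_monomial M = fold_mset jm (\<lambda>v. if v = base_matching then 1 else 0) M"

text \<open>Moving one transposition past the other one conjugates it.\<close>

lemma switch_switch_commute:
  assumes "q \<noteq> b" "q \<noteq> p"
  shows "switch c q (switch b p v) = switch b p (switch (transpose b p c) q v)"
proof -
  have 1: "transpose c q (transpose b p i) = transpose b p (transpose (transpose b p c) q i)" for i
    using assms by (auto simp: transpose_def)
  have 2: "transpose b p (transpose c q i) = transpose (transpose b p c) q (transpose b p i)" for i
    using assms by (auto simp: transpose_def)
  show ?thesis by (rule ext) (simp add: switch_def 1 2)
qed

text \<open>For \<open>k < l\<close> each transposition in the sum \<open>jm k\<close> permutes the summands of \<open>jm l\<close> by conjugation.\<close>

lemma jm_commute_less:
  assumes "k < l" shows "jm k (jm l f) v = jm l (jm k f) v"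
proof -
  let ?p = "2 * k - 1" and ?q = "2 * l - 1" and ?B = "{1..2 * k - 2}" and ?C = "{1..2 * l - 2}"
  have "(\<Sum>c\<in>?C. f (switch c ?q (switch b ?p v))) = (\<Sum>c\<in>?C. f (switch b ?p (switch c ?q v)))"
    if b: "b \<in> ?B" for b
  proof -
    have "transpose b ?p permutes ?C" using b assms by (intro permutes_swap_id) auto
    hence "(\<Sum>c\<in>?C. f (switch b ?p (switch c ?q v)))
      = (\<Sum>c\<in>?C. f (switch b ?p (switch (transpose b ?p c) ?q v)))"
      using sum.permute[of _ ?C "\<lambda>c. f (switch b ?p (switch c ?q v))"] by (simp add: comp_def)
    also have "\<dots> = (\<Sum>c\<in>?C. f (switch c ?q (switch b ?p v)))"
      using b assms switch_switch_commute[of ?q b ?p] by (intro sum.cong refl arg_cong[of _ _ f]) auto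
    finally show ?thesis ..
  qed
  hence "jm k (jm l f) v = (\<Sum>b\<in>?B. \<Sum>c\<in>?C. f (switch b ?p (switch c ?q v)))"
    by (simp add: jm_def)
  also have "\<dots> = jm l (jm k f) v" unfolding jm_def by (rule sum.swap)
  finally show ?thesis .
qed

lemma jm_commute: "jm k (jm l f) = jm l (jm k f)"
  using jm_commute_less[of k l f] jm_commute_less[of l k f] by (cases k l rule: linorder_cases) auto

lemma jm_monomial_empty: "jm_monomial {#} v = (if v = base_matching then 1 else 0)"
  by (simp add: jm_monomial_def)

lemma jm_monomial_add: "jm_monomial (add_mset k M) = jm k (jm_monomial M)"
proof -
  interpret comp_fun_commute jm
    by standard (simp add: fun_eq_iff comp_def jm_commute)
  show ?thesis by (simp add: jm_monomial_def)
qed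

lemma jm_monomial_nonzeroE:
  assumes "jm_monomial (add_mset k M) v \<noteq> 0"
  obtains b where "1 \<le> k" "b \<in> {1..2 * k - 2}" "jm_monomial M (switch b (2 * k - 1) v) \<noteq> 0"
proof -
  obtain b where b: "b \<in> {1..2 * k - 2}" "jm_monomial M (switch b (2 * k - 1) v) \<noteq> 0"
    using assms unfolding jm_monomial_add jm_def by (meson sum.neutral)
  moreover from b have "1 \<le> k" by (cases k) auto
  ultimately show thesis using that by blast
qed

lemma jm_monomial_support:
  assumes "set_mset M \<subseteq> {1..n}" "jm_monomial M v \<noteq> 0"
  shows "v \<in> matchings n"
  using assms
proof (induction M arbitrary: v)
  case empty
  thus ?case using base_matching_in by (auto simp: jm_monomial_empty split: if_splits)
next
  case (add k M)
  obtain b where b: "1 \<le> k" "b \<in> {1..2 * k - 2}" "jm_monomial M (switch b (2 * k - 1) v) \<noteq> 0"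
    using jm_monomial_nonzeroE[OF add.prems(2)] .
  hence "switch b (2 * k - 1) v \<in> matchings n" using add by auto
  moreover have "k \<le> n" using add.prems by auto
  ultimately have "switch b (2 * k - 1) (switch b (2 * k - 1) v) \<in> matchings n"
    using b by (intro switch_matchings[of "switch b (2 * k - 1) v"]) auto
  thus ?case by simp
qed

subsection \<open>Elementary symmetric polynomials\<close>

lemma matchings_Suc_iff:
  assumes z: "z \<in> matchings (Suc n)"
  shows "z \<in> matchings n \<longleftrightarrow> z (2 * n + 2) = 2 * n + 1"
proof
  assume "z \<in> matchings n"
  hence "z (2 * n + 2) = base_matching (2 * n + 2)" by (intro matchings_outside) auto
  thus "z (2 * n + 2) = 2 * n + 1" by (simp add: base_matching_def)
next
  assume a: "z (2 * n + 2) = 2 * n + 1"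
  hence a': "z (2 * n + 1) = 2 * n + 2" using involutionD[OF matchings_involution[OF z]] by metis
  have "z i = base_matching i" if "i \<notin> {1..2 * n}" for i
  proof -
    have "i = 2 * n + 1 \<or> i = 2 * n + 2 \<or> i \<notin> {1..2 * Suc n}" using that by auto
    thus ?thesis
      using a a' matchings_outside[OF z, of i] by (elim disjE) (auto simp: base_matching_def)
  qed
  thus "z \<in> matchings n" using z by (auto simp: matchings_def)
qed

lemma sum_Pow_insert:
  fixes F :: "'a set \<Rightarrow> 'b::comm_monoid_add"
  assumes "finite A" "a \<notin> A"
  shows "(\<Sum>S\<in>Pow (insert a A). F S) = (\<Sum>S\<in>Pow A. F S) + (\<Sum>S\<in>Pow A. F (insert a S))"
proof -
  have "inj_on (insert a) (Pow A)" using assms(2) by (auto simp: inj_on_def)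
  moreover have "Pow A \<inter> insert a ` Pow A = {}" using assms(2) by blast
  ultimately show ?thesis using assms(1)
    by (simp add: Pow_insert sum.union_disjoint sum.reindex)
qed

text \<open>Induction on \<open>n\<close>: a matching in which the last pair is not an edge comes from exactly one matching of
  the lower level, through the transposition of \<open>2 * n + 1\<close> with the partner of \<open>2 * n + 2\<close>. It merges
  the last pair with another component and raises the distance by one.\<close>

lemma elementary_jm:
  assumes "z \<in> matchings n"
  shows "(\<Sum>S\<in>Pow {1..n}. if card S = i then jm_monomial (mset_set S) z else 0)
    = (if distance base_matching z = i then 1 else 0)"
  using assms
proof (induction n arbitrary: z i)
  case 0
  hence "z = base_matching" by (simp add: matchings_0)
  moreover have "distance base_matching base_matching = 0"
    using distance_eq_0_iff[OF base_matching_in base_matching_in] by simp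
  ultimately show ?case by (simp add: jm_monomial_empty)
next
  case (Suc n)
  let ?t = base_matching and ?p = "2 * n + 1" and ?q = "2 * n + 2"
  let ?F = "\<lambda>S. if card S = i then jm_monomial (mset_set S) z else 0"
  have p: "2 * Suc n - 1 = ?p" "2 * Suc n - 2 = 2 * n" by simp_all
  have vanish: "jm_monomial (mset_set S) v = 0" if "S \<in> Pow {1..n}" "v \<notin> matchings n" for S v
    using jm_monomial_support[of "mset_set S" n v] that finite_subset[of S "{1..n}"] by auto
  have "(\<Sum>S\<in>Pow {1..Suc n}. ?F S) = (\<Sum>S\<in>Pow {1..n}. ?F S) + (\<Sum>S\<in>Pow {1..n}. ?F (insert (Suc n) S))"
    using sum_Pow_insert[of "{1..n}" "Suc n" ?F] by (simp add: atLeastAtMostSuc_conv)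
  also have "(\<Sum>S\<in>Pow {1..n}. ?F (insert (Suc n) S)) = (\<Sum>S\<in>Pow {1..n}.
      \<Sum>b\<in>{1..2 * n}. if card S + 1 = i then jm_monomial (mset_set S) (switch b ?p z) else 0)"
  proof (rule sum.cong[OF refl])
    fix S assume S: "S \<in> Pow {1..n}"
    hence "finite S" "Suc n \<notin> S" using finite_subset[of S "{1..n}"] by auto
    thus "?F (insert (Suc n) S) =
      (\<Sum>b\<in>{1..2 * n}. if card S + 1 = i then jm_monomial (mset_set S) (switch b ?p z) else 0)"
      using p by (simp add: jm_monomial_add jm_def)
  qed
  also have "\<dots> = (\<Sum>b\<in>{1..2 * n}. \<Sum>S\<in>Pow {1..n}.
      if card S + 1 = i then jm_monomial (mset_set S) (switch b ?p z) else 0)"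
    by (rule sum.swap)
  finally have eq: "(\<Sum>S\<in>Pow {1..Suc n}. ?F S) = (\<Sum>S\<in>Pow {1..n}. ?F S) + (\<Sum>b\<in>{1..2 * n}.
      \<Sum>S\<in>Pow {1..n}. if card S + 1 = i then jm_monomial (mset_set S) (switch b ?p z) else 0)" .
  have sw: "switch b ?p z \<in> matchings (Suc n)" if "b \<in> {1..2 * n}" for b
    using that by (intro switch_matchings[OF Suc.prems]) auto
  have sq: "switch b ?p z ?q = transpose b ?p (z ?q)" if "b \<in> {1..2 * n}" for b
    using that by (simp add: switch_def)
  show ?case
  proof (cases "z \<in> matchings n")
    case True
    hence zq: "z ?q = ?p" using matchings_Suc_iff[OF Suc.prems] by simp
    have "switch b ?p z \<notin> matchings n" if "b \<in> {1..2 * n}" for b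
      unfolding matchings_Suc_iff[OF sw[OF that]] sq[OF that] zq using that by simp
    hence "(\<Sum>b\<in>{1..2 * n}.
      \<Sum>S\<in>Pow {1..n}. if card S + 1 = i then jm_monomial (mset_set S) (switch b ?p z) else 0) = 0"
      by (intro sum.neutral ballI) (auto simp: vanish)
    thus ?thesis unfolding eq using Suc.IH[OF True, of i] by simp
  next
    case False
    let ?b = "z ?q"
    have "?b \<noteq> ?q" using matchings_no_fixpoint[OF Suc.prems] by simp
    moreover have bp: "?b \<noteq> ?p" using False matchings_Suc_iff[OF Suc.prems] by simp
    moreover have "?b \<in> {1..2 * Suc n}" using matchings_range[OF Suc.prems, of ?q] by auto
    ultimately have b: "?b \<in> {1..2 * n}" by auto
    let ?z = "switch ?b ?p z"
    have z0: "?z \<in> matchings n"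
      unfolding matchings_Suc_iff[OF sw[OF b]] sq[OF b] by simp
    have out: "switch b ?p z \<notin> matchings n" if "b \<in> {1..2 * n} - {?b}" for b
    proof -
      have bb: "b \<in> {1..2 * n}" "?b \<noteq> b" using that by auto
      thus ?thesis unfolding matchings_Suc_iff[OF sw[OF bb(1)]] sq[OF bb(1)] using bp by simp
    qed
    have ct: "component ?t ?z ?p = {?p, ?q}"
    proof -
      have "?z ?p = ?t ?p" using z0 by (intro matchings_outside) auto
      moreover have "?t ?p = ?q" by (simp add: base_matching_def)
      ultimately show ?thesis
        using component_trivial[of ?t ?z ?p] matchings_involution z0 base_matching_in by metis
    qed
    have d: "distance ?t z = distance ?t ?z + 1"
    proof -
      have "?b \<notin> component ?t ?z ?p" using ct b by auto
      hence "distance ?t (switch ?p ?b ?z) = distance ?t ?z + 1"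
        using b by (intro distance_merge[OF base_matching_in z0]) auto
      moreover have "switch ?p ?b ?z = z" by (simp only: switch_commute[of ?p ?b] switch_switch)
      ultimately show ?thesis by simp
    qed
    have "(\<Sum>b\<in>{1..2 * n}.
      \<Sum>S\<in>Pow {1..n}. if card S + 1 = i then jm_monomial (mset_set S) (switch b ?p z) else 0)
      = (\<Sum>b\<in>{?b}.
      \<Sum>S\<in>Pow {1..n}. if card S + 1 = i then jm_monomial (mset_set S) (switch b ?p z) else 0)"
      using b out vanish by (intro sum.mono_neutral_right) (auto intro!: sum.neutral)
    also have "\<dots> = (\<Sum>S\<in>Pow {1..n}. if card S + 1 = i then jm_monomial (mset_set S) ?z else 0)" by simp
    also have "\<dots> = (if distance ?t ?z + 1 = i then 1 else 0)"
    proof (cases i)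
      case (Suc j)
      thus ?thesis using Suc.IH[OF z0, of j] by simp
    qed simp
    moreover have "(\<Sum>S\<in>Pow {1..n}. ?F S) = 0" using vanish False by (auto intro!: sum.neutral)
    ultimately show ?thesis unfolding eq d by simp
  qed
qed

lemma distance_switch_move:
  "distance (switch a b x) y = distance x (switch a b y)"
  by (rule distance_conj[of "transpose a b"]) (simp_all add: switch_def)

lemma bij_betw_switch:
  assumes "a \<in> {1..2 * n}" "b \<in> {1..2 * n}"
  shows "bij_betw (switch a b) (matchings n) (matchings n)"
  by (rule bij_betwI[of _ _ _ "switch a b"]) (use switch_matchings assms in auto)

text \<open>A switch preserves distances and can therefore be moved from one side of \<open>distance z v\<close> to the other.
  In this way the operators \<open>jm k\<close> commute with the summation over all \<open>z\<close> at distance \<open>i\<close>, and the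
  claim is reduced to the base matching.\<close>

lemma elementary_jm_monomial:
  assumes "set_mset M \<subseteq> {1..n}" "v \<in> matchings n"
  shows "(\<Sum>z\<in>matchings n. jm_monomial M z * (if distance z v = i then 1 else 0))
    = (\<Sum>S\<in>Pow {1..n}. if card S = i then jm_monomial (mset_set S + M) v else 0)"
  using assms
proof (induction M arbitrary: v)
  case empty
  have "(\<Sum>z\<in>matchings n. jm_monomial {#} z * (if distance z v = i then 1 else 0))
    = (\<Sum>z\<in>matchings n. if z = base_matching then (if distance base_matching v = i then 1 else 0) else 0)"
    by (intro sum.cong) (auto simp: jm_monomial_empty)
  also have "\<dots> = (if distance base_matching v = i then 1 else 0)"
    using finite_matchings base_matching_in by simp
  finally show ?case using elementary_jm[OF empty.prems(2), of i] by (simp only: add_0_right)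
next
  case (add k M)
  let ?p = "2 * k - 1" and ?B = "{1..2 * k - 2}"
  let ?I = "\<lambda>z v. if distance z v = i then 1 else (0::rat)"
  have k: "1 \<le> k" "k \<le> n" using add.prems by auto
  have B: "b \<in> {1..2 * n}" "?p \<in> {1..2 * n}" if "b \<in> ?B" for b using that k by auto
  have "(\<Sum>z\<in>matchings n. jm_monomial (add_mset k M) z * ?I z v)
    = (\<Sum>b\<in>?B. \<Sum>z\<in>matchings n. jm_monomial M (switch b ?p z) * ?I z v)"
    unfolding jm_monomial_add jm_def sum_distrib_right by (rule sum.swap)
  also have "\<dots> = (\<Sum>b\<in>?B. \<Sum>z\<in>matchings n. jm_monomial M z * ?I z (switch b ?p v))"
  proof (rule sum.cong[OF refl])
    fix b assume b: "b \<in> ?B"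
    show "(\<Sum>z\<in>matchings n. jm_monomial M (switch b ?p z) * ?I z v)
      = (\<Sum>z\<in>matchings n. jm_monomial M z * ?I z (switch b ?p v))"
      by (subst sum.reindex_bij_betw[OF bij_betw_switch[OF B[OF b]], symmetric])
        (simp add: distance_switch_move)
  qed
  also have "\<dots> = (\<Sum>b\<in>?B. \<Sum>S\<in>Pow {1..n}. if card S = i then jm_monomial (mset_set S + M) (switch b ?p v) else 0)"
    using add.prems B by (intro sum.cong[OF refl] add.IH switch_matchings) auto
  also have "\<dots> = (\<Sum>S\<in>Pow {1..n}. \<Sum>b\<in>?B. if card S = i then jm_monomial (mset_set S + M) (switch b ?p v) else 0)"
    by (rule sum.swap)
  also have "\<dots> = (\<Sum>S\<in>Pow {1..n}. if card S = i then jm_monomial (mset_set S + add_mset k M) v else 0)"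
    by (intro sum.cong refl) (simp add: jm_monomial_add jm_def)
  finally show ?case .
qed

text \<open>Lists of squarefree monomials of prescribed degrees; \<open>total\<close> is the exponent multiset of their
  product.\<close>

definition set_lists :: "nat \<Rightarrow> nat list \<Rightarrow> nat set list set" where
  "set_lists n l = {Ss. list_all2 (\<lambda>S i. S \<subseteq> {1..n} \<and> card S = i) Ss l}"

definition total :: "nat set list \<Rightarrow> nat multiset" where
  "total Ss = sum_list (map mset_set Ss)"

lemma set_lists_Nil: "set_lists n [] = {[]}"
  by (simp add: set_lists_def)

lemma set_lists_Cons:
  "set_lists n (i # l) = (\<lambda>(S, Ss). S # Ss) ` ({S \<in> Pow {1..n}. card S = i} \<times> set_lists n l)"
  by (auto simp: set_lists_def list_all2_Cons2 image_iff)

lemma finite_set_lists: "finite (set_lists n l)"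
  by (induction l) (auto simp: set_lists_Nil set_lists_Cons)

lemma total_subset: "Ss \<in> set_lists n l \<Longrightarrow> set_mset (total Ss) \<subseteq> {1..n}"
proof (induction l arbitrary: Ss)
  case (Cons i l)
  then obtain S Ss' where S: "Ss = S # Ss'" "S \<subseteq> {1..n}" "Ss' \<in> set_lists n l"
    by (auto simp: set_lists_Cons)
  hence "finite S" using finite_subset by blast
  thus ?case using S Cons.IH[OF S(3)] by (auto simp: total_def)
qed (simp add: set_lists_Nil total_def)

text \<open>Each generator in turn contributes an elementary symmetric function in the operators \<open>jm k\<close>.\<close>

lemma specialization_T_product:
  assumes "v \<in> matchings n"
  shows "specialization n (T_product l) base_matching v = (\<Sum>Ss\<in>set_lists n l. jm_monomial (total Ss) v)"
  using assms
proof (induction l arbitrary: v)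
  case Nil
  thus ?case using specialization_one[OF base_matching_in Nil]
    by (auto simp: T_product_def set_lists_Nil total_def jm_monomial_empty)
next
  case (Cons i l)
  let ?P = "{S \<in> Pow {1..n}. card S = i}"
  have "specialization n (T_product (i # l)) base_matching v
    = (\<Sum>z\<in>matchings n. specialization n (T_product l) base_matching z * (if distance z v = i then 1 else 0))"
    using specialization_mult[OF base_matching_in Cons.prems, of "hecke_T i" "T_product l"] Cons.prems
    by (simp add: T_product_def specialization_hecke_T)
  also have "\<dots> = (\<Sum>z\<in>matchings n. \<Sum>Ss\<in>set_lists n l.
      jm_monomial (total Ss) z * (if distance z v = i then 1 else 0))"
    by (intro sum.cong refl) (simp only: Cons.IH sum_distrib_right)
  also have "\<dots> = (\<Sum>Ss\<in>set_lists n l. \<Sum>z\<in>matchings n.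
      jm_monomial (total Ss) z * (if distance z v = i then 1 else 0))" by (rule sum.swap)
  also have "\<dots> = (\<Sum>Ss\<in>set_lists n l. \<Sum>S\<in>Pow {1..n}.
      if card S = i then jm_monomial (mset_set S + total Ss) v else 0)"
    by (intro sum.cong refl elementary_jm_monomial total_subset Cons.prems)
  also have "\<dots> = (\<Sum>Ss\<in>set_lists n l. \<Sum>S\<in>?P. jm_monomial (mset_set S + total Ss) v)"
    by (intro sum.cong refl sum.inter_filter[symmetric]) simp
  also have "\<dots> = (\<Sum>(S, Ss)\<in>?P \<times> set_lists n l. jm_monomial (mset_set S + total Ss) v)"
    by (subst sum.swap) (rule sum.cartesian_product)
  also have "\<dots> = (\<Sum>Ss\<in>set_lists n (i # l). jm_monomial (total Ss) v)"
  proof -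
    have inj: "inj_on (\<lambda>(S, Ss). S # Ss) (?P \<times> set_lists n l)" by (auto simp: inj_on_def)
    show ?thesis unfolding set_lists_Cons sum.reindex[OF inj]
      by (intro sum.cong refl) (auto simp: total_def)
  qed
  finally show ?case .
qed

section \<open>Leading terms of Jucys--Murphy monomials\<close>

text \<open>The factors of the monomial are distributed over the components: a component of excess \<open>r\<close> receives
  \<open>r\<close> of them, and its largest pair is among the indices if \<open>r > 0\<close>.\<close>

definition fits :: "nat multiset \<Rightarrow> (nat \<Rightarrow> nat) \<Rightarrow> bool" where
  "fits M v \<longleftrightarrow>
    (\<forall>w\<ge>1. excess (component base_matching v w) =
      size {#k \<in># M. 2 * k - 1 \<in> component base_matching v w#}) \<and>
    (\<forall>C\<in>nontrivial_components base_matching v. Max C div 2 \<in># M)"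

lemma size_filter_disjoint:
  assumes "\<And>k. k \<in># M \<Longrightarrow> \<not> (P k \<and> Q k)"
  shows "size {#k \<in># M. P k \<or> Q k#} = size {#k \<in># M. P k#} + size {#k \<in># M. Q k#}"
  using assms by (induction M) auto

lemma nontrivial_component_iff:
  assumes "y \<in> matchings n" "1 \<le> w"
  shows "component base_matching y w \<notin> nontrivial_components base_matching y \<longleftrightarrow>
    component base_matching y w = {w, base_matching w}"
proof
  assume "component base_matching y w \<notin> nontrivial_components base_matching y"
  hence "y w = base_matching w" using nontrivial_componentsI[OF base_matching_in assms(1)] by metis
  thus "component base_matching y w = {w, base_matching w}"
    using component_trivial matchings_involution base_matching_in assms(1) by metis
next
  assume eq: "component base_matching y w = {w, base_matching w}"
  have "card {w, base_matching w} \<le> 2" by (simp add: card_insert_if)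
  thus "component base_matching y w \<notin> nontrivial_components base_matching y"
    by (simp add: eq nontrivial_components_def)
qed

text \<open>The new factor \<open>k\<close> pays for the merging of the two components. The union has its largest pair in one
  of them; if this one was trivial, then it is the pair \<open>k\<close>, since \<open>b\<close> and its partner are smaller.\<close>

lemma fits_merge:
  assumes y: "y \<in> matchings n" and k: "1 \<le> k" and b: "b \<in> {1..2 * k - 2}"
    and nb: "2 * k - 1 \<notin> component base_matching y b" and fits: "fits M y"
  shows "fits (add_mset k M) (switch b (2 * k - 1) y)"
  unfolding fits_def
proof (intro conjI allI impI ballI)
  let ?t = base_matching and ?p = "2 * k - 1"
  let ?B = "component ?t y b" and ?P = "component ?t y ?p"
  let ?y = "switch b ?p y"
  note t = base_matching_in[of n]
  have it: "involution ?t" and iy: "involution y" using base_matching_in y matchings_involution by blast+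
  note iy' = switch_involution[OF iy, of b ?p]
  have b1: "1 \<le> b" and p1: "1 \<le> ?p" using b k by auto
  have ex: "excess (component ?t y w) = size {#k \<in># M. 2 * k - 1 \<in> component ?t y w#}" if "1 \<le> w" for w
    using fits that by (simp add: fits_def)
  have pP: "?p \<in> ?P" by (rule component_refl)
  have U: "component ?t ?y b = ?B \<union> ?P" by (rule component_merge[OF t y b1 p1 nb])
  have dis: "?B \<inter> ?P = {}" using component_disjoint[OF it iy nb] by blast
  {
    fix w :: nat assume w: "1 \<le> w"
    show "excess (component ?t ?y w) = size {#j \<in># add_mset k M. 2 * j - 1 \<in> component ?t ?y w#}"
    proof (cases "w \<in> ?B \<union> ?P")
      case True
      hence eq: "component ?t ?y w = ?B \<union> ?P" using component_eq[OF it iy', of w b] U by simp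
      have "size {#j \<in># M. 2 * j - 1 \<in> ?B \<or> 2 * j - 1 \<in> ?P#} = excess ?B + excess ?P"
        unfolding ex[OF b1] ex[OF p1] using dis by (intro size_filter_disjoint) blast
      thus ?thesis unfolding eq using pP excess_merge[OF t y b1 p1 nb] by simp
    next
      case False
      hence eq: "component ?t ?y w = component ?t y w"
        using component_switch_other[OF it iy] by blast
      moreover have "?p \<notin> component ?t y w" using False component_sym[OF it iy, of ?p w] by blast
      ultimately show ?thesis using ex[OF w] by simp
    qed
  next
    fix C assume C: "C \<in> nontrivial_components ?t ?y"
    have fitsM: "Max D div 2 \<in># M" if "D \<in> nontrivial_components ?t y" for D
      using fits that by (simp add: fits_def)
    show "Max C div 2 \<in># add_mset k M"
    proof (cases "C = ?B \<union> ?P")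
      case True
      have fin: "finite ?B" "finite ?P" using finite_component[OF t y] by blast+
      have ne: "?B \<noteq> {}" "?P \<noteq> {}"
        using component_refl[of b ?t y] component_refl[of ?p ?t y] by auto
      have Max: "Max C = max (Max ?B) (Max ?P)" unfolding True using fin ne by (simp add: Max_Un)
      have P: "Max ?P div 2 \<in># add_mset k M"
      proof (cases "?P \<in> nontrivial_components ?t y")
        case False
        hence "?P = {?p, ?t ?p}" using nontrivial_component_iff[OF y p1] by simp
        hence "Max ?P = 2 * k" using base_matching_odd_even(1)[OF k] by simp
        thus ?thesis by simp
      qed (use fitsM in simp)
      have "Max ?B div 2 \<in># add_mset k M" if "Max ?P < Max ?B"
      proof (cases "?B \<in> nontrivial_components ?t y")
        case False
        hence "?B = {b, ?t b}" using nontrivial_component_iff[OF y b1] by simp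
        moreover have "?t b \<in> {1..2 * (k - 1)}" using b base_matching_range[of b "k - 1"] by (auto simp: algebra_simps)
        ultimately have "Max ?B \<le> 2 * (k - 1)" using b by auto
        moreover have "?p \<le> Max ?P" using fin pP by simp
        ultimately show ?thesis using that k by linarith
      qed (use fitsM in simp)
      thus ?thesis using P unfolding Max by (auto simp: max_def not_le)
    next
      case False
      hence "C \<in> nontrivial_components ?t y"
        using C nontrivial_components_merge[OF t y b1 p1 nb] by blast
      thus ?thesis using fitsM by simp
    qed
  }
qed

lemma fits_empty: "fits {#} base_matching"
proof -
  have i: "involution base_matching" using base_matching_in matchings_involution by blast
  have "nontrivial_components base_matching base_matching = {}"
    using pair_type_self[OF i] finite_nontrivial_components[OF base_matching_in base_matching_in]
    by (simp add: pair_type_def mset_set_empty_iff)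
  thus ?thesis using excess_component_trivial[of base_matching base_matching]
    by (auto simp: fits_def)
qed

text \<open>A transposition raises the distance by at most one. If the distance equals the degree, then every
  factor has merged two components.\<close>

lemma jm_monomial_leading:
  assumes "v \<in> matchings n" "jm_monomial M v \<noteq> 0"
  shows "distance base_matching v \<le> size M \<and> (distance base_matching v = size M \<longrightarrow> fits M v)"
  using assms
proof (induction M arbitrary: v n)
  case empty
  hence "v = base_matching" by (simp add: jm_monomial_empty split: if_splits)
  thus ?case using fits_empty distance_eq_0_iff[OF base_matching_in base_matching_in] by simp
next
  case (add k M)
  let ?t = base_matching and ?p = "2 * k - 1"
  obtain b where k: "1 \<le> k" and b: "b \<in> {1..2 * k - 2}" and nz: "jm_monomial M (switch b ?p v) \<noteq> 0"
    using jm_monomial_nonzeroE[OF add.prems(2)] .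
  let ?y = "switch b ?p v"
  have "v \<in> matchings (n + k)" using add.prems(1) matchings_mono[of n "n + k"] by auto
  hence y: "?y \<in> matchings (n + k)" using b by (intro switch_matchings) auto
  have v: "v = switch b ?p ?y" by simp
  note IH = add.IH[OF y nz]
  have pos: "1 \<le> b" "1 \<le> ?p" using b k by auto
  show ?case
  proof (rule distance_switch_cases[OF base_matching_in y pos])
    assume merge: "?p \<notin> component ?t ?y b" "distance ?t (switch b ?p ?y) = distance ?t ?y + 1"
    moreover have "fits (add_mset k M) v" if "fits M ?y"
      using fits_merge[OF y k b merge(1) that] by simp
    ultimately show ?thesis using IH by simp
  next
    assume "distance ?t (switch b ?p ?y) = distance ?t ?y"
    thus ?thesis using IH by simp
  next
    assume "distance ?t ?y = distance ?t (switch b ?p ?y) + 1"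
    thus ?thesis using IH by simp
  qed
qed

text \<open>The only monomial that fits \<open>v\<close> and has no more distinct factors than there are nontrivial components: each
  component is a star around its largest pair.\<close>

definition leading_monomial :: "(nat \<Rightarrow> nat) \<Rightarrow> nat multiset" where
  "leading_monomial v =
    (\<Sum>C\<in>nontrivial_components base_matching v. replicate_mset (excess C) (Max C div 2))"

text \<open>The partition formed by the exponents of a monomial.\<close>

definition shape :: "nat multiset \<Rightarrow> nat multiset" where
  "shape M = image_mset (count M) (mset_set (set_mset M))"

lemma Max_component:
  assumes y: "y \<in> matchings n" and w: "1 \<le> w"
  defines "C \<equiv> component base_matching y w"
  shows "Max C \<in> C" "1 \<le> Max C div 2" "2 * (Max C div 2) = Max C" "2 * (Max C div 2) - 1 \<in> C"
proof -
  have fin: "finite C" unfolding C_def by (rule finite_component[OF base_matching_in y])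
  have "w \<in> C" unfolding C_def by (rule component_refl)
  show M: "Max C \<in> C" using fin \<open>w \<in> C\<close> by (intro Max_in) auto
  have pos: "1 \<le> Max C" using Max_ge[OF fin \<open>w \<in> C\<close>] w by simp
  have tC: "base_matching (Max C) \<in> C" using M component_closed(1) unfolding C_def by metis
  have ev: "even (Max C)"
  proof (rule ccontr)
    assume "odd (Max C)"
    hence "base_matching (Max C) = Max C + 1" using pos by (simp add: base_matching_def)
    thus False using Max_ge[OF fin tC] by simp
  qed
  thus "2 * (Max C div 2) = Max C" by simp
  show "1 \<le> Max C div 2" using ev pos by presburger
  have "base_matching (Max C) = 2 * (Max C div 2) - 1" using ev pos by (simp add: base_matching_def)
  thus "2 * (Max C div 2) - 1 \<in> C" using tC by simp
qed

lemma nontrivial_componentsE: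
  assumes "y \<in> matchings n" "C \<in> nontrivial_components base_matching y"
  obtains w where "w \<in> {1..2 * n}" "C = component base_matching y w"
proof -
  obtain w where w: "C = component base_matching y w"
    using assms(2) by (auto simp: nontrivial_components_def)
  hence "w \<in> {1..2 * n}"
    using nontrivial_components_subset[OF base_matching_in assms] component_refl[of w] by blast
  thus thesis using that w by blast
qed

lemma Max_nontrivial_component:
  assumes y: "y \<in> matchings n" and C: "C \<in> nontrivial_components base_matching y"
  shows "Max C \<in> C" "1 \<le> Max C div 2" "2 * (Max C div 2) = Max C" "2 * (Max C div 2) - 1 \<in> C"
proof -
  obtain w where w: "w \<in> {1..2 * n}" "C = component base_matching y w"
    using nontrivial_componentsE[OF y C] .
  hence "1 \<le> w" by simp
  thus "Max C \<in> C" "1 \<le> Max C div 2" "2 * (Max C div 2) = Max C" "2 * (Max C div 2) - 1 \<in> C"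
    using Max_component[OF y, of w] w(2) by simp_all
qed

lemma inj_on_Max_div:
  assumes y: "y \<in> matchings n"
  shows "inj_on (\<lambda>C. Max C div 2) (nontrivial_components base_matching y)"
proof (rule inj_onI)
  fix C D assume C: "C \<in> nontrivial_components base_matching y"
    and D: "D \<in> nontrivial_components base_matching y" and eq: "Max C div 2 = Max D div 2"
  have "Max C = Max D"
    using Max_nontrivial_component(3)[OF y C] Max_nontrivial_component(3)[OF y D] eq by metis
  hence "C \<inter> D \<noteq> {}"
    using Max_nontrivial_component(1)[OF y C] Max_nontrivial_component(1)[OF y D] by auto
  thus "C = D" using nontrivial_components_disjoint matchings_involution base_matching_in y C D by metis
qed

lemma count_leading_monomial:
  assumes y: "y \<in> matchings n" and C: "C \<in> nontrivial_components base_matching y"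
  shows "count (leading_monomial y) (Max C div 2) = excess C"
proof -
  have "count (leading_monomial y) (Max C div 2) =
    (\<Sum>D\<in>nontrivial_components base_matching y. if D = C then excess D else 0)"
    unfolding leading_monomial_def count_sum
    by (intro sum.cong) (auto dest: inj_onD[OF inj_on_Max_div[OF y] _ C])
  thus ?thesis using C finite_nontrivial_components[OF base_matching_in y] by simp
qed

lemma set_leading_monomial:
  assumes y: "y \<in> matchings n"
  shows "set_mset (leading_monomial y) = (\<lambda>C. Max C div 2) ` nontrivial_components base_matching y"
proof -
  have "set_mset (leading_monomial y) =
    (\<Union>C\<in>nontrivial_components base_matching y. set_mset (replicate_mset (excess C) (Max C div 2)))"
    unfolding leading_monomial_def using finite_nontrivial_components[OF base_matching_in y]
    by (simp add: set_mset_sum)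
  thus ?thesis using excess_pos(1)[OF base_matching_in y] by (auto simp: gr0_conv_Suc)
qed

lemma shape_leading_monomial:
  assumes y: "y \<in> matchings n" shows "shape (leading_monomial y) = pair_type base_matching y"
proof -
  let ?N = "nontrivial_components base_matching y"
  have "shape (leading_monomial y)
    = image_mset (count (leading_monomial y)) (image_mset (\<lambda>C. Max C div 2) (mset_set ?N))"
    unfolding shape_def set_leading_monomial[OF y] by (simp add: image_mset_mset_set[OF inj_on_Max_div[OF y]])
  also have "\<dots> = image_mset excess (mset_set ?N)"
    unfolding multiset.map_comp comp_def
    using finite_nontrivial_components[OF base_matching_in y] count_leading_monomial[OF y]
    by (intro image_mset_cong) auto
  finally show ?thesis by (simp add: pair_type_def)
qed

lemma size_leading_monomial:
  "size (leading_monomial v) = distance base_matching v"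
  by (simp add: leading_monomial_def distance_eq_sum size_multiset_sum)

lemma size_shape: "size (shape M) = card (set_mset M)"
  by (simp add: shape_def)

text \<open>Every nontrivial component contains an index of the monomial, namely that of its largest pair; if there are no
  further indices, then all factors belonging to the component coincide.\<close>

lemma fits_eq_leading_monomial:
  assumes y: "y \<in> matchings n" and fits: "fits M y"
    and size: "size (shape M) \<le> size (pair_type base_matching y)"
  shows "M = leading_monomial y"
proof -
  let ?N = "nontrivial_components base_matching y" and ?h = "\<lambda>C::nat set. Max C div 2"
  have sub: "?h ` ?N \<subseteq> set_mset M" using fits by (auto simp: fits_def)
  have "card (set_mset M) \<le> card (?h ` ?N)"
    using size card_image[OF inj_on_Max_div[OF y]] by (simp add: size_shape size_pair_type)
  hence set: "?h ` ?N = set_mset M" using card_seteq[OF _ sub] by simp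
  show ?thesis
  proof (rule multiset_eqI)
    fix j
    show "count M j = count (leading_monomial y) j"
    proof (cases "j \<in> ?h ` ?N")
      case False
      thus ?thesis using set set_leading_monomial[OF y] by (metis count_eq_zero_iff)
    next
      case True
      then obtain C where C: "C \<in> ?N" "j = ?h C" by blast
      obtain w where w: "w \<in> {1..2 * n}" "C = component base_matching y w"
        using nontrivial_componentsE[OF y C(1)] .
      have "k = j" if k: "k \<in># M" "2 * k - 1 \<in> C" for k
      proof -
        obtain D where D: "D \<in> ?N" "k = ?h D" using k(1) set by blast
        hence "2 * k - 1 \<in> D" using Max_nontrivial_component(4)[OF y D(1)] by simp
        hence "C \<inter> D \<noteq> {}" using k(2) by blast
        hence "C = D"
          using nontrivial_components_disjoint matchings_involution base_matching_in y C(1) D(1) by metis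
        thus ?thesis using C D by simp
      qed
      moreover have "2 * j - 1 \<in> C" using Max_nontrivial_component(4)[OF y C(1)] C(2) by simp
      ultimately have "{#k \<in># M. 2 * k - 1 \<in> C#} = {#k \<in># M. k = j#}"
        by (intro filter_mset_cong) auto
      hence "excess C = count M j" using fits w by (simp add: fits_def filter_eq_replicate_mset)
      thus ?thesis using count_leading_monomial[OF y C(1)] C(2) by simp
    qed
  qed
qed

text \<open>Undoing one transposition of the star around the largest pair of \<open>C\<close> removes a single pair from \<open>C\<close>
  and keeps the largest one.\<close>

lemma leading_monomial_reduce:
  assumes y: "y \<in> matchings n" and C: "C \<in> nontrivial_components base_matching y"
  defines "k \<equiv> Max C div 2" and "p \<equiv> 2 * (Max C div 2) - 1"
  defines "b \<equiv> base_matching (y p)"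
  defines "y' \<equiv> switch b p y"
  shows "leading_monomial y = add_mset k (leading_monomial y')"
    and "y' \<in> matchings n" "b \<in> {1..2 * k - 2}"
    and "distance base_matching y = Suc (distance base_matching y')"
    and "\<And>D. D \<in> nontrivial_components base_matching y' \<Longrightarrow> Max D \<in> C \<Longrightarrow> Max D = 2 * k"
proof -
  let ?t = base_matching
  note t = base_matching_in[of n]
  have it: "involution ?t" and iy: "involution y" using base_matching_in y matchings_involution by blast+
  note MC = Max_nontrivial_component[OF y C, folded k_def p_def]
  have pC: "p \<in> C" by (rule MC(4))
  have k1: "1 \<le> k" by (rule MC(2))
  have tp: "?t p = 2 * k" using base_matching_odd_even(1)[OF k1] by (simp add: p_def k_def)
  have Cp: "C = component ?t y p" by (rule nontrivial_components_eq_component[OF it iy C pC])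
  have ne: "?t p \<noteq> y p" using C component_card_gt2_iff[OF t y, of p] Cp by (simp add: nontrivial_components_def)
  have sw: "switch p b y = y'" by (simp add: y'_def switch_commute)
  note r = switch_reduce[OF t y ne, folded b_def, unfolded sw]
  show y': "y' \<in> matchings n" by (rule r(3))
  show "distance ?t y = Suc (distance ?t y')" by (rule r(7))
  have p1: "1 \<le> p" and b1: "1 \<le> b" using r(1,2) by auto
  let ?P = "component ?t y' p" and ?B = "component ?t y' b"
  have sw': "switch p b y' = y" unfolding sw[symmetric] by simp
  have U: "C = ?P \<union> ?B" using component_merge[OF t y' p1 b1 r(5)] sw' Cp by simp
  have kP: "2 * k \<in> ?P" using component_closed(1)[OF component_refl[of p ?t y']] tp by simp
  have pP: "p \<in> ?P" by (rule component_refl)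
  have bC: "b \<in> C" using U component_refl[of b] by blast
  have fC: "finite C" using finite_component[OF t y] Cp by simp
  have "b \<noteq> 2 * k" "b \<noteq> p" using r(5) kP pP by metis+
  moreover have "b \<le> 2 * k" using Max_ge[OF fC bC] MC(3) by simp
  moreover have "p = 2 * k - 1" by (simp add: p_def k_def)
  ultimately show b: "b \<in> {1..2 * k - 2}" using b1 by auto
  have MP: "Max ?P = 2 * k"
  proof (rule Max_eqI)
    show "finite ?P" by (rule finite_component[OF t y'])
    show "j \<le> 2 * k" if "j \<in> ?P" for j using Max_ge[OF fC, of j] that U MC(3) by auto
  qed (rule kP)
  let ?N = "nontrivial_components ?t y'" and ?r = "\<lambda>C::nat set. replicate_mset (excess C) (Max C div 2)"
  have "?t b = y p" by (simp add: b_def base_matching_simps)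
  hence Bt: "?B = {b, ?t b}" using r(4) by simp
  have BN: "?B \<notin> ?N" using nontrivial_component_iff[OF y' b1] Bt by simp
  hence eB: "excess ?B = 0" by (rule excess_component_trivial)
  have PB: "?P \<noteq> ?B" using r(5) component_refl by metis
  have fin: "finite ?N" by (rule finite_nontrivial_components[OF t y'])
  have iy': "involution y'" using y' matchings_involution by blast
  have N: "nontrivial_components ?t y = insert C (?N - {?P, ?B})"
    using nontrivial_components_merge[OF t y' p1 b1 r(5)] sw' U by simp
  \<comment> \<open>Passing to \<open>y'\<close> replaces \<open>C\<close> by \<open>?P\<close> and the single pair \<open>?B\<close>, which contributes nothing.\<close>
  have CN: "C \<notin> ?N - {?P, ?B}"
  proof
    assume "C \<in> ?N - {?P, ?B}"
    thus False using nontrivial_components_eq_component[OF it iy' _ pC] by blast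
  qed
  have "excess C = excess ?P + 1"
    using excess_merge[OF t y' p1 b1 r(5)] U eB by simp
  hence rC: "?r C = add_mset k (?r ?P)" using MP by (simp add: k_def[symmetric])
  have "sum ?r (?N - {?P, ?B}) + ?r ?P = sum ?r (?N \<union> {?P, ?B})"
  proof -
    have "sum ?r (?N \<union> {?P, ?B}) = sum ?r (?N - {?P, ?B}) + sum ?r {?P, ?B}"
      using fin by (subst sum.union_disjoint[symmetric]) (auto intro: arg_cong[of _ _ "sum ?r"])
    thus ?thesis using PB eB by simp
  qed
  also have "sum ?r (?N \<union> {?P, ?B}) = sum ?r ?N"
    using fin excess_component_trivial[of ?t y'] by (intro sum.mono_neutral_right) auto
  finally have eq: "sum ?r (?N - {?P, ?B}) + ?r ?P = leading_monomial y'"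
    by (simp add: leading_monomial_def)
  have "leading_monomial y = ?r C + sum ?r (?N - {?P, ?B})"
    unfolding leading_monomial_def N using fin CN by simp
  also have "\<dots> = add_mset k (leading_monomial y')" unfolding rC eq[symmetric] by simp
  finally show "leading_monomial y = add_mset k (leading_monomial y')" .
  fix D assume D: "D \<in> ?N" "Max D \<in> C"
  have MD: "Max D \<in> D" by (rule Max_nontrivial_component(1)[OF y' D(1)])
  have DD: "D = component ?t y' (Max D)" by (rule nontrivial_components_eq_component[OF it iy' D(1) MD])
  have "Max D \<notin> ?B"
  proof
    assume "Max D \<in> ?B"
    hence "D = ?B" using DD component_eq[OF it iy'] by metis
    thus False using BN D(1) by simp
  qed
  hence "Max D \<in> ?P" using D(2) U by blast
  hence "D = ?P" using DD component_eq[OF it iy'] by metis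
  thus "Max D = 2 * k" using MP by simp
qed

text \<open>The monomial reaches its matching in exactly one way. The last factor has to split the component,
  and any splitting other than that of \<open>leading_monomial_reduce\<close> leaves a nontrivial component whose
  largest pair is not an index of the remaining monomial.\<close>

lemma jm_leading_monomial:
  assumes "v \<in> matchings n" shows "jm_monomial (leading_monomial v) v = 1"
  using assms
proof (induction "distance base_matching v" arbitrary: v)
  case 0
  hence v: "v = base_matching" using distance_eq_0_iff[OF base_matching_in 0(2)] by simp
  have "size (leading_monomial v) = 0" unfolding size_leading_monomial using 0 by simp
  thus ?case using v by (simp add: jm_monomial_empty)
next
  case (Suc d)
  let ?t = base_matching
  note t = base_matching_in[of n]
  have it: "involution ?t" and iv: "involution v" using base_matching_in Suc.prems matchings_involution by blast+
  have "nontrivial_components ?t v \<noteq> {}" using Suc.hyps(2) by (auto simp: distance_eq_sum)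
  then obtain C where C: "C \<in> nontrivial_components ?t v" by blast
  let ?k = "Max C div 2" and ?p = "2 * (Max C div 2) - 1"
  let ?b = "?t (v ?p)"
  let ?v = "switch ?b ?p v"
  note r = leading_monomial_reduce[OF Suc.prems C]
  note MC = Max_nontrivial_component[OF Suc.prems C]
  have IH: "jm_monomial (leading_monomial ?v) ?v = 1"
    using Suc.hyps(1)[OF _ r(2)] Suc.hyps(2) r(4) by simp
  have tp: "?t ?p = 2 * ?k" using base_matching_odd_even(1)[OF MC(2)] by simp
  have C_p: "C = component ?t v ?p" by (rule nontrivial_components_eq_component[OF it iv C MC(4)])
  have "jm_monomial (leading_monomial ?v) (switch b ?p v) = 0"
    if b: "b \<in> {1..2 * ?k - 2} - {?b}" for b
  proof (rule ccontr)
    assume nz: "jm_monomial (leading_monomial ?v) (switch b ?p v) \<noteq> 0"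
    let ?u = "switch b ?p v"
    have pos: "1 \<le> b" "1 \<le> ?p" using b MC(2) by auto
    have "?p \<in> {1..2 * n}" "b \<in> {1..2 * n}"
    proof -
      have "2 * ?k \<in> {1..2 * n}"
        using MC(1,3) nontrivial_components_subset[OF t Suc.prems C] by auto
      hence "?k \<le> n" by simp
      moreover have "2 * j - 1 \<le> 2 * n \<and> 2 * j - 2 \<le> 2 * n" if "j \<le> n" for j using that by linarith
      ultimately have "?p \<le> 2 * n" "2 * ?k - 2 \<le> 2 * n" by blast+
      thus "?p \<in> {1..2 * n}" "b \<in> {1..2 * n}" using b pos by auto
    qed
    hence u: "?u \<in> matchings n" using Suc.prems by (intro switch_matchings) auto
    have lead: "distance ?t ?u \<le> distance ?t ?v"
      "distance ?t ?u = distance ?t ?v \<Longrightarrow> fits (leading_monomial ?v) ?u"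
      using jm_monomial_leading[OF u nz] by (simp_all add: size_leading_monomial)
    have split: "?p \<in> component ?t v b" "?p \<notin> component ?t ?u b" "distance ?t v = distance ?t ?u + 1"
      using lead(1) r(4) by (cases rule: distance_switch_cases[OF t Suc.prems pos]; simp)+
    have fits: "fits (leading_monomial ?v) ?u" using lead(2) split(3) r(4) by simp
    \<comment> \<open>Degrees force \<open>?u\<close> to split \<open>C\<close>; then \<open>?D\<close> is the part of \<open>C\<close> that does not contain its largest pair.\<close>
    let ?D = "component ?t ?u b"
    have "component ?t (switch b ?p ?u) b = ?D \<union> component ?t ?u ?p"
      by (rule component_merge[OF t u pos split(2)])
    moreover have "component ?t v b = C" using component_eq[OF it iv split(1)] C_p by simp
    ultimately have DC: "?D \<subseteq> C" by auto
    have "?D \<notin> nontrivial_components ?t ?u"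
    proof
      assume D: "?D \<in> nontrivial_components ?t ?u"
      note MD = Max_nontrivial_component[OF u D]
      have "Max ?D div 2 \<in># leading_monomial ?v" using fits D by (simp add: fits_def)
      then obtain E where E: "E \<in> nontrivial_components ?t ?v" "Max ?D div 2 = Max E div 2"
        using set_leading_monomial[OF r(2)] by auto
      hence "Max ?D = Max E" using MD(3) Max_nontrivial_component(3)[OF r(2) E(1)] by metis
      moreover from this have "Max E \<in> C" using MD(1) DC by auto
      ultimately have "Max ?D = 2 * ?k" using r(5)[OF E(1)] by simp
      hence "?p \<in> ?D" using MD(4) by simp
      thus False using split(2) by simp
    qed
    hence D: "?D = {b, ?t b}" using nontrivial_component_iff[OF u pos(1)] by simp
    have "?u b \<in> ?D" by (rule component_closed(2)[OF component_refl])
    hence ub: "?u b = ?t b" using D matchings_no_fixpoint[OF u pos(1)] by auto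
    have vp: "v ?p \<noteq> ?p" using matchings_no_fixpoint[OF Suc.prems pos(2)] .
    have ub': "?u b = transpose b ?p (v ?p)" by (simp add: switch_def)
    show False
    proof (cases "v ?p = b")
      case True
      hence "?t b = ?p" using ub ub' by simp
      hence "b = 2 * ?k" using tp by (metis base_matching_simps(1))
      thus False using b MC(2) by auto
    next
      case False
      hence "v ?p = ?t b" using ub ub' vp by simp
      hence "b = ?b" by (simp add: base_matching_simps)
      thus False using b by simp
    qed
  qed
  hence "jm ?k (jm_monomial (leading_monomial ?v)) v = (\<Sum>b\<in>{?b}. jm_monomial (leading_monomial ?v) (switch b ?p v))"
    unfolding jm_def using r(3) by (intro sum.mono_neutral_right) auto
  thus ?case using IH unfolding r(1) jm_monomial_add by simp
qed

section \<open>Monomial and elementary symmetric functions\<close>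

definition shape_list :: "nat multiset \<Rightarrow> nat list" where
  "shape_list M = list_of (shape M)"

lemma zero_notin_shape: "0 \<notin># shape M"
  by (auto simp: shape_def) (metis not_in_iff)

lemma sum_shape: "sum_mset (shape M) = size M"
  by (simp add: shape_def size_multiset_overloaded_eq sum_unfold_sum_mset)

lemma is_partition_shape_list: "is_partition (shape_list M)"
  by (simp add: shape_list_def is_partition_list_of zero_notin_shape)

lemma sum_list_shape_list: "sum_list (shape_list M) = size M"
  by (simp add: shape_list_def sum_shape)

text \<open>The monomial symmetric function of \<open>\<nu>\<close> in the first \<open>n\<close> Jucys--Murphy operators, applied to the base
  matching.\<close>

definition msum :: "nat \<Rightarrow> nat list \<Rightarrow> (nat \<Rightarrow> nat) \<Rightarrow> rat" where
  "msum n \<nu> v = (\<Sum>M | set_mset M \<subseteq> {1..n} \<and> shape_list M = \<nu>. jm_monomial M v)"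

lemma finite_shape_list: "finite {M. set_mset M \<subseteq> {1..n} \<and> shape_list M = \<nu>}"
proof (rule finite_subset)
  show "{M. set_mset M \<subseteq> {1..n} \<and> shape_list M = \<nu>} \<subseteq> multisets_of_size {1..n} (sum_list \<nu>)"
    using sum_list_shape_list by (auto simp: multisets_of_size_def)
qed (rule finite_multisets_of_size, simp)

text \<open>A monomial of top degree fits its matching. So there are at most as many nontrivial components as
  distinct factors, and if the numbers agree, then the exponents are the excesses of the components.\<close>

lemma msum_triangular:
  assumes v: "v \<in> matchings n" and nz: "msum n \<nu> v \<noteq> 0"
  defines "\<kappa> \<equiv> stable_type base_matching v"
  shows "sum_list \<kappa> < sum_list \<nu> \<or> sum_list \<kappa> = sum_list \<nu> \<and> (length \<kappa> < length \<nu> \<or> \<kappa> = \<nu>)"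
proof -
  obtain M where M: "shape_list M = \<nu>" "jm_monomial M v \<noteq> 0"
    using nz unfolding msum_def by (metis (mono_tags, lifting) mem_Collect_eq sum.neutral)
  have size: "size M = sum_list \<nu>" using M(1) sum_list_shape_list by metis
  have len: "size (shape M) = length \<nu>" using M(1) by (auto simp: shape_list_def)
  note lead = jm_monomial_leading[OF v M(2)]
  have dist: "sum_list \<kappa> = distance base_matching v" by (simp add: \<kappa>_def sum_list_stable_type)
  have lenk: "length \<kappa> = size (pair_type base_matching v)" by (simp add: \<kappa>_def stable_type_def)
  have "length \<kappa> < length \<nu> \<or> \<kappa> = \<nu>" if eq: "sum_list \<kappa> = sum_list \<nu>"
  proof -
    have fits: "fits M v" using lead eq size dist by simp
    show ?thesis
    proof (cases "length \<kappa> < length \<nu>")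
      case False
      hence "M = leading_monomial v"
        using fits_eq_leading_monomial[OF v fits] len lenk by simp
      hence "\<nu> = \<kappa>" using M(1) shape_leading_monomial[OF v] by (simp add: shape_list_def \<kappa>_def stable_type_def)
      thus ?thesis by simp
    qed simp
  qed
  thus ?thesis using lead size dist by linarith
qed

text \<open>Among the monomials of the right shape only the leading one contributes.\<close>

lemma msum_diagonal:
  assumes v: "v \<in> matchings n" shows "msum n (stable_type base_matching v) v = 1"
proof -
  let ?\<kappa> = "stable_type base_matching v" and ?L = "leading_monomial v"
  have set: "set_mset ?L \<subseteq> {1..n}"
  proof
    fix j assume "j \<in># ?L"
    then obtain C where C: "C \<in> nontrivial_components base_matching v" "j = Max C div 2"
      using set_leading_monomial[OF v] by auto
    have "Max C \<in> {1..2 * n}"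
      using nontrivial_components_subset[OF base_matching_in v C(1)] Max_nontrivial_component(1)[OF v C(1)] by blast
    thus "j \<in> {1..n}" using C(2) Max_nontrivial_component(2)[OF v C(1)] by auto
  qed
  have shape: "shape_list ?L = ?\<kappa>"
    using shape_leading_monomial[OF v] by (simp add: shape_list_def stable_type_def)
  have "jm_monomial M v = 0" if M: "shape_list M = ?\<kappa>" "M \<noteq> ?L" for M
  proof (rule ccontr)
    assume nz: "jm_monomial M v \<noteq> 0"
    have "size M = distance base_matching v"
      using M(1) sum_list_shape_list[of M] sum_list_stable_type[of base_matching v] by simp
    hence fits: "fits M v" using jm_monomial_leading[OF v nz] by simp
    have "shape M = pair_type base_matching v"
      using M(1) by (simp add: shape_list_def stable_type_def list_of_inject)
    hence "M = ?L" using fits_eq_leading_monomial[OF v fits] by simp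
    thus False using M(2) by simp
  qed
  hence "msum n ?\<kappa> v = (\<Sum>M\<in>{?L}. jm_monomial M v)"
    unfolding msum_def using set shape finite_shape_list
    by (intro sum.mono_neutral_right) auto
  thus ?thesis using jm_leading_monomial[OF v] by simp
qed

subsection \<open>Expanding products of elementary symmetric functions\<close>

text \<open>The factorizations of a monomial into squarefree monomials of prescribed degrees. Their number is a
  coefficient of a product of elementary symmetric functions.\<close>

definition factorizations :: "nat list \<Rightarrow> nat multiset \<Rightarrow> nat set list set" where
  "factorizations l M = {Ss. list_all2 (\<lambda>S i. finite S \<and> card S = i) Ss l \<and> total Ss = M}"

lemma total_Cons: "total (S # Ss) = mset_set S + total Ss"
  by (simp add: total_def)

lemma total_Nil: "total [] = {#}"
  by (simp add: total_def)

lemma subset_total: "S \<in> set Ss \<Longrightarrow> finite S \<Longrightarrow> S \<subseteq> set_mset (total Ss)"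
  by (induction Ss) (auto simp: total_Cons)

lemma size_total:
  "list_all2 (\<lambda>S i. finite S \<and> card S = i) Ss l \<Longrightarrow> size (total Ss) = sum_list l"
  by (induction rule: list_all2_induct) (auto simp: total_Cons total_Nil)

lemma factorizations_finite_mem:
  assumes "Ss \<in> factorizations l M" "S \<in> set Ss" shows "finite S" "S \<subseteq> set_mset M"
proof -
  have "list_all2 (\<lambda>S i. finite S \<and> card S = i) Ss l" using assms(1) by (simp add: factorizations_def)
  thus "finite S" using assms(2) by (induction rule: list_all2_induct) auto
  thus "S \<subseteq> set_mset M" using subset_total[OF assms(2)] assms(1) by (simp add: factorizations_def)
qed

lemma factorizations_set_lists:
  assumes "set_mset M \<subseteq> {1..n}"
  shows "{Ss \<in> set_lists n l. total Ss = M} = factorizations l M"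
proof (intro equalityI subsetI)
  fix Ss assume "Ss \<in> {Ss \<in> set_lists n l. total Ss = M}"
  thus "Ss \<in> factorizations l M"
    by (auto simp: set_lists_def factorizations_def elim!: list_all2_mono intro: finite_subset)
next
  fix Ss assume Ss: "Ss \<in> factorizations l M"
  hence "S \<subseteq> {1..n}" if "S \<in> set Ss" for S using factorizations_finite_mem(2)[OF Ss that] assms by blast
  thus "Ss \<in> {Ss \<in> set_lists n l. total Ss = M}"
    using Ss by (auto simp: set_lists_def factorizations_def list_all2_conv_all_nth)
qed

lemma finite_factorizations: "finite (factorizations l M)"
proof (rule finite_subset)
  show "factorizations l M \<subseteq> {Ss. set Ss \<subseteq> Pow (set_mset M) \<and> length Ss = length l}"
    using factorizations_finite_mem(2) by (auto simp: factorizations_def list_all2_lengthD)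
qed (rule finite_lists_length_eq, simp)

text \<open>Monomials of the same shape differ by a renaming of the indices, along which factorizations can be
  transported.\<close>

lemma card_factorizations_le:
  assumes "shape M = shape M'"
  shows "card (factorizations l M) \<le> card (factorizations l M')"
proof -
  obtain \<beta> where \<beta>: "bij_betw \<beta> (set_mset M) (set_mset M')" and c: "\<forall>a\<in>set_mset M. count M' (\<beta> a) = count M a"
    using bij_of_image_mset_eq[of "set_mset M" "set_mset M'" "count M" "count M'"] assms
    by (auto simp: shape_def)
  have inj: "inj_on \<beta> (set_mset M)" and im: "\<beta> ` set_mset M = set_mset M'"
    using \<beta> by (auto simp: bij_betw_def)
  have M': "image_mset \<beta> M = M'"
  proof (rule multiset_eqI)
    fix j
    show "count (image_mset \<beta> M) j = count M' j"
    proof (cases "j \<in># M'")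
      case True
      then obtain a where a: "a \<in># M" "j = \<beta> a" using im by blast
      have "\<beta> -` {j} \<inter> set_mset M = {a}" using a inj by (auto dest: inj_onD)
      thus ?thesis using a c by (simp add: count_image_mset)
    next
      case False
      hence "j \<notin># image_mset \<beta> M" using im by auto
      thus ?thesis using False by (metis count_eq_zero_iff)
    qed
  qed
  have tot: "total (map (image \<beta>) Ss) = image_mset \<beta> (total Ss)"
    if "\<And>S. S \<in> set Ss \<Longrightarrow> S \<subseteq> set_mset M" for Ss
    using that
  proof (induction Ss)
    case (Cons S Ss)
    have "inj_on \<beta> S" using Cons.prems inj by (meson inj_on_subset list.set_intros(1))
    thus ?case using Cons by (simp add: total_Cons image_mset_mset_set)
  qed (simp add: total_Nil)
  have "map (image \<beta>) ` factorizations l M \<subseteq> factorizations l M'"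
  proof clarify
    fix Ss assume Ss: "Ss \<in> factorizations l M"
    note sub = factorizations_finite_mem[OF Ss]
    have "card (\<beta> ` S) = card S" if "S \<in> set Ss" for S
      by (rule card_image[OF inj_on_subset[OF inj sub(2)[OF that]]])
    hence "list_all2 (\<lambda>S i. finite S \<and> card S = i) (map (image \<beta>) Ss) l"
      using Ss by (auto simp: factorizations_def list_all2_conv_all_nth)
    moreover have "total (map (image \<beta>) Ss) = M'"
      using tot[of Ss] sub(2) Ss M' by (simp add: factorizations_def)
    ultimately show "map (image \<beta>) Ss \<in> factorizations l M'" by (simp add: factorizations_def)
  qed
  moreover have "inj_on (map (image \<beta>)) (factorizations l M)"
  proof (rule inj_on_mapI)
    have "\<Union> (set ` factorizations l M) \<subseteq> Pow (set_mset M)" using factorizations_finite_mem(2) by blast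
    thus "inj_on (image \<beta>) (\<Union> (set ` factorizations l M))"
      using inj_on_subset[OF inj_on_image_Pow[OF inj]] by blast
  qed
  ultimately show ?thesis
    using card_inj_on_le[OF _ _ finite_factorizations, of "map (image \<beta>)"] by blast
qed

text \<open>The coefficient of the monomial symmetric function of \<open>\<nu>\<close> in a product of elementary ones; by symmetry
  all monomials of shape \<open>\<nu>\<close> give the same number (\<open>expansion_coeff_eq\<close>).\<close>

definition expansion_coeff :: "nat list \<Rightarrow> nat list \<Rightarrow> nat" where
  "expansion_coeff l \<nu> = card (factorizations l (SOME M. shape_list M = \<nu>))"

lemma expansion_coeff_eq: "expansion_coeff l (shape_list M) = card (factorizations l M)"
proof -
  have "shape_list (SOME M'. shape_list M' = shape_list M) = shape_list M"
    by (rule someI[of _ M]) simp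
  hence "shape (SOME M'. shape_list M' = shape_list M) = shape M"
    by (simp add: shape_list_def list_of_inject)
  thus ?thesis unfolding expansion_coeff_def
    by (intro antisym card_factorizations_le) simp_all
qed

definition partitions_of :: "nat \<Rightarrow> nat list set" where
  "partitions_of k = {\<nu>. is_partition \<nu> \<and> sum_list \<nu> = k}"

lemma finite_partitions_of: "finite (partitions_of k)"
  by (rule finite_subset[OF _ finite_partitions[of k]]) (auto simp: partitions_of_def)

lemma specialization_T_product_msum:
  assumes v: "v \<in> matchings n"
  shows "specialization n (T_product l) base_matching v
    = (\<Sum>\<nu>\<in>partitions_of (sum_list l). of_nat (expansion_coeff l \<nu>) * msum n \<nu> v)"
proof -
  let ?Ms = "multisets_of_size {1..n} (sum_list l)"
  have fin: "finite ?Ms" by (rule finite_multisets_of_size) simp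
  have tot: "total Ss \<in> ?Ms" if "Ss \<in> set_lists n l" for Ss
  proof -
    have "list_all2 (\<lambda>S i. finite S \<and> card S = i) Ss l"
      using that by (auto simp: set_lists_def elim!: list_all2_mono intro: finite_subset)
    thus ?thesis using total_subset[OF that] size_total by (simp add: multisets_of_size_def)
  qed
  have "specialization n (T_product l) base_matching v = (\<Sum>Ss\<in>set_lists n l. jm_monomial (total Ss) v)"
    by (rule specialization_T_product[OF v])
  also have "\<dots> = (\<Sum>M\<in>?Ms. \<Sum>Ss | Ss \<in> set_lists n l \<and> total Ss = M. jm_monomial (total Ss) v)"
    using fin finite_set_lists tot by (intro sum.group[symmetric]) auto
  also have "\<dots> = (\<Sum>M\<in>?Ms. of_nat (expansion_coeff l (shape_list M)) * jm_monomial M v)"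
  proof (rule sum.cong[OF refl])
    fix M assume "M \<in> ?Ms"
    hence "{Ss. Ss \<in> set_lists n l \<and> total Ss = M} = factorizations l M"
      using factorizations_set_lists[of M n l] by (simp add: multisets_of_size_def)
    moreover have "(\<Sum>Ss | Ss \<in> set_lists n l \<and> total Ss = M. jm_monomial (total Ss) v)
      = (\<Sum>Ss | Ss \<in> set_lists n l \<and> total Ss = M. jm_monomial M v)" by (intro sum.cong) auto
    ultimately show "(\<Sum>Ss | Ss \<in> set_lists n l \<and> total Ss = M. jm_monomial (total Ss) v)
      = of_nat (expansion_coeff l (shape_list M)) * jm_monomial M v"
      by (simp add: expansion_coeff_eq)
  qed
  also have "\<dots> = (\<Sum>\<nu>\<in>partitions_of (sum_list l). \<Sum>M | M \<in> ?Ms \<and> shape_list M = \<nu>.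
      of_nat (expansion_coeff l (shape_list M)) * jm_monomial M v)"
    using fin finite_partitions_of is_partition_shape_list sum_list_shape_list
    by (intro sum.group[symmetric]) (auto simp: partitions_of_def multisets_of_size_def)
  also have "\<dots> = (\<Sum>\<nu>\<in>partitions_of (sum_list l). of_nat (expansion_coeff l \<nu>) * msum n \<nu> v)"
  proof (rule sum.cong[OF refl])
    fix \<nu> assume "\<nu> \<in> partitions_of (sum_list l)"
    hence "{M. M \<in> ?Ms \<and> shape_list M = \<nu>} = {M. set_mset M \<subseteq> {1..n} \<and> shape_list M = \<nu>}"
      using sum_list_shape_list by (auto simp: partitions_of_def multisets_of_size_def)
    thus "(\<Sum>M | M \<in> ?Ms \<and> shape_list M = \<nu>. of_nat (expansion_coeff l (shape_list M)) * jm_monomial M v)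
      = of_nat (expansion_coeff l \<nu>) * msum n \<nu> v"
      unfolding msum_def sum_distrib_left by (intro sum.cong) auto
  qed
  finally show ?thesis .
qed

subsection \<open>Conjugation and triangularity\<close>

text \<open>A numerical substitute for the dominance order, in which it is strictly increasing.\<close>

definition energy :: "nat list \<Rightarrow> nat" where
  "energy \<nu> = (\<Sum>c\<leftarrow>\<nu>. c ^ 2)"

text \<open>The initial segments of sizes \<open>l\<close> are the rows of the diagram of \<open>l\<close>, so that their total counts its
  columns.\<close>

definition conjugate :: "nat list \<Rightarrow> nat list" where
  "conjugate l = shape_list (total (map (\<lambda>i. {1..i}) l))"

lemma energy_shape_list: "energy (shape_list M) = (\<Sum>k\<in>set_mset M. (count M k)\<^sup>2)"
proof -
  have "energy (shape_list M) = sum_mset (image_mset (\<lambda>c. c\<^sup>2) (mset (shape_list M)))"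
    unfolding energy_def sum_mset_sum_list[symmetric] mset_map ..
  also have "\<dots> = (\<Sum>k\<in>set_mset M. (count M k)\<^sup>2)"
    by (simp add: shape_list_def shape_def sum_unfold_sum_mset multiset.map_comp comp_def)
  finally show ?thesis .
qed

lemma count_total:
  assumes "\<And>S. S \<in> set Ss \<Longrightarrow> finite S"
  shows "count (total Ss) k = card {p. p < length Ss \<and> k \<in> Ss ! p}"
  using assms
proof (induction Ss)
  case (Cons S Ss)
  have "{p. p < length (S # Ss) \<and> k \<in> (S # Ss) ! p} =
    (if k \<in> S then {0} else {}) \<union> Suc ` {p. p < length Ss \<and> k \<in> Ss ! p}" (is "?A = ?B \<union> Suc ` ?C")
  proof (intro equalityI subsetI)
    fix p assume "p \<in> ?A" thus "p \<in> ?B \<union> Suc ` ?C" by (cases p) auto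
  qed (auto split: if_splits)
  moreover have "card (?B \<union> Suc ` ?C) = card ?B + card (Suc ` ?C)" by (intro card_Un_disjoint) auto
  moreover have "card (Suc ` ?C) = card ?C" by (intro card_image) auto
  ultimately have "card ?A = (if k \<in> S then 1 else 0) + card ?C" by simp
  thus ?case using Cons by (simp add: total_Cons count_mset_set')
qed (simp add: total_Nil)

text \<open>Count the triples of two positions in the list and a common element of the sets there.\<close>

lemma energy_total:
  assumes fin: "\<And>S. S \<in> set Ss \<Longrightarrow> finite S"
  shows "energy (shape_list (total Ss)) = (\<Sum>p<length Ss. \<Sum>q<length Ss. card (Ss ! p \<inter> Ss ! q))"
proof -
  let ?M = "total Ss" and ?r = "length Ss"
  let ?i = "\<lambda>p k. if k \<in> Ss ! p then 1 else (0::nat)"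
  have cnt: "count ?M k = (\<Sum>p<?r. ?i p k)" for k
  proof -
    have "(\<Sum>p<?r. ?i p k) = card {p \<in> {..<?r}. k \<in> Ss ! p}" by (simp add: sum.If_cases Int_def)
    thus ?thesis using count_total[of Ss k, OF fin] by simp
  qed
  have "energy (shape_list ?M) = (\<Sum>k\<in>set_mset ?M. \<Sum>p<?r. \<Sum>q<?r. ?i p k * ?i q k)"
    unfolding energy_shape_list cnt power2_eq_square sum_product ..
  also have "\<dots> = (\<Sum>p<?r. \<Sum>k\<in>set_mset ?M. \<Sum>q<?r. ?i p k * ?i q k)" by (rule sum.swap)
  also have "\<dots> = (\<Sum>p<?r. \<Sum>q<?r. \<Sum>k\<in>set_mset ?M. ?i p k * ?i q k)"
    by (rule sum.cong[OF refl], rule sum.swap)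
  also have "\<dots> = (\<Sum>p<?r. \<Sum>q<?r. card (Ss ! p \<inter> Ss ! q))"
  proof (intro sum.cong refl)
    fix p q assume pq: "p \<in> {..<?r}" "q \<in> {..<?r}"
    have "(\<Sum>k\<in>set_mset ?M. ?i p k * ?i q k) = (\<Sum>k\<in>set_mset ?M. if k \<in> Ss ! p \<inter> Ss ! q then 1 else 0)"
      by (intro sum.cong) auto
    also have "\<dots> = card (set_mset ?M \<inter> (Ss ! p \<inter> Ss ! q))"
      by (simp add: sum.If_cases Int_def)
    also have "set_mset ?M \<inter> (Ss ! p \<inter> Ss ! q) = Ss ! p \<inter> Ss ! q"
      using subset_total[of "Ss ! p" Ss] fin[of "Ss ! p"] pq by auto
    finally show "(\<Sum>k\<in>set_mset ?M. ?i p k * ?i q k) = card (Ss ! p \<inter> Ss ! q)" .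
  qed
  finally show ?thesis .
qed

lemma factorizations_nth:
  assumes "Ss \<in> factorizations l M"
  shows "length Ss = length l" "p < length l \<Longrightarrow> finite (Ss ! p) \<and> card (Ss ! p) = l ! p"
  using assms by (auto simp: factorizations_def list_all2_conv_all_nth)

lemma initial_factorization:
  "map (\<lambda>i. {1..i}) l \<in> factorizations l (total (map (\<lambda>i. {1..i}) l))"
  by (simp add: factorizations_def list_all2_conv_all_nth)

lemma energy_conjugate:
  "energy (conjugate l) = (\<Sum>p<length l. \<Sum>q<length l. min (l ! p) (l ! q))"
proof -
  have "card ({1..i} \<inter> {1..j}) = min i j" for i j :: nat by simp
  thus ?thesis unfolding conjugate_def by (subst energy_total) auto
qed

text \<open>The intersection of two sets is at most as large as the smaller one, and initial segments attain all
  of these bounds simultaneously.\<close>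

lemma energy_factorization:
  assumes Ss: "Ss \<in> factorizations l M"
  shows "energy (shape_list M) \<le> energy (conjugate l)"
    and "energy (shape_list M) = energy (conjugate l) \<Longrightarrow> p < length l \<Longrightarrow> q < length l \<Longrightarrow>
      card (Ss ! p \<inter> Ss ! q) = min (l ! p) (l ! q)"
proof -
  let ?r = "length l"
  note nth = factorizations_nth[OF Ss]
  have le: "card (Ss ! p \<inter> Ss ! q) \<le> min (l ! p) (l ! q)" if "p < ?r" "q < ?r" for p q
    using nth(2)[OF that(1)] nth(2)[OF that(2)] card_mono[of "Ss ! p" "Ss ! p \<inter> Ss ! q"]
      card_mono[of "Ss ! q" "Ss ! p \<inter> Ss ! q"] by auto
  have M: "energy (shape_list M) = (\<Sum>p<?r. \<Sum>q<?r. card (Ss ! p \<inter> Ss ! q))"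
    using energy_total[of Ss] factorizations_finite_mem(1)[OF Ss] nth(1) Ss by (simp add: factorizations_def)
  show "energy (shape_list M) \<le> energy (conjugate l)"
    unfolding M energy_conjugate using le by (intro sum_mono) auto
  assume eq: "energy (shape_list M) = energy (conjugate l)" and p: "p < ?r" and q: "q < ?r"
  show "card (Ss ! p \<inter> Ss ! q) = min (l ! p) (l ! q)"
  proof (rule ccontr)
    assume "card (Ss ! p \<inter> Ss ! q) \<noteq> min (l ! p) (l ! q)"
    hence lt: "card (Ss ! p \<inter> Ss ! q) < min (l ! p) (l ! q)"
      using le[OF p q] le_neq_implies_less by blast
    have "(\<Sum>p<?r. \<Sum>q<?r. card (Ss ! p \<inter> Ss ! q)) < (\<Sum>p<?r. \<Sum>q<?r. min (l ! p) (l ! q))"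
    proof (rule sum_strict_mono_ex1)
      show "\<forall>x\<in>{..<?r}. (\<Sum>q<?r. card (Ss ! x \<inter> Ss ! q)) \<le> (\<Sum>q<?r. min (l ! x) (l ! q))"
        using le by (auto intro!: sum_mono)
      have "(\<Sum>q<?r. card (Ss ! p \<inter> Ss ! q)) < (\<Sum>q<?r. min (l ! p) (l ! q))"
        using le p q lt by (intro sum_strict_mono_ex1) auto
      thus "\<exists>a\<in>{..<?r}. (\<Sum>q<?r. card (Ss ! a \<inter> Ss ! q)) < (\<Sum>q<?r. min (l ! a) (l ! q))" using p by auto
    qed simp
    thus False using eq M energy_conjugate[of l] by simp
  qed
qed

text \<open>In the extremal case the sets are nested, and a nested family consists of the level sets of its sum.\<close>

lemma factorization_level_sets:
  assumes Ss: "Ss \<in> factorizations l M" and l: "is_partition l"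
    and eq: "energy (shape_list M) = energy (conjugate l)" and p: "p < length l"
  shows "Ss ! p = {k. p < count M k}"
proof -
  let ?r = "length l"
  note nth = factorizations_nth[OF Ss]
  have nested: "Ss ! j \<subseteq> Ss ! i" if "i \<le> j" "j < ?r" for i j
  proof -
    have "l ! j \<le> l ! i"
      using l that by (cases "i = j") (auto simp: is_partition_def sorted_wrt_iff_nth_less)
    moreover have "i < ?r" using that by simp
    ultimately have "card (Ss ! i \<inter> Ss ! j) = card (Ss ! j)"
      using energy_factorization(2)[OF Ss eq _ that(2), of i] nth(2)[OF that(2)] by simp
    hence "Ss ! i \<inter> Ss ! j = Ss ! j"
      using nth(2)[OF that(2)] by (intro card_subset_eq) auto
    thus ?thesis by blast
  qed
  have cnt: "count M k = card {p. p < ?r \<and> k \<in> Ss ! p}" for k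
    using count_total[of Ss k] factorizations_finite_mem(1)[OF Ss] Ss nth(1) by (simp add: factorizations_def)
  have "k \<in> Ss ! p \<longleftrightarrow> p < count M k" for k
  proof
    assume k: "k \<in> Ss ! p"
    have "{..p} \<subseteq> {p. p < ?r \<and> k \<in> Ss ! p}" using k nested[OF _ p] p by auto
    hence "card {..p} \<le> count M k" unfolding cnt by (intro card_mono) auto
    thus "p < count M k" by simp
  next
    assume lt: "p < count M k"
    show "k \<in> Ss ! p"
    proof (rule ccontr)
      assume "k \<notin> Ss ! p"
      hence "j < p" if "j < ?r" "k \<in> Ss ! j" for j using nested[of p j] that by (meson not_le subsetD)
      hence "{j. j < ?r \<and> k \<in> Ss ! j} \<subseteq> {..<p}" by blast
      hence "count M k \<le> card {..<p}" unfolding cnt by (intro card_mono) auto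
      thus False using lt by simp
    qed
  qed
  thus ?thesis by blast
qed

lemma card_level_set: "card {k. p < count M k} = size {#c \<in># shape M. p < c#}"
proof -
  have "size {#c \<in># shape M. p < c#} = card {k \<in> set_mset M. p < count M k}"
    by (simp add: shape_def filter_mset_image_mset)
  moreover have "{k \<in> set_mset M. p < count M k} = {k. p < count M k}"
    by (auto simp: count_greater_zero_iff[symmetric] simp del: count_greater_zero_iff)
  ultimately show ?thesis by simp
qed

text \<open>A multiplicity is the difference of two consecutive tail sizes.\<close>

lemma multiset_eq_by_tails:
  fixes X Y :: "nat multiset"
  assumes "0 \<notin># X" "0 \<notin># Y" "\<And>p. size {#c \<in># X. p < c#} = size {#c \<in># Y. p < c#}"
  shows "X = Y"
proof (rule multiset_eqI)
  have step: "size {#c \<in># X. p < c#} = size {#c \<in># X. Suc p < c#} + count X (Suc p)" for p and X :: "nat multiset"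
    by (induction X) auto
  fix c
  show "count X c = count Y c"
  proof (cases c)
    case 0
    thus ?thesis using assms(1,2) by (metis count_eq_zero_iff)
  next
    case (Suc p)
    thus ?thesis using step[of p X] step[of p Y] assms(3)[of p] assms(3)[of "Suc p"] by simp
  qed
qed

lemma level_set_sizes:
  assumes Ss: "Ss \<in> factorizations l M" and l: "is_partition l"
    and eq: "energy (shape_list M) = energy (conjugate l)"
  shows "size {#c \<in># shape M. p < c#} = (if p < length l then l ! p else 0)"
proof (cases "p < length l")
  case True
  thus ?thesis
    using factorization_level_sets[OF Ss l eq True] factorizations_nth(2)[OF Ss True]
    by (simp add: card_level_set[symmetric])
next
  case False
  have le: "count M k \<le> length l" for k
  proof -
    have "count M k = card {p. p < length l \<and> k \<in> Ss ! p}"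
      using count_total[of Ss k] factorizations_finite_mem(1)[OF Ss] Ss factorizations_nth(1)[OF Ss]
      by (simp add: factorizations_def)
    also have "\<dots> \<le> card {..<length l}" by (intro card_mono) auto
    finally show ?thesis by simp
  qed
  have "\<not> p < count M k" for k using le[of k] False by linarith
  hence "{k. p < count M k} = {}" by blast
  thus ?thesis using False by (simp add: card_level_set[symmetric])
qed

text \<open>If the energy is maximal, then the sizes of the level sets are the parts of \<open>l\<close>, and they determine
  the shape.\<close>

lemma expansion_coeff_triangular:
  assumes l: "is_partition l" and \<nu>: "is_partition \<nu>" and nz: "expansion_coeff l \<nu> \<noteq> 0"
  shows "\<nu> = conjugate l \<or> energy \<nu> < energy (conjugate l)"
proof -
  obtain M where M: "shape_list M = \<nu>"
  proof -
    \<comment> \<open>Every partition is the shape of a monomial, with its parts as exponents.\<close>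
    let ?M = "\<Sum>j<length \<nu>. replicate_mset (\<nu> ! j) j"
    have pos: "0 < \<nu> ! j" if "j < length \<nu>" for j using \<nu> that by (simp add: is_partition_def)
    have cnt: "count ?M j = (if j < length \<nu> then \<nu> ! j else 0)" for j
      by (simp add: count_sum)
    have "set_mset ?M = {..<length \<nu>}"
      using pos cnt by (auto simp: count_greater_zero_iff[symmetric] simp del: count_greater_zero_iff split: if_splits)
    hence "shape ?M = image_mset (\<lambda>j. \<nu> ! j) (mset_set {..<length \<nu>})"
      unfolding shape_def using cnt by (auto intro!: image_mset_cong)
    also have "\<dots> = mset (map (\<lambda>j. \<nu> ! j) [0..<length \<nu>])"
      by (simp add: lessThan_atLeast0 mset_upt)
    finally have "shape ?M = mset \<nu>" by (simp add: map_nth)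
    hence "shape_list ?M = \<nu>" using list_of_mset[OF \<nu>] by (simp add: shape_list_def)
    thus thesis by (rule that)
  qed
  obtain Ss where Ss: "Ss \<in> factorizations l M"
    using nz expansion_coeff_eq[of l M] M by (metis card.empty ex_in_conv)
  show ?thesis
  proof (cases "energy \<nu> = energy (conjugate l)")
    case True
    let ?M0 = "total (map (\<lambda>i. {1..i}) l)"
    have "shape M = shape ?M0"
    proof (rule multiset_eq_by_tails)
      fix p
      show "size {#c \<in># shape M. p < c#} = size {#c \<in># shape ?M0. p < c#}"
        using level_set_sizes[OF Ss l] level_set_sizes[OF initial_factorization l] True M
        by (simp add: conjugate_def)
    qed (rule zero_notin_shape)+
    thus ?thesis using M by (simp add: conjugate_def shape_list_def)
  next
    case False
    thus ?thesis using energy_factorization(1)[OF Ss] M by simp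
  qed
qed

lemma expansion_coeff_diagonal:
  assumes l: "is_partition l" shows "expansion_coeff l (conjugate l) = 1"
proof -
  let ?M0 = "total (map (\<lambda>i. {1..i}) l)"
  have "Ss = map (\<lambda>i. {1..i}) l" if Ss: "Ss \<in> factorizations l ?M0" for Ss
  proof (rule nth_equalityI)
    show "length Ss = length (map (\<lambda>i. {1..i}) l)" using factorizations_nth(1)[OF Ss] by simp
    fix p assume "p < length Ss"
    hence p: "p < length l" using factorizations_nth(1)[OF Ss] by simp
    show "Ss ! p = map (\<lambda>i. {1..i}) l ! p"
      using factorization_level_sets[OF Ss l _ p] factorization_level_sets[OF initial_factorization l _ p]
      by (simp add: conjugate_def)
  qed
  hence "factorizations l ?M0 = {map (\<lambda>i. {1..i}) l}" using initial_factorization by blast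
  thus ?thesis by (simp add: conjugate_def expansion_coeff_eq)
qed

text \<open>The parts of \<open>l\<close> are recovered as the sizes of the level sets.\<close>

lemma inj_on_conjugate: "inj_on conjugate {l. is_partition l}"
proof (rule inj_onI)
  fix l l' assume "l \<in> {l. is_partition l}" "l' \<in> {l. is_partition l}" and eq: "conjugate l = conjugate l'"
  hence l: "is_partition l" and l': "is_partition l'" by simp_all
  have "shape (total (map (\<lambda>i. {1..i}) l)) = shape (total (map (\<lambda>i. {1..i}) l'))"
    using eq by (simp add: conjugate_def shape_list_def list_of_inject)
  hence parts: "(if p < length l then l ! p else 0) = (if p < length l' then l' ! p else 0)" for p
    using level_set_sizes[OF initial_factorization l] level_set_sizes[OF initial_factorization l']
    by (simp add: conjugate_def)
  have pos: "p < length l \<Longrightarrow> 0 < l ! p" "p < length l' \<Longrightarrow> 0 < l' ! p" for p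
    using l l' by (auto simp: is_partition_def)
  have "p < length l \<longleftrightarrow> p < length l'" for p
    using parts[of p] pos[of p] by (auto split: if_splits)
  hence len: "length l = length l'" by (metis nat_neq_iff)
  show "l = l'"
  proof (rule nth_equalityI[OF len])
    fix i assume "i < length l"
    thus "l ! i = l' ! i" using parts[of i] len by simp
  qed
qed

lemma conjugate_partition: "conjugate l \<in> partitions_of (sum_list l)"
proof -
  have "size (total (map (\<lambda>i. {1..i}) l)) = sum_list l"
    using initial_factorization[of l] size_total by (auto simp: factorizations_def)
  thus ?thesis by (simp add: partitions_of_def conjugate_def is_partition_shape_list sum_list_shape_list)
qed

lemma conjugate_surj:
  assumes "is_partition \<nu>"
  shows "\<exists>l. is_partition l \<and> sum_list l = sum_list \<nu> \<and> conjugate l = \<nu>"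
proof -
  let ?P = "partitions_of (sum_list \<nu>)"
  have "conjugate ` ?P \<subseteq> ?P" using conjugate_partition by (auto simp: partitions_of_def)
  moreover have "inj_on conjugate ?P"
    by (rule inj_on_subset[OF inj_on_conjugate]) (auto simp: partitions_of_def)
  ultimately have "conjugate ` ?P = ?P" by (rule endo_inj_surj[OF finite_partitions_of])
  moreover have "\<nu> \<in> ?P" using assms by (simp add: partitions_of_def)
  ultimately obtain l where "l \<in> ?P" "conjugate l = \<nu>" by (metis imageE)
  thus ?thesis by (auto simp: partitions_of_def)
qed

section \<open>Evaluation at the generators\<close>

text \<open>Exponent vectors correspond to partitions: the exponent of the variable \<open>i\<close> is the multiplicity of the
  part \<open>i\<close>.\<close>

definition partition_of :: "(nat \<Rightarrow>\<^sub>0 nat) \<Rightarrow> nat list" where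
  "partition_of m = list_of (Abs_multiset (Poly_Mapping.lookup m))"

definition T_evaluation :: "((nat \<Rightarrow>\<^sub>0 nat) \<Rightarrow>\<^sub>0 rat poly) \<Rightarrow> nat list \<Rightarrow>\<^sub>0 rat poly" where
  "T_evaluation P = (\<Sum>m\<in>Poly_Mapping.keys P. scale (Poly_Mapping.lookup P m) (T_product (partition_of m)))"

lemma scale_simps:
  "scale 0 x = 0" "scale 1 x = x" "scale c 0 = 0"
  "scale (c + d) x = scale c x + scale d x" "scale c (x + y) = scale c x + scale c y"
  "scale c (scale d x) = scale (c * d) x"
  by (auto intro!: poly_mapping_eqI simp: lookup_scale lookup_add algebra_simps)

lemma scale_sum: "scale c (sum f I) = (\<Sum>i\<in>I. scale c (f i))"
  by (induction I rule: infinite_finite_induct) (auto simp: scale_simps)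

lemma count_partition_of: "count (mset (partition_of m)) = Poly_Mapping.lookup m"
  by (simp add: partition_of_def count_Abs_multiset)

lemma partition_of_inject: "partition_of m = partition_of m' \<longleftrightarrow> m = m'"
  by (metis count_partition_of poly_mapping_eq_iff)

lemma is_partition_partition_of:
  assumes "Poly_Mapping.keys m \<subseteq> {1..}" shows "is_partition (partition_of m)"
  unfolding partition_of_def
proof (rule is_partition_list_of)
  have "Poly_Mapping.lookup m 0 = 0" using assms by (auto simp: in_keys_iff)
  thus "0 \<notin># Abs_multiset (Poly_Mapping.lookup m)"
    by (simp add: not_in_iff count_Abs_multiset)
qed

lemma partition_of_surj:
  assumes "is_partition l"
  shows "\<exists>m. Poly_Mapping.keys m \<subseteq> {1..} \<and> partition_of m = l"
proof -
  let ?m = "Abs_poly_mapping (count (mset l))"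
  have "finite {x. count (mset l) x \<noteq> 0}"
    by (rule finite_subset[of _ "set l"]) (auto simp: count_eq_zero_iff[symmetric] simp del: count_eq_zero_iff)
  hence lk: "Poly_Mapping.lookup ?m = count (mset l)" by (rule lookup_Abs_poly_mapping)
  have "partition_of ?m = l" using list_of_mset[OF assms] by (simp add: partition_of_def lk)
  moreover have "Poly_Mapping.keys ?m \<subseteq> {1..}"
    using is_partition_nonzero[OF assms] by (auto simp: in_keys_iff lk Suc_le_eq intro: gr0I)
  ultimately show ?thesis by blast
qed

lemma T_product_partition_of_add:
  "T_product (partition_of (m + m'))
    = T_product (partition_of m) \<star> T_product (partition_of m')"
proof -
  have "mset (partition_of (m + m')) = mset (partition_of m @ partition_of m')"
    by (rule multiset_eqI) (simp add: count_partition_of lookup_add)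
  thus ?thesis using T_product_perm T_product_append by metis
qed

lemma T_evaluation_superset:
  assumes "finite K" "Poly_Mapping.keys P \<subseteq> K"
  shows "T_evaluation P = (\<Sum>m\<in>K. scale (Poly_Mapping.lookup P m) (T_product (partition_of m)))"
  unfolding T_evaluation_def using assms
  by (intro sum.mono_neutral_left) (auto simp: in_keys_iff scale_simps)

lemma T_evaluation_add: "T_evaluation (P + Q) = T_evaluation P + T_evaluation Q"
proof -
  let ?K = "Poly_Mapping.keys P \<union> Poly_Mapping.keys Q"
  have "Poly_Mapping.keys (P + Q) \<subseteq> ?K" by (rule keys_add)
  thus ?thesis
    by (simp add: T_evaluation_superset[of ?K] lookup_add scale_simps sum.distrib)
qed

lemma T_evaluation_scale: "T_evaluation (scale c P) = scale c (T_evaluation P)"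
proof -
  have "Poly_Mapping.keys (scale c P) \<subseteq> Poly_Mapping.keys P"
    by (auto simp: in_keys_iff lookup_scale)
  thus ?thesis
    by (simp add: T_evaluation_superset[of "Poly_Mapping.keys P"] lookup_scale scale_sum scale_simps)
qed

lemma T_evaluation_zero: "T_evaluation 0 = 0"
  by (simp add: T_evaluation_def)

lemma T_evaluation_sum: "T_evaluation (sum f I) = (\<Sum>i\<in>I. T_evaluation (f i))"
  by (induction I rule: infinite_finite_induct) (auto simp: T_evaluation_zero T_evaluation_add)

lemma T_evaluation_single: "T_evaluation (Poly_Mapping.single m c) = scale c (T_product (partition_of m))"
  by (simp add: T_evaluation_superset[of "{m}"])

lemma poly_mapping_sum_single:
  "P = (\<Sum>m\<in>Poly_Mapping.keys P. Poly_Mapping.single m (Poly_Mapping.lookup P m))"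
  by (rule poly_mapping_eqI) (auto simp: lookup_sum lookup_single when_def in_keys_iff)

lemma polynomial_algebra_carrierD:
  assumes "P \<in> carrier polynomial_algebra"
  shows "m \<in> Poly_Mapping.keys P \<Longrightarrow> Poly_Mapping.keys m \<subseteq> {1..}"
    and "Poly_Mapping.lookup P m \<in> carrier int_valued_polys"
proof -
  have *: "\<forall>m\<in>Poly_Mapping.keys P. Poly_Mapping.keys m \<subseteq> {1..} \<and> Poly_Mapping.lookup P m \<in> carrier int_valued_polys"
    using assms by (simp add: polynomial_algebra_def)
  show "m \<in> Poly_Mapping.keys P \<Longrightarrow> Poly_Mapping.keys m \<subseteq> {1..}" using * by blast
  show "Poly_Mapping.lookup P m \<in> carrier int_valued_polys"
    using * int_valued_polys_const(1) by (cases "m \<in> Poly_Mapping.keys P") (auto simp: in_keys_iff)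
qed

lemma polynomial_algebra_carrierI:
  assumes "\<And>m. Poly_Mapping.lookup P m \<noteq> 0 \<Longrightarrow> Poly_Mapping.keys m \<subseteq> {1..}"
    and "\<And>m. Poly_Mapping.lookup P m \<in> carrier int_valued_polys"
  shows "P \<in> carrier polynomial_algebra"
  using assms by (simp add: polynomial_algebra_def in_keys_iff)

lemma T_evaluation_closed:
  assumes "P \<in> carrier polynomial_algebra" shows "T_evaluation P \<in> carrier universal_hecke"
  unfolding T_evaluation_def
  by (intro universal_sum_closed universal_scale_closed T_product_closed polynomial_algebra_carrierD(2)[OF assms])

lemma universal_mult_sum:
  assumes "\<And>i. i \<in> I \<Longrightarrow> f i \<in> carrier universal_hecke" "y \<in> carrier universal_hecke"
  shows "sum f I \<star> y = (\<Sum>i\<in>I. f i \<star> y)"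
  by (rule specialization_ext)
    (use assms in \<open>simp_all add: universal_mult_closed universal_sum_closed specialization_mult base_matching_in
      specialization_sum sum_distrib_left sum.swap[of _ I]\<close>)

lemma T_evaluation_mult:
  assumes P: "P \<in> carrier polynomial_algebra" and Q: "Q \<in> carrier polynomial_algebra"
  shows "T_evaluation (P * Q) = T_evaluation P \<star> T_evaluation Q"
proof -
  let ?T = "\<lambda>m. T_product (partition_of m)"
  let ?p = "\<lambda>m. Poly_Mapping.lookup P m" and ?q = "\<lambda>m. Poly_Mapping.lookup Q m"
  note pc = polynomial_algebra_carrierD(2)[OF P] and qc = polynomial_algebra_carrierD(2)[OF Q]
  have Tc: "?T m \<in> carrier universal_hecke" for m by (rule T_product_closed)
  have product_term: "scale (?p m) (?T m) \<star> scale (?q m') (?T m')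
    = scale (?p m * ?q m') (?T m \<star> ?T m')" for m m'
  proof -
    have "scale (?p m) (?T m) \<star> scale (?q m') (?T m')
      = scale (?p m) (scale (?q m') (?T m') \<star> ?T m)"
      using universal_mult_scale[OF pc Tc universal_scale_closed[OF qc Tc]]
        universal_mult_commute[OF Tc universal_scale_closed[OF qc Tc]] by simp
    also have "\<dots> = scale (?p m * ?q m') (?T m \<star> ?T m')"
      using universal_mult_scale[OF qc Tc Tc] universal_mult_commute[OF Tc Tc] by (simp add: scale_simps)
    finally show ?thesis .
  qed
  have "P * Q = (\<Sum>m\<in>Poly_Mapping.keys P. \<Sum>m'\<in>Poly_Mapping.keys Q.
      Poly_Mapping.single (m + m') (?p m * ?q m'))"
    by (subst poly_mapping_sum_single[of P], subst poly_mapping_sum_single[of Q])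
      (simp add: sum_product mult_single)
  hence "T_evaluation (P * Q) = (\<Sum>m\<in>Poly_Mapping.keys P. \<Sum>m'\<in>Poly_Mapping.keys Q.
      scale (?p m) (?T m) \<star> scale (?q m') (?T m'))"
    by (simp add: T_evaluation_sum T_evaluation_single T_product_partition_of_add product_term)
  also have "\<dots> = (\<Sum>m\<in>Poly_Mapping.keys P. scale (?p m) (?T m) \<star> T_evaluation Q)"
  proof (rule sum.cong[OF refl])
    fix m
    have c: "scale (?p m) (?T m) \<in> carrier universal_hecke"
      "\<And>m'. scale (?q m') (?T m') \<in> carrier universal_hecke"
      by (rule universal_scale_closed[OF pc Tc], rule universal_scale_closed[OF qc Tc])
    have "scale (?p m) (?T m) \<star> T_evaluation Q
      = T_evaluation Q \<star> scale (?p m) (?T m)"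
      by (rule universal_mult_commute[OF c(1) T_evaluation_closed[OF Q]])
    also have "\<dots> = (\<Sum>m'\<in>Poly_Mapping.keys Q. scale (?q m') (?T m') \<star> scale (?p m) (?T m))"
      unfolding T_evaluation_def[of Q] by (rule universal_mult_sum[OF c(2) c(1)])
    finally show "(\<Sum>m'\<in>Poly_Mapping.keys Q. scale (?p m) (?T m) \<star> scale (?q m') (?T m'))
      = scale (?p m) (?T m) \<star> T_evaluation Q"
      using universal_mult_commute[OF c(1) c(2)] by simp
  qed
  also have "\<dots> = T_evaluation P \<star> T_evaluation Q"
    unfolding T_evaluation_def[of P]
    by (rule universal_mult_sum[symmetric]) (rule universal_scale_closed[OF pc Tc], rule T_evaluation_closed[OF Q])
  finally show ?thesis .
qed

subsection \<open>Surjectivity\<close>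

definition T_span :: "(nat list \<Rightarrow>\<^sub>0 rat poly) set" where
  "T_span = T_evaluation ` carrier polynomial_algebra"

lemma T_span_closed: "x \<in> T_span \<Longrightarrow> x \<in> carrier universal_hecke"
  using T_evaluation_closed by (auto simp: T_span_def)

lemma T_span_add:
  assumes "x \<in> T_span" "y \<in> T_span" shows "x + y \<in> T_span"
proof -
  obtain P Q where PQ: "P \<in> carrier polynomial_algebra" "Q \<in> carrier polynomial_algebra"
    "x = T_evaluation P" "y = T_evaluation Q" using assms by (auto simp: T_span_def)
  have "P + Q \<in> carrier polynomial_algebra"
  proof (rule polynomial_algebra_carrierI)
    fix m assume "Poly_Mapping.lookup (P + Q) m \<noteq> 0"
    hence "m \<in> Poly_Mapping.keys P \<or> m \<in> Poly_Mapping.keys Q" by (auto simp: in_keys_iff lookup_add)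
    thus "Poly_Mapping.keys m \<subseteq> {1..}" using polynomial_algebra_carrierD(1) PQ(1,2) by blast
  qed (simp add: lookup_add int_valued_polys_closed polynomial_algebra_carrierD(2) PQ)
  thus ?thesis unfolding PQ(3,4) T_span_def T_evaluation_add[symmetric] by (rule imageI)
qed

lemma T_span_scale:
  assumes c: "c \<in> carrier int_valued_polys" and "x \<in> T_span" shows "scale c x \<in> T_span"
proof -
  obtain P where P: "P \<in> carrier polynomial_algebra" "x = T_evaluation P"
    using assms by (auto simp: T_span_def)
  have "scale c P \<in> carrier polynomial_algebra"
  proof (rule polynomial_algebra_carrierI)
    fix m assume "Poly_Mapping.lookup (scale c P) m \<noteq> 0"
    hence "m \<in> Poly_Mapping.keys P" by (auto simp: in_keys_iff lookup_scale)
    thus "Poly_Mapping.keys m \<subseteq> {1..}" using polynomial_algebra_carrierD(1) P(1) by blast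
  qed (simp add: lookup_scale int_valued_polys_closed polynomial_algebra_carrierD(2) P c)
  thus ?thesis unfolding P(2) T_span_def T_evaluation_scale[symmetric] by (rule imageI)
qed

lemma T_span_zero: "0 \<in> T_span"
proof -
  have "0 \<in> carrier polynomial_algebra"
    by (rule polynomial_algebra_carrierI) (simp_all add: int_valued_polys_const)
  thus ?thesis using T_evaluation_zero by (metis T_span_def imageI)
qed

lemma T_span_sum: "(\<And>i. i \<in> I \<Longrightarrow> f i \<in> T_span) \<Longrightarrow> sum f I \<in> T_span"
  by (induction I rule: infinite_finite_induct) (auto simp: T_span_zero intro: T_span_add)

lemma T_span_diff:
  assumes "x \<in> T_span" "y \<in> T_span" shows "x - y \<in> T_span"
proof -
  have "scale (- 1) y \<in> T_span"
    using int_valued_polys_uminus[OF int_valued_polys_const(2)] assms(2) by (rule T_span_scale)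
  moreover have "scale (- 1) y = - y" by (rule poly_mapping_eqI) (simp add: lookup_scale)
  ultimately show ?thesis using T_span_add[OF assms(1), of "- y"] by simp
qed

lemma T_product_in_span:
  assumes "is_partition l" shows "T_product l \<in> T_span"
proof -
  obtain m where m: "Poly_Mapping.keys m \<subseteq> {1..}" "partition_of m = l"
    using partition_of_surj[OF assms] by blast
  have "Poly_Mapping.single m 1 \<in> carrier polynomial_algebra"
    by (rule polynomial_algebra_carrierI)
      (use m(1) in \<open>auto simp: lookup_single when_def int_valued_polys_const split: if_splits\<close>)
  moreover have "T_evaluation (Poly_Mapping.single m 1) = T_product l"
    by (simp add: T_evaluation_single m(2) scale_simps)
  ultimately show ?thesis by (metis T_span_def imageI)
qed

text \<open>Induction on the energy: the expansion of the product of generators indexed by the conjugate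
  partition is solved for its leading term.\<close>

lemma msum_in_span:
  assumes "is_partition \<nu>"
  shows "\<exists>x\<in>T_span. \<forall>n. \<forall>v\<in>matchings n. specialization n x base_matching v = msum n \<nu> v"
  using assms
proof (induction "energy \<nu>" arbitrary: \<nu> rule: less_induct)
  case less
  obtain l where l: "is_partition l" "sum_list l = sum_list \<nu>" "conjugate l = \<nu>"
    using conjugate_surj[OF less.prems] by blast
  let ?K = "{\<kappa> \<in> partitions_of (sum_list l). energy \<kappa> < energy \<nu>}"
  have "\<forall>\<kappa>\<in>?K. \<exists>x. x \<in> T_span \<and> (\<forall>n. \<forall>v\<in>matchings n. specialization n x base_matching v = msum n \<kappa> v)"
  proof
    fix \<kappa> assume "\<kappa> \<in> ?K"
    hence "energy \<kappa> < energy \<nu>" "is_partition \<kappa>" by (auto simp: partitions_of_def)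
    from less.hyps[OF this]
    show "\<exists>x. x \<in> T_span \<and> (\<forall>n. \<forall>v\<in>matchings n. specialization n x base_matching v = msum n \<kappa> v)" by blast
  qed
  from bchoice[OF this] obtain x where x: "\<And>\<kappa>. \<kappa> \<in> ?K \<Longrightarrow> x \<kappa> \<in> T_span"
    "\<And>\<kappa> n v. \<kappa> \<in> ?K \<Longrightarrow> v \<in> matchings n \<Longrightarrow> specialization n (x \<kappa>) base_matching v = msum n \<kappa> v" by blast
  define y where "y = T_product l - (\<Sum>\<kappa>\<in>?K. scale (of_nat (expansion_coeff l \<kappa>)) (x \<kappa>))"
  have "y \<in> T_span" unfolding y_def
    by (intro T_span_diff T_span_sum T_span_scale T_product_in_span l int_valued_polys_const x)
  moreover have "specialization n y base_matching v = msum n \<nu> v" if v: "v \<in> matchings n" for n v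
  proof -
    let ?f = "\<lambda>\<kappa>. of_nat (expansion_coeff l \<kappa>) * msum n \<kappa> v"
    have nu: "\<nu> \<in> partitions_of (sum_list l)" using less.prems l by (simp add: partitions_of_def)
    have "specialization n (T_product l) base_matching v = sum ?f (partitions_of (sum_list l))"
      by (rule specialization_T_product_msum[OF v])
    also have "\<dots> = sum ?f (insert \<nu> ?K)"
    proof (rule sum.mono_neutral_right[OF finite_partitions_of])
      show "insert \<nu> ?K \<subseteq> partitions_of (sum_list l)" using nu by blast
      show "\<forall>\<kappa>\<in>partitions_of (sum_list l) - insert \<nu> ?K. ?f \<kappa> = 0"
        using expansion_coeff_triangular[OF l(1)] l(3) by (auto simp: partitions_of_def)
    qed
    also have "\<dots> = ?f \<nu> + sum ?f ?K" using finite_partitions_of by simp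
    also have "?f \<nu> = msum n \<nu> v" using expansion_coeff_diagonal[OF l(1)] l(3) by simp
    finally show ?thesis by (simp add: y_def specialization_linear specialization_sum x(2)[OF _ v])
  qed
  ultimately show ?case by blast
qed

text \<open>The element of the universal ring that specializes to the monomial symmetric function of \<open>\<nu>\<close> at every
  level.\<close>

definition monomial_element :: "nat list \<Rightarrow> nat list \<Rightarrow>\<^sub>0 rat poly" where
  "monomial_element \<nu> =
    (SOME x. x \<in> T_span \<and> (\<forall>n. \<forall>v\<in>matchings n. specialization n x base_matching v = msum n \<nu> v))"

lemma monomial_element:
  assumes "is_partition \<nu>"
  shows "monomial_element \<nu> \<in> T_span"
    and "v \<in> matchings n \<Longrightarrow> specialization n (monomial_element \<nu>) base_matching v = msum n \<nu> v"
proof -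
  have "\<exists>x. x \<in> T_span \<and> (\<forall>n. \<forall>v\<in>matchings n. specialization n x base_matching v = msum n \<nu> v)"
    using msum_in_span[OF assms] by blast
  from someI_ex[OF this] show "monomial_element \<nu> \<in> T_span"
    and "v \<in> matchings n \<Longrightarrow> specialization n (monomial_element \<nu>) base_matching v = msum n \<nu> v"
    unfolding monomial_element_def by blast+
qed

text \<open>Encodes the order by size and then by length, as the length of a partition is at most its size.\<close>

definition rank :: "nat list \<Rightarrow> nat" where
  "rank \<nu> = sum_list \<nu> * (sum_list \<nu> + 1) + length \<nu>"

lemma length_le_sum: "is_partition \<nu> \<Longrightarrow> length \<nu> \<le> sum_list \<nu>"
proof -
  have "\<forall>x\<in>set \<nu>. 0 < x \<Longrightarrow> length \<nu> \<le> sum_list \<nu>" by (induction \<nu>) auto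
  thus "is_partition \<nu> \<Longrightarrow> length \<nu> \<le> sum_list \<nu>" by (simp add: is_partition_def)
qed

lemma rank_less:
  assumes "is_partition \<kappa>"
    and "sum_list \<kappa> < sum_list \<nu> \<or> sum_list \<kappa> = sum_list \<nu> \<and> length \<kappa> < length \<nu>"
  shows "rank \<kappa> < rank \<nu>"
  using assms(2)
proof
  assume lt: "sum_list \<kappa> < sum_list \<nu>"
  have "rank \<kappa> \<le> sum_list \<kappa> * (sum_list \<kappa> + 2)"
    using length_le_sum[OF assms(1)] by (simp add: rank_def algebra_simps)
  also have "\<dots> < (sum_list \<kappa> + 1) * (sum_list \<kappa> + 2)" by simp
  also have "\<dots> \<le> sum_list \<nu> * (sum_list \<nu> + 1)" using lt by (intro mult_mono) auto
  finally show ?thesis by (simp add: rank_def)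
qed (simp add: rank_def)

lemma monomial_element_diagonal:
  assumes \<nu>: "is_partition \<nu>"
  shows "Poly_Mapping.lookup (monomial_element \<nu>) \<nu> = 1"
proof (rule poly_eqI_nat[of "wt \<nu>"])
  fix n assume n: "wt \<nu> \<le> n"
  obtain v where v: "v \<in> matchings n" "stable_type base_matching v = \<nu>"
    using stable_type_exists[OF \<nu>] matchings_mono[OF n] by blast
  show "poly (Poly_Mapping.lookup (monomial_element \<nu>) \<nu>) (of_nat n) = poly 1 (of_nat n)"
    using monomial_element(2)[OF \<nu> v(1)] msum_diagonal[OF v(1)] v(2) by (simp add: specialization_def)
qed

lemma monomial_element_triangular:
  assumes \<nu>: "is_partition \<nu>" and nz: "Poly_Mapping.lookup (monomial_element \<nu>) \<kappa> \<noteq> 0"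
  shows "\<kappa> = \<nu> \<or> rank \<kappa> < rank \<nu>"
proof -
  have \<kappa>: "is_partition \<kappa>"
    using universal_hecke_carrierD(1)[OF T_span_closed[OF monomial_element(1)[OF \<nu>]]] nz by blast
  obtain n where n: "wt \<kappa> \<le> n" "poly (Poly_Mapping.lookup (monomial_element \<nu>) \<kappa>) (of_nat n) \<noteq> 0"
    using poly_eqI_nat[of "wt \<kappa>" "Poly_Mapping.lookup (monomial_element \<nu>) \<kappa>" 0] nz by auto
  obtain v where v: "v \<in> matchings n" "stable_type base_matching v = \<kappa>"
    using stable_type_exists[OF \<kappa>] matchings_mono[OF n(1)] by blast
  have "msum n \<nu> v \<noteq> 0" using monomial_element(2)[OF \<nu> v(1)] n(2) v(2) by (simp add: specialization_def)
  thus ?thesis using msum_triangular[OF v(1)] rank_less[OF \<kappa>] v(2) by blast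
qed

text \<open>Induction on the rank, again solving a unitriangular system for the leading term.\<close>

lemma basis_in_span:
  assumes "is_partition \<nu>" shows "Poly_Mapping.single \<nu> 1 \<in> T_span"
  using assms
proof (induction "rank \<nu>" arbitrary: \<nu> rule: less_induct)
  case less
  let ?e = "monomial_element \<nu>"
  let ?K = "Poly_Mapping.keys ?e - {\<nu>}"
  note e = monomial_element(1)[OF less.prems]
  have "?e = (\<Sum>\<kappa>\<in>Poly_Mapping.keys ?e. Poly_Mapping.single \<kappa> (Poly_Mapping.lookup ?e \<kappa>))"
    by (rule poly_mapping_sum_single)
  also have "\<dots> = Poly_Mapping.single \<nu> 1 + (\<Sum>\<kappa>\<in>?K. Poly_Mapping.single \<kappa> (Poly_Mapping.lookup ?e \<kappa>))"
    using monomial_element_diagonal[OF less.prems]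
    by (subst sum.remove[of _ \<nu>]) (auto simp: in_keys_iff)
  also have "(\<Sum>\<kappa>\<in>?K. Poly_Mapping.single \<kappa> (Poly_Mapping.lookup ?e \<kappa>))
    = (\<Sum>\<kappa>\<in>?K. scale (Poly_Mapping.lookup ?e \<kappa>) (Poly_Mapping.single \<kappa> 1))"
    by (intro sum.cong refl poly_mapping_eqI) (simp add: lookup_scale lookup_single when_def)
  finally have eq: "Poly_Mapping.single \<nu> 1
    = ?e - (\<Sum>\<kappa>\<in>?K. scale (Poly_Mapping.lookup ?e \<kappa>) (Poly_Mapping.single \<kappa> 1))"
    by (simp add: algebra_simps)
  have "scale (Poly_Mapping.lookup ?e \<kappa>) (Poly_Mapping.single \<kappa> 1) \<in> T_span" if "\<kappa> \<in> ?K" for \<kappa>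
  proof (rule T_span_scale[OF universal_hecke_carrierD(2)[OF T_span_closed[OF e]]])
    have nz: "Poly_Mapping.lookup ?e \<kappa> \<noteq> 0" using that by (simp add: in_keys_iff)
    hence "is_partition \<kappa>" using universal_hecke_carrierD(1)[OF T_span_closed[OF e]] by blast
    moreover have "rank \<kappa> < rank \<nu>" using monomial_element_triangular[OF less.prems nz] that by blast
    ultimately show "Poly_Mapping.single \<kappa> 1 \<in> T_span" by (rule less.hyps[rotated])
  qed
  thus ?case unfolding eq by (intro T_span_diff e T_span_sum)
qed

lemma T_evaluation_surj: "T_evaluation ` carrier polynomial_algebra = carrier universal_hecke"
proof
  show "T_evaluation ` carrier polynomial_algebra \<subseteq> carrier universal_hecke"
    using T_evaluation_closed by blast
  show "carrier universal_hecke \<subseteq> T_evaluation ` carrier polynomial_algebra"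
  proof
    fix x assume x: "x \<in> carrier universal_hecke"
    have "x = (\<Sum>\<kappa>\<in>Poly_Mapping.keys x. scale (Poly_Mapping.lookup x \<kappa>) (Poly_Mapping.single \<kappa> 1))"
      by (rule poly_mapping_eqI) (auto simp: lookup_sum lookup_scale lookup_single when_def in_keys_iff)
    moreover have "\<dots> \<in> T_span"
    proof (rule T_span_sum)
      fix \<kappa> assume "\<kappa> \<in> Poly_Mapping.keys x"
      hence "is_partition \<kappa>" using universal_hecke_carrierD(1)[OF x] by (auto simp: in_keys_iff)
      thus "scale (Poly_Mapping.lookup x \<kappa>) (Poly_Mapping.single \<kappa> 1) \<in> T_span"
        by (intro T_span_scale basis_in_span universal_hecke_carrierD(2)[OF x])
    qed
    ultimately show "x \<in> T_evaluation ` carrier polynomial_algebra" by (simp add: T_span_def)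
  qed
qed

subsection \<open>Injectivity\<close>

text \<open>In a vanishing combination, look at the pivot of an index of largest weight among those with a nonzero
  coefficient: no other term contributes there.\<close>

lemma unitriangular_independent:
  fixes c :: "'i \<Rightarrow> 'r::comm_ring_1" and f :: "'i \<Rightarrow> nat"
  assumes fin: "finite I"
    and diag: "\<And>i. i \<in> I \<Longrightarrow> A i (pivot i) = 1"
    and tri: "\<And>i i'. i \<in> I \<Longrightarrow> i' \<in> I \<Longrightarrow> A i' (pivot i) \<noteq> 0 \<Longrightarrow> i = i' \<or> f i < f i'"
    and zero: "\<And>i. i \<in> I \<Longrightarrow> (\<Sum>i'\<in>I. c i' * A i' (pivot i)) = 0"
    and i: "i \<in> I"
  shows "c i = 0"
proof (rule ccontr)
  assume "c i \<noteq> 0"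
  let ?J = "{i \<in> I. c i \<noteq> 0}"
  have J: "finite ?J" "?J \<noteq> {}" using fin i \<open>c i \<noteq> 0\<close> by auto
  have "Max (f ` ?J) \<in> f ` ?J" using J by (intro Max_in) auto
  then obtain k where k: "k \<in> ?J" and fk: "f k = Max (f ` ?J)" by auto
  have max: "f j \<le> f k" if "j \<in> ?J" for j
    unfolding fk using J that by (intro Max_ge) auto
  have "(\<Sum>i'\<in>I. c i' * A i' (pivot k)) = (\<Sum>i'\<in>{k}. c i' * A i' (pivot k))"
  proof (rule sum.mono_neutral_right[OF fin])
    show "\<forall>i'\<in>I - {k}. c i' * A i' (pivot k) = 0"
    proof
      fix i' assume i': "i' \<in> I - {k}"
      show "c i' * A i' (pivot k) = 0"
      proof (cases "c i' = 0")
        case False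
        hence "f i' \<le> f k" using max i' by simp
        hence "A i' (pivot k) = 0" using tri[of k i'] k i' by auto
        thus ?thesis by simp
      qed simp
    qed
  qed (use k in simp)
  hence "c k = 0" using zero[of k] diag[of k] k by simp
  thus False using k by simp
qed

lemma T_product_monomial_elements:
  "T_product l = (\<Sum>\<kappa>\<in>partitions_of (sum_list l). scale (of_nat (expansion_coeff l \<kappa>)) (monomial_element \<kappa>))"
proof (rule specialization_ext[OF T_product_closed])
  have p: "is_partition \<kappa>" if "\<kappa> \<in> partitions_of (sum_list l)" for \<kappa>
    using that by (simp add: partitions_of_def)
  show "(\<Sum>\<kappa>\<in>partitions_of (sum_list l). scale (of_nat (expansion_coeff l \<kappa>)) (monomial_element \<kappa>)) \<in> carrier universal_hecke"
    by (intro universal_sum_closed universal_scale_closed int_valued_polys_const T_span_closed monomial_element(1) p)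
  fix n v assume v: "v \<in> matchings n"
  show "specialization n (T_product l) base_matching v = specialization n (\<Sum>\<kappa>\<in>partitions_of (sum_list l).
      scale (of_nat (expansion_coeff l \<kappa>)) (monomial_element \<kappa>)) base_matching v"
    unfolding specialization_T_product_msum[OF v] specialization_sum specialization_linear
    by (intro sum.cong refl) (simp add: monomial_element(2)[OF p v])
qed

text \<open>Independence is used twice: that of the monomial elements shows that the coefficients \<open>d \<kappa>\<close> of the
  rewritten relation vanish, and then unitriangularity in the energy shows that those of \<open>P\<close> vanish.\<close>

lemma T_evaluation_kernel:
  assumes P: "P \<in> carrier polynomial_algebra" and zero: "T_evaluation P = 0"
  shows "P = 0"
proof -
  let ?I = "Poly_Mapping.keys P" and ?l = partition_of
  let ?E = "\<lambda>m \<kappa>. if sum_list \<kappa> = sum_list (?l m) then of_nat (expansion_coeff (?l m) \<kappa>) else (0 :: rat poly)"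
  define K where "K = (\<Union>m\<in>?I. partitions_of (sum_list (?l m)))"
  have finK: "finite K" unfolding K_def by (simp add: finite_partitions_of)
  have Kp: "is_partition \<kappa>" if "\<kappa> \<in> K" for \<kappa> using that by (auto simp: K_def partitions_of_def)
  have l: "is_partition (?l m)" if "m \<in> ?I" for m
    by (rule is_partition_partition_of[OF polynomial_algebra_carrierD(1)[OF P that]])
  have T: "T_product (?l m) = (\<Sum>\<kappa>\<in>K. scale (?E m \<kappa>) (monomial_element \<kappa>))" if m: "m \<in> ?I" for m
  proof -
    have "T_product (?l m) = (\<Sum>\<kappa>\<in>partitions_of (sum_list (?l m)). scale (?E m \<kappa>) (monomial_element \<kappa>))"
      unfolding T_product_monomial_elements[of "?l m"] by (intro sum.cong) (auto simp: partitions_of_def)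
    also have "\<dots> = (\<Sum>\<kappa>\<in>K. scale (?E m \<kappa>) (monomial_element \<kappa>))"
    proof (rule sum.mono_neutral_left[OF finK])
      show "partitions_of (sum_list (?l m)) \<subseteq> K" unfolding K_def using m by blast
      show "\<forall>\<kappa>\<in>K - partitions_of (sum_list (?l m)). scale (?E m \<kappa>) (monomial_element \<kappa>) = 0"
      proof
        fix \<kappa> assume "\<kappa> \<in> K - partitions_of (sum_list (?l m))"
        hence "sum_list \<kappa> \<noteq> sum_list (?l m)" using Kp by (auto simp: partitions_of_def)
        thus "scale (?E m \<kappa>) (monomial_element \<kappa>) = 0" by (simp add: scale_simps)
      qed
    qed
    finally show ?thesis .
  qed
  define d where "d \<kappa> = (\<Sum>m\<in>?I. Poly_Mapping.lookup P m * ?E m \<kappa>)" for \<kappa>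
  have "0 = (\<Sum>m\<in>?I. scale (Poly_Mapping.lookup P m) (\<Sum>\<kappa>\<in>K. scale (?E m \<kappa>) (monomial_element \<kappa>)))"
    using zero unfolding T_evaluation_def by (simp add: T)
  also have "\<dots> = (\<Sum>\<kappa>\<in>K. scale (d \<kappa>) (monomial_element \<kappa>))"
  proof -
    have ss: "scale (\<Sum>m\<in>?I. g m) x = (\<Sum>m\<in>?I. scale (g m) x)" for g and x :: "nat list \<Rightarrow>\<^sub>0 rat poly"
      by (rule poly_mapping_eqI) (simp add: lookup_scale lookup_sum sum_distrib_right)
    show ?thesis unfolding scale_sum d_def ss scale_simps(6) by (rule sum.swap)
  qed
  finally have sum0: "(\<Sum>\<kappa>\<in>K. scale (d \<kappa>) (monomial_element \<kappa>)) = 0" by simp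
  have d0: "d \<kappa> = 0" if \<kappa>: "\<kappa> \<in> K" for \<kappa>
  proof (rule unitriangular_independent[of K "\<lambda>\<kappa>. Poly_Mapping.lookup (monomial_element \<kappa>)" "\<lambda>\<kappa>. \<kappa>" rank d, OF finK])
    fix \<kappa>
    have "Poly_Mapping.lookup (\<Sum>\<kappa>'\<in>K. scale (d \<kappa>') (monomial_element \<kappa>')) \<kappa> = 0" by (simp add: sum0)
    thus "(\<Sum>\<kappa>'\<in>K. d \<kappa>' * Poly_Mapping.lookup (monomial_element \<kappa>') \<kappa>) = 0"
      by (simp add: lookup_sum lookup_scale)
  qed (use monomial_element_diagonal monomial_element_triangular Kp \<kappa> in auto)
  have "Poly_Mapping.lookup P m = 0" if m: "m \<in> ?I" for m
  proof (rule unitriangular_independent[of ?I ?E "\<lambda>m. conjugate (?l m)" "\<lambda>m. energy (conjugate (?l m))" "Poly_Mapping.lookup P", OF finite_keys])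
    have conj: "is_partition (conjugate l)" "sum_list (conjugate l) = sum_list l" for l
      using conjugate_partition[of l] by (simp_all add: partitions_of_def)
    fix m assume m: "m \<in> ?I"
    show "?E m (conjugate (?l m)) = 1" using expansion_coeff_diagonal[OF l[OF m]] conj by simp
    have "conjugate (?l m) \<in> K" unfolding K_def using m conjugate_partition by blast
    from d0[OF this] show "(\<Sum>m'\<in>?I. Poly_Mapping.lookup P m' * ?E m' (conjugate (?l m))) = 0"
      by (simp add: d_def)
    fix m' assume m': "m' \<in> ?I" and nz: "?E m' (conjugate (?l m)) \<noteq> 0"
    have "expansion_coeff (?l m') (conjugate (?l m)) \<noteq> 0" using nz by (auto split: if_splits)
    hence "conjugate (?l m) = conjugate (?l m') \<or> energy (conjugate (?l m)) < energy (conjugate (?l m'))"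
      by (rule expansion_coeff_triangular[OF l[OF m'] conj(1)])
    moreover have "m = m'" if "conjugate (?l m) = conjugate (?l m')"
      using inj_onD[OF inj_on_conjugate that] l m m' partition_of_inject by auto
    ultimately show "m = m' \<or> energy (conjugate (?l m)) < energy (conjugate (?l m'))" by blast
  qed (rule m)
  thus ?thesis by (intro poly_mapping_eqI) (auto simp: in_keys_iff)
qed

lemma polynomial_algebra_ops:
  "P \<otimes>\<^bsub>polynomial_algebra\<^esub> Q = P * Q" "P \<oplus>\<^bsub>polynomial_algebra\<^esub> Q = P + Q"
  "\<one>\<^bsub>polynomial_algebra\<^esub> = 1" "c \<odot>\<^bsub>polynomial_algebra\<^esub> P = scale c P"
  by (simp_all add: polynomial_algebra_def)

lemma T_evaluation_inj: "inj_on T_evaluation (carrier polynomial_algebra)"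
proof (rule inj_onI)
  fix P Q assume PQ: "P \<in> carrier polynomial_algebra" "Q \<in> carrier polynomial_algebra"
    and eq: "T_evaluation P = T_evaluation Q"
  have "P - Q \<in> carrier polynomial_algebra"
  proof (rule polynomial_algebra_carrierI)
    fix m assume "Poly_Mapping.lookup (P - Q) m \<noteq> 0"
    hence "m \<in> Poly_Mapping.keys P \<or> m \<in> Poly_Mapping.keys Q" by (auto simp: in_keys_iff lookup_minus)
    thus "Poly_Mapping.keys m \<subseteq> {1..}" using polynomial_algebra_carrierD(1) PQ by blast
  next
    fix m
    have "Poly_Mapping.lookup P m + - Poly_Mapping.lookup Q m \<in> carrier int_valued_polys"
      by (intro int_valued_polys_closed int_valued_polys_uminus polynomial_algebra_carrierD(2) PQ)
    thus "Poly_Mapping.lookup (P - Q) m \<in> carrier int_valued_polys" by (simp add: lookup_minus)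
  qed
  moreover have "T_evaluation (P - Q) = 0"
    using T_evaluation_add[of "P - Q" Q] eq by simp
  ultimately have "P - Q = 0" by (rule T_evaluation_kernel)
  thus "P = Q" by simp
qed

lemma T_evaluation_one: "T_evaluation 1 = \<one>\<^bsub>universal_hecke\<^esub>"
proof -
  have "partition_of 0 = []"
    by (metis count_partition_of lookup_zero count_empty multiset_eqI mset_zero_iff)
  moreover have "T_evaluation 1 = T_evaluation (Poly_Mapping.single 0 1)" by simp
  ultimately show ?thesis unfolding T_evaluation_single scale_simps by (simp add: T_product_def)
qed

lemma T_evaluation_var: "T_evaluation (poly_var i) = hecke_T i"
proof -
  let ?m = "Poly_Mapping.single i (1::nat)"
  have "mset (partition_of ?m) = mset [i]"
    by (rule multiset_eqI) (simp add: count_partition_of lookup_single when_def)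
  hence "T_product (partition_of ?m) = T_product [i]" by (rule T_product_perm)
  also have "\<dots> = hecke_T i"
    using universal_mult_commute[OF hecke_T_closed, of "\<one>\<^bsub>universal_hecke\<^esub>" i]
      universal_mult_one[OF hecke_T_closed, of i] universal_const_closed(2)[OF is_partition_Nil]
    by (simp add: T_product_def universal_hecke_ops)
  finally show ?thesis by (simp add: poly_var_def T_evaluation_single scale_simps)
qed

theorem theorem4p8:
  shows "freely_generated_by universal_hecke hecke_T"
  unfolding freely_generated_by_def
proof (intro conjI bexI[of _ T_evaluation] ballI allI impI)
  show "algebra int_valued_polys universal_hecke" by (rule algebra_universal_hecke)
  show "T_evaluation \<in> ring_iso polynomial_algebra universal_hecke"
  proof (rule ring_iso_memI)
    show "bij_betw T_evaluation (carrier polynomial_algebra) (carrier universal_hecke)"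
      by (simp add: bij_betw_def T_evaluation_inj T_evaluation_surj)
  qed (simp_all add: polynomial_algebra_ops universal_hecke_ops(1) T_evaluation_closed T_evaluation_mult
      T_evaluation_add T_evaluation_one)
qed (simp_all add: polynomial_algebra_ops universal_hecke_ops T_evaluation_scale T_evaluation_var)

end
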